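(* Let $X$ be a complex Banach space and let $x=(x_n)_{n\ge0}\in \ell^\infty(\mathbb{Z}_+;X)$ be such that $$\sup_{n\geq0}\bigg\|\sum_{k=0}^n x_k\bigg\|<\infty.$$ Let $G_x:\mathbb{E}\to X$ be the holomorphic function $G_x(\lambda)=\sum_{n\ge0}x_n\lambda^{-(n+1)}$, $|\lambda|>1$. If $G_x$ admits a boundary function $F_x\in L^1_{\mathrm{loc}}(\mathbb{T}\setminus\{1\};X)$, then $x\in c_0(\mathbb{Z}_+;X)$, that is, $\|x_n\|\to0$ as $n\to\infty$. Moreover, given a continuous non-increasing function $m:(0,\pi]\to[1,\infty)$, the following hold whenever $x=(x_n)_{n\ge0}\in \ell^\infty(\mathbb{Z}_+;X)$ satisfies $\sup_{n\geq0}\big\|\sum_{k=0}^n x_k\big\|<\infty$ and the holomorphic function $G_x(\lambda)=\sum_{n\ge0}x_n\lambda^{-(n+1)}$, $|\lambda|>1$, admits a boundary function $F_x\in L^1_{\mathrm{loc}}(\mathbb{T}\setminus\{1\};X)$. (a) Suppose that $F_x\in C^k(\mathbb{T}\setminus\{1\};X)$ for some $k\ge1$ and that $$\| F_x^{(j)}(\mathrm{e}^{\mathrm{i}\theta})\|\le C |\theta|^{\ell-j}m(|\theta|)^{\ell+1},\quad 0<|\theta|\le\pi,\;0\le j\le\ell\le k,$$ for some constant $C>0$. Then, for any $c>0$, $$\|x_n\|=O\left(m_k^{-1}(cn)\right),\quad n\to\infty,$$ where $m_k^{-1}$ is the inverse function of the map $m_k$ defined by $$m_k(\varepsilon)=m(\varepsilon)\left(\frac{m(\varepsilon)}{\varepsilon}\right)^{1/k},\quad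 0<\varepsilon\le\pi.$$ (b) Suppose that $F_x\in C^\infty(\mathbb{T}\setminus\{1\};X)$ and that $$\| F_x^{(j)}(\mathrm{e}^{\mathrm{i}\theta})\|\le C j!\,|\theta|\, m(|\theta|)^{j+1},\quad 0<|\theta|\le\pi,\;j\ge0,$$ for some constant $C>0$. Then, for any $c\in(0,1)$, $$\|x_n\|=O\left(m_{\mathrm{log}}^{-1}(cn)+\frac{1}{n}\right),\quad n\to\infty,$$ where $m_{\mathrm{log}}^{-1}$ is the inverse function of the map $m_{\mathrm{log}}$ defined by $$m_{\mathrm{log}}(\varepsilon)=m(\varepsilon)\log\left(1+\frac{m(\varepsilon)}{\varepsilon}\right),\quad 0<\varepsilon\le\pi.$$
   Context: Notation: $\mathbb{Z}_+=\{0,1,2,\dots\}$; $\mathbb{T}=\{\lambda\in\mathbb{C}:|\lambda|=1\}$; $\mathbb{E}=\{\lambda\in\mathbb{C}:|\lambda|>1\}$. $\ell^\infty(\mathbb{Z}_+;X)$ and $c_0(\mathbb{Z}_+;X)$ are the spaces of bounded, respectively norm-null, $X$-valued sequences. Let $C_0(-\pi,\pi)$ denote the set of continuous functions $\psi:[-\pi,\pi]\to\mathbb{C}$ which vanish in a neighbourhood of zero and satisfy $\psi(-\pi)=\psi(\pi)$. Let $L^1_{\mathrm{loc}}(\mathbb{T}\setminus\{1\};X)$ denote the set of functions $F:\mathbb{T}\setminus\{1\}\to X$ such that for every $\psi\in C_0(-\pi,\pi)$ the map $\theta\mapsto\psi(\theta)F(\mathrm{e}^{\mathrm{i}\theta})$,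 interpreted as taking the value zero where $\psi$ does, lies in $L^1(-\pi,\pi;X)$. Given a holomorphic function $G:\mathbb{E}\to X$ and $F\in L^1_{\mathrm{loc}}(\mathbb{T}\setminus\{1\};X)$, $F$ is said to be a boundary function for $G$ if $$\lim_{r\to1+}\int_{-\pi}^\pi \psi(\theta)G(r\mathrm{e}^{\mathrm{i}\theta})\,\mathrm{d}\theta=\int_{-\pi}^\pi \psi(\theta)F(\mathrm{e}^{\mathrm{i}\theta})\,\mathrm{d}\theta\quad\text{for all }\psi\in C_0(-\pi,\pi).$$ For $k\ge1$, $C^k(\mathbb{T}\setminus\{1\};X)$ is the set of functions $F:\mathbb{T}\setminus\{1\}\to X$ which are $k$-times continuously differentiable, with $\mathbb{T}\setminus\{1\}$ viewed as a one-dimensional manifold, and $C^\infty(\mathbb{T}\setminus\{1\};X)=\bigcap_{k\ge1}C^k(\mathbb{T}\setminus\{1\};X)$. Derivatives $F^{(j)}$ are taken with respect to the variable $\lambda=\mathrm{e}^{\mathrm{i}\theta}$ along the circle, i.e. $F^{(0)}=F$ and $\frac{\mathrm{d}}{\mathrm{d}\theta}\big[F^{(j)}(\mathrm{e}^{\mathrm{i}\theta})\big]=\mathrm{i}\mathrm{e}^{\mathrm{i}\theta}F^{(j+1)}(\mathrm{e}^{\mathrm{i}\theta})$. The maps $m_k$ and $m_{\mathrm{log}}$ are continuous and strictly decreasing on $(0,\pi]$ and tend to infinity at $0+$, so their inverses are defined on their ranges, and in particular at $cn$ for all sufficiently large $n$. For sequences $(a_n)$, $(b_n)$ of non-negative terms,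 $a_n=O(b_n)$, $n\to\infty$, means that there exists a constant $K>0$ such that $a_n\le K b_n$ for all sufficiently large $n\ge0$. *)

theory Defs
  imports "HOL-Analysis.Analysis" "HOL-Library.Landau_Symbols"
begin

class complex_banach = banach +
  fixes scaleC :: "complex \<Rightarrow> 'a \<Rightarrow> 'a"  (infixr "*\<^sub>C" 75)
  assumes scaleC_add_right: "a *\<^sub>C (x + y) = a *\<^sub>C x + a *\<^sub>C y"
    and scaleC_add_left: "(a + b) *\<^sub>C x = a *\<^sub>C x + b *\<^sub>C x"
    and scaleC_scaleC: "a *\<^sub>C b *\<^sub>C x = (a * b) *\<^sub>C x"
    and scaleC_of_real: "complex_of_real r *\<^sub>C x = r *\<^sub>R x"
    and norm_scaleC: "norm (a *\<^sub>C x) = cmod a * norm x"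

instantiation complex :: complex_banach
begin

definition scaleC_complex :: "complex \<Rightarrow> complex \<Rightarrow> complex"
  where "scaleC_complex a x = a * x"

instance
  by standard (simp_all add: scaleC_complex_def algebra_simps norm_mult scaleR_conv_of_real)

end

text \<open>The library's \<^const>\<open>has_bochner_integral\<close> is restricted to separable range spaces
  (class \<^class>\<open>second_countable_topology\<close>). The definitions below are the library's ones without
  this restriction; approximability in mean by simple functions makes every integrable function
  almost everywhere separably valued. The two abbreviations reopen constants that the library hides.\<close>

abbreviation (input) "simple_bochner_integrable \<equiv> Bochner_Integration.simple_bochner_integrable"
abbreviation (input) "simple_bochner_integral \<equiv> Bochner_Integration.simple_bochner_integral"

definition has_Bochner :: "'b measure \<Rightarrow> ('b \<Rightarrow> 'a::real_normed_vector) \<Rightarrow> 'a \<Rightarrow> bool" where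
  "has_Bochner M f y \<longleftrightarrow>
     f \<in> borel_measurable M \<and>
     (\<exists>s. (\<forall>i::nat. simple_bochner_integrable M (s i)) \<and>
          (\<lambda>i. \<integral>\<^sup>+ t. ennreal (norm (f t - s i t)) \<partial>M) \<longlonglongrightarrow> 0 \<and>
          (\<lambda>i. simple_bochner_integral M (s i)) \<longlonglongrightarrow> y)"

definition Bochner_integrable :: "'b measure \<Rightarrow> ('b \<Rightarrow> 'a::real_normed_vector) \<Rightarrow> bool" where
  "Bochner_integrable M f \<longleftrightarrow> (\<exists>y. has_Bochner M f y)"

definition Bochner_integral :: "'b measure \<Rightarrow> ('b \<Rightarrow> 'a::real_normed_vector) \<Rightarrow> 'a" where
  "Bochner_integral M f =
     (if Bochner_integrable M f then THE y. has_Bochner M f y else 0)"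

lemma has_Bochner_iff_has_bochner_integral:
  fixes f :: "'b \<Rightarrow> 'a::{real_normed_vector, second_countable_topology}"
  shows "has_Bochner M f y \<longleftrightarrow> has_bochner_integral M f y"
  unfolding has_Bochner_def has_bochner_integral.simps by blast

lemma borel_measurable_norm_diff_simple:
  fixes f s :: "'b \<Rightarrow> 'a::real_normed_vector"
  assumes f: "f \<in> borel_measurable M" and s: "simple_bochner_integrable M s"
  shows "(\<lambda>t. norm (f t - s t)) \<in> borel_measurable M"
proof -
  have sf: "simple_function M s"
    using s by (auto elim: simple_bochner_integrable.cases)
  have 1: "(\<lambda>t. norm (f t - a)) \<in> borel_measurable M" for a
    by (rule borel_measurable_continuous_on[OF _ f]) (intro continuous_intros)
  have 2: "s \<in> measurable M (count_space (s ` space M))"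
    using sf by (simp add: measurable_count_space_eq2 simple_function_def)
  show ?thesis
    by (rule measurable_compose_countable'[where f = "\<lambda>a t. norm (f t - a)", OF 1 2
          countable_finite[OF simple_functionD(1)[OF sf]]])
qed

lemma has_Bochner_unique:
  fixes f :: "'b \<Rightarrow> 'a::real_normed_vector"
  assumes "has_Bochner M f y" and "has_Bochner M f z"
  shows "y = z"
proof -
  from assms(1) obtain s where f: "f \<in> borel_measurable M"
    and s: "\<And>i::nat. simple_bochner_integrable M (s i)"
    and s0: "(\<lambda>i. \<integral>\<^sup>+ t. ennreal (norm (f t - s i t)) \<partial>M) \<longlonglongrightarrow> 0"
    and sy: "(\<lambda>i. simple_bochner_integral M (s i)) \<longlonglongrightarrow> y"
    unfolding has_Bochner_def by blast
  from assms(2) obtain u where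
        u: "\<And>i::nat. simple_bochner_integrable M (u i)"
    and u0: "(\<lambda>i. \<integral>\<^sup>+ t. ennreal (norm (f t - u i t)) \<partial>M) \<longlonglongrightarrow> 0"
    and uz: "(\<lambda>i. simple_bochner_integral M (u i)) \<longlonglongrightarrow> z"
    unfolding has_Bochner_def by blast
  let ?S = "\<lambda>i. \<integral>\<^sup>+ t. ennreal (norm (f t - s i t)) \<partial>M"
  let ?U = "\<lambda>i. \<integral>\<^sup>+ t. ennreal (norm (f t - u i t)) \<partial>M"
  have tri: "norm (b - c) \<le> norm (a - b) + norm (a - c)" for a b c :: 'a
    using norm_triangle_ineq4[of "a - c" "a - b"] by simp
  have le: "ennreal (norm (simple_bochner_integral M (s i) - simple_bochner_integral M (u i)))
      \<le> ?S i + ?U i" for i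
  proof -
    have d: "simple_bochner_integrable M (\<lambda>t. s i t - u i t)"
      using s u by (rule simple_bochner_integrable_compose2[where p = "(-)", rotated]) simp
    have "ennreal (norm (simple_bochner_integral M (s i) - simple_bochner_integral M (u i)))
        = ennreal (norm (simple_bochner_integral M (\<lambda>t. s i t - u i t)))"
      using s u by (simp add: simple_bochner_integral_diff)
    also have "\<dots> \<le> ennreal (simple_bochner_integral M (\<lambda>t. norm (s i t - u i t)))"
      using d by (intro ennreal_leI simple_bochner_integral_norm_bound)
    also have "\<dots> = (\<integral>\<^sup>+ t. ennreal (norm (s i t - u i t)) \<partial>M)"
      using simple_bochner_integrable_compose2[OF _ s u, of "\<lambda>a b. norm (a - b)"]
      by (intro simple_bochner_integral_eq_nn_integral) auto
    also have "\<dots> \<le> (\<integral>\<^sup>+ t. ennreal (norm (f t - s i t)) + ennreal (norm (f t - u i t)) \<partial>M)"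
      by (intro nn_integral_mono) (simp add: tri flip: ennreal_plus)
    also have "\<dots> = ?S i + ?U i"
      using borel_measurable_norm_diff_simple[OF f s] borel_measurable_norm_diff_simple[OF f u]
      by (intro nn_integral_add) auto
    finally show ?thesis .
  qed
  have lim: "(\<lambda>i. ?S i + ?U i) \<longlonglongrightarrow> 0"
    using tendsto_add[OF s0 u0] by simp
  have "(\<lambda>i. ennreal (norm (simple_bochner_integral M (s i)
      - simple_bochner_integral M (u i)))) \<longlonglongrightarrow> ennreal 0"
    unfolding ennreal_0
    by (rule tendsto_sandwich[OF always_eventually always_eventually tendsto_const lim])
      (rule allI, rule zero_le, rule allI, rule le)
  then have "(\<lambda>i. norm (simple_bochner_integral M (s i)
      - simple_bochner_integral M (u i))) \<longlonglongrightarrow> 0"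
    by (subst (asm) tendsto_ennreal_iff) simp_all
  moreover have "(\<lambda>i. norm (simple_bochner_integral M (s i)
      - simple_bochner_integral M (u i))) \<longlonglongrightarrow> norm (y - z)"
    by (intro tendsto_intros sy uz)
  ultimately show ?thesis
    using LIMSEQ_unique[of _ 0 "norm (y - z)"] by simp
qed

text \<open>Functions on $\mathbb{T}\setminus\{1\}$ are represented by functions on all of
  \<^typ>\<open>complex\<close>, of which only the values on that set are relevant. In particular the value at
  $1$ never matters below, since the test functions vanish near $0$.\<close>

definition punctured_circle :: "complex set" where
  "punctured_circle = sphere 0 1 - {1}"

definition test_function :: "(real \<Rightarrow> complex) \<Rightarrow> bool" where
  "test_function \<psi> \<longleftrightarrow>
     continuous_on {-pi..pi} \<psi> \<and>
     (\<exists>\<delta>>0. \<forall>\<theta>\<in>{-pi..pi}. \<bar>\<theta>\<bar> < \<delta> \<longrightarrow> \<psi> \<theta> = 0) \<and>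
     \<psi> (-pi) = \<psi> pi"

definition L1_loc :: "(complex \<Rightarrow> 'a::complex_banach) set" where
  "L1_loc = {F. \<forall>\<psi>. test_function \<psi> \<longrightarrow>
     Bochner_integrable (lebesgue_on {-pi..pi}) (\<lambda>\<theta>. \<psi> \<theta> *\<^sub>C F (cis \<theta>))}"

text \<open>\<open>G\<close> is only evaluated on the exterior of the closed unit disc. Holomorphy of \<open>G\<close> there is
  not demanded separately: the notion is only applied to \<open>G_transform x\<close> for bounded \<open>x\<close>, which is
  given by a convergent power series in \<open>1 / z\<close>.\<close>

definition boundary_function :: "(complex \<Rightarrow> 'a::complex_banach) \<Rightarrow> (complex \<Rightarrow> 'a) \<Rightarrow> bool" where
  "boundary_function G F \<longleftrightarrow>
     F \<in> L1_loc \<and>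
     (\<forall>\<psi>. test_function \<psi> \<longrightarrow>
       ((\<lambda>r. Bochner_integral (lebesgue_on {-pi..pi})
               (\<lambda>\<theta>. \<psi> \<theta> *\<^sub>C G (complex_of_real r * cis \<theta>)))
         \<longlongrightarrow> Bochner_integral (lebesgue_on {-pi..pi}) (\<lambda>\<theta>. \<psi> \<theta> *\<^sub>C F (cis \<theta>)))
       (at_right 1))"

definition G_transform :: "(nat \<Rightarrow> 'a::complex_banach) \<Rightarrow> complex \<Rightarrow> 'a" where
  "G_transform x z = (\<Sum>n. inverse (z ^ (n + 1)) *\<^sub>C x n)"

text \<open>Differentiation along the circle with respect to \<open>z = cis \<theta>\<close>, so that
  \<open>d/d\<theta> [F (cis \<theta>)] = \<i> * cis \<theta> *\<^sub>C circle_deriv F (cis \<theta>)\<close>. The choice of the angle is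
  immaterial by periodicity; see \<open>circle_derivs_has_vector_derivative\<close> below.\<close>

definition circle_deriv :: "(complex \<Rightarrow> 'a::complex_banach) \<Rightarrow> complex \<Rightarrow> 'a" where
  "circle_deriv F z =
     inverse (\<i> * z) *\<^sub>C vector_derivative (\<lambda>\<theta>. F (cis \<theta>)) (at (Arg z))"

abbreviation circle_derivs :: "nat \<Rightarrow> (complex \<Rightarrow> 'a::complex_banach) \<Rightarrow> complex \<Rightarrow> 'a" where
  "circle_derivs j \<equiv> circle_deriv ^^ j"

definition C_k :: "nat \<Rightarrow> (complex \<Rightarrow> 'a::complex_banach) set" where
  "C_k k = {F.
     (\<forall>j<k. \<forall>\<theta>. cis \<theta> \<in> punctured_circle \<longrightarrow>
        (\<lambda>t. circle_derivs j F (cis t)) differentiable (at \<theta>)) \<and>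
     (\<forall>j\<le>k. continuous_on punctured_circle (circle_derivs j F))}"

definition C_infinity :: "(complex \<Rightarrow> 'a::complex_banach) set" where
  "C_infinity = (\<Inter>k\<in>{1..}. C_k k)"

lemma circle_derivs_has_vector_derivative:
  fixes F :: "complex \<Rightarrow> 'a::complex_banach"
  assumes "F \<in> C_k k" and "j < k" and "cis \<theta> \<in> punctured_circle"
  shows "((\<lambda>t. circle_derivs j F (cis t)) has_vector_derivative
           (\<i> * cis \<theta>) *\<^sub>C circle_derivs (Suc j) F (cis \<theta>)) (at \<theta>)"
proof -
  define f where "f = (\<lambda>t. circle_derivs j F (cis t))"
  define a where "a = Arg (cis \<theta>)"
  have cis_a: "cis a = cis \<theta>"
    unfolding a_def using cis_Arg[of "cis \<theta>"] by (simp add: sgn_eq)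
  have shift: "f (t + (\<theta> - a)) = f t" for t
    using cis_a by (simp add: f_def flip: cis_mult cis_divide)
  have "f differentiable (at a)"
    using assms unfolding C_k_def f_def cis_a[symmetric] by blast
  then have "(f has_vector_derivative vector_derivative f (at a)) (at a)"
    by (rule vector_derivative_works[THEN iffD1])
  then have "(f \<circ> (\<lambda>t. t - (\<theta> - a)) has_vector_derivative
      1 *\<^sub>R vector_derivative f (at a)) (at \<theta>)"
    by (intro vector_diff_chain_at) (auto intro!: derivative_eq_intros)
  moreover have "f \<circ> (\<lambda>t. t - (\<theta> - a)) = f"
    using shift[of "_ - (\<theta> - a)"] by (auto simp: fun_eq_iff)
  moreover have "(\<i> * cis \<theta>) *\<^sub>C circle_derivs (Suc j) F (cis \<theta>) = vector_derivative f (at a)"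
  proof -
    have "(\<i> * cis \<theta>) * inverse (\<i> * cis \<theta>) = complex_of_real 1"
      using right_inverse[of "\<i> * cis \<theta>"] by auto
    then have "(\<i> * cis \<theta>) *\<^sub>C inverse (\<i> * cis \<theta>) *\<^sub>C v = v" for v :: 'a
      unfolding scaleC_scaleC by (simp only: scaleC_of_real scaleR_one)
    then show ?thesis
      by (simp only: funpow.simps o_apply circle_deriv_def f_def a_def)
  qed
  ultimately show ?thesis
    by (simp add: f_def)
qed

definition m_pow :: "(real \<Rightarrow> real) \<Rightarrow> nat \<Rightarrow> real \<Rightarrow> real" where
  "m_pow m k \<epsilon> = m \<epsilon> * (m \<epsilon> / \<epsilon>) powr (1 / real k)"

definition m_log :: "(real \<Rightarrow> real) \<Rightarrow> real \<Rightarrow> real" where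
  "m_log m \<epsilon> = m \<epsilon> * ln (1 + m \<epsilon> / \<epsilon>)"

text \<open>The value is the actual inverse only on the range of the restriction of \<open>g\<close> to $(0,\pi]$;
  it is unspecified elsewhere.\<close>

definition rate_inv :: "(real \<Rightarrow> real) \<Rightarrow> real \<Rightarrow> real" where
  "rate_inv g = the_inv_into {0<..pi} g"

end

theory Submission
  imports Defs
begin

text \<open>
  Let \<open>\<eta>\<close> be a smooth function on the line vanishing on \<open>(-1, 1)\<close> and equal to \<open>1\<close> outside \<open>[-2, 2]\<close>.
  Testing the boundary function against \<open>\<theta> \<mapsto> \<eta> (\<theta> / \<epsilon>) e\<^sup>i\<^sup>(\<^sup>n\<^sup>+\<^sup>1\<^sup>)\<^sup>\<theta>\<close> isolates \<open>2 \<pi> x\<^sub>n\<close>, up to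
  the sum of the \<open>x\<^sub>k\<close> weighted by the Fourier coefficients of \<open>1 - \<eta> (\<theta> / \<epsilon>)\<close>. The total
  variation of these coefficients is \<open>O(\<epsilon>)\<close>, so summation by parts against the bounded partial sums
  bounds the error by \<open>O(\<epsilon>)\<close>. What remains is the oscillatory integral of \<open>\<eta> (\<theta> / \<epsilon>) F\<close>: it tends to
  zero by the Riemann--Lebesgue lemma, and repeated integration by parts makes it \<open>O(\<epsilon>)\<close> when \<open>\<epsilon>\<close> is
  the claimed rate. In the smooth case the cutoff is differentiated only once in each term, and the
  number of integrations by parts is about \<open>n / m(\<epsilon>)\<close>, which is where \<open>j! (m(\<epsilon>) / n)\<^sup>j\<close> is smallest.
\<close>

section \<open>Complex scaling and Bochner integrals\<close>

text \<open>The boundary function may fail to be integrable at \<theta> = 0, so no estimate may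
  touch it there; hence a cutoff that vanishes near 0, paid for by the low-frequency error. Bounding
  that error by the boundedness of x alone would give nothing: about 1/\<epsilon> coefficients have
  size \<epsilon>, so their absolute sum is of order one. The bounded partial sums gain the missing
  factor, because the difference of neighbouring coefficients at frequency p is at most a constant
  times min(\<epsilon>^2, 1/p^2), and this sums to O(\<epsilon>). The rates come from balancing
  against this error. In (a), k integrations by parts leave m(\<epsilon>)^(k+1) / n^k, which is of
  order \<epsilon> exactly when m_k(\<epsilon>) is of order n. In (b), what is left is about
  m(\<epsilon>) exp(-n / m(\<epsilon>)), which is of order \<epsilon> once n / m(\<epsilon>) reaches
  log(1 + m(\<epsilon>)/\<epsilon>), that is, once n reaches m_log(\<epsilon>). Since X may be
  non-separable, integrability is taken in the Bochner sense, but all calculations are done with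
  gauge integrals.\<close>

lemma bounded_bilinear_scaleC:
  "bounded_bilinear (scaleC :: complex \<Rightarrow> 'a::complex_banach \<Rightarrow> 'a)"
proof
  show "(r *\<^sub>R a) *\<^sub>C b = r *\<^sub>R (a *\<^sub>C b)" for r :: real and a and b :: 'a
    by (simp add: scaleR_conv_of_real flip: scaleC_scaleC scaleC_of_real)
  show "a *\<^sub>C (r *\<^sub>R b) = r *\<^sub>R (a *\<^sub>C b)" for r :: real and a and b :: 'a
    by (simp add: scaleC_scaleC mult.commute flip: scaleC_of_real)
  show "\<exists>K. \<forall>a (b::'a). norm (a *\<^sub>C b) \<le> norm a * norm b * K"
    by (intro exI[of _ 1]) (simp add: norm_scaleC)
qed (auto simp: scaleC_add_left scaleC_add_right)

interpretation scaleC: bounded_bilinear "scaleC :: complex \<Rightarrow> 'a::complex_banach \<Rightarrow> 'a"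
  by (rule bounded_bilinear_scaleC)

lemma sum_indicator_fibres:
  fixes s :: "'b \<Rightarrow> 'a::real_vector"
  assumes "finite (s ` A)" "x \<in> A"
  shows "(\<Sum>y\<in>s ` A. indicat_real {t \<in> A. s t = y} x *\<^sub>R y) = s x"
proof -
  have "(\<Sum>y\<in>s ` A. indicat_real {t \<in> A. s t = y} x *\<^sub>R y) = (\<Sum>y\<in>s ` A. if s x = y then y else 0)"
    using assms(2) by (intro sum.cong) (auto simp: indicator_def)
  also have "\<dots> = s x"
    using assms by (subst sum.delta') auto
  finally show ?thesis .
qed

lemma simple_bochner_integrable_fibres:
  assumes "simple_bochner_integrable (lebesgue_on {a..b::real}) s"
  shows "finite (s ` {a..b})" "{t \<in> {a..b}. s t = y} \<in> lmeasurable"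
proof -
  have s: "simple_function (lebesgue_on {a..b}) s"
    using assms by (auto elim: simple_bochner_integrable.cases)
  then show "finite (s ` {a..b})"
    using simple_functionD(1)[OF s] by simp
  have "s -` {y} \<inter> space (lebesgue_on {a..b}) \<in> sets (lebesgue_on {a..b})"
    using simple_functionD(2)[OF s] .
  moreover have "s -` {y} \<inter> space (lebesgue_on {a..b}) = {t \<in> {a..b}. s t = y}"
    by auto
  ultimately have "{t \<in> {a..b}. s t = y} \<in> sets lebesgue"
    by (simp add: sets_restrict_space_iff)
  then show "{t \<in> {a..b}. s t = y} \<in> lmeasurable"
    by (rule fmeasurableI2[of "{a..b}" lebesgue, rotated 2]) auto
qed

lemma has_integral_indicator_lmeasurable:
  fixes A :: "real set"
  assumes "A \<in> lmeasurable" "A \<subseteq> S"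
  shows "(indicat_real A has_integral measure lebesgue A) S"
proof -
  have "(indicat_real A has_integral measure lebesgue A) UNIV"
    using assms(1) lmeasurable_iff_has_integral by blast
  then show ?thesis
    using assms(2) by (subst has_integral_restrict_UNIV[symmetric])
      (erule has_integral_eq[rotated], auto simp: indicator_def)
qed

lemma simple_bochner_has_integral:
  fixes s :: "real \<Rightarrow> 'a::real_normed_vector"
  assumes s: "simple_bochner_integrable (lebesgue_on {a..b}) s"
  shows "(s has_integral simple_bochner_integral (lebesgue_on {a..b}) s) {a..b}"
proof -
  let ?A = "\<lambda>y. {t \<in> {a..b}. s t = y}"
  have "measure (lebesgue_on {a..b}) (?A y) = measure lebesgue (?A y)" for y
    by (rule measure_restrict_space) auto
  then have I: "simple_bochner_integral (lebesgue_on {a..b}) s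
      = (\<Sum>y\<in>s ` {a..b}. measure lebesgue (?A y) *\<^sub>R y)"
    by (simp add: simple_bochner_integral_def)
  have "((\<lambda>x. \<Sum>y\<in>s ` {a..b}. indicat_real (?A y) x *\<^sub>R y)
      has_integral (\<Sum>y\<in>s ` {a..b}. measure lebesgue (?A y) *\<^sub>R y)) {a..b}"
    using simple_bochner_integrable_fibres[OF s]
    by (intro has_integral_sum has_integral_scaleR_left has_integral_indicator_lmeasurable) auto
  moreover have "(\<Sum>y\<in>s ` {a..b}. indicat_real (?A y) x *\<^sub>R y) = s x" if "x \<in> {a..b}" for x
    using sum_indicator_fibres[of s "{a..b}" x] simple_bochner_integrable_fibres(1)[OF s] that by simp
  ultimately show ?thesis
    unfolding I by (rule has_integral_eq[rotated])
qed

text \<open>The norm is real-valued, so the agreement of Lebesgue and gauge integrals applies to it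
  whatever X is.\<close>

lemma norm_diff_simple_has_integral:
  fixes f :: "real \<Rightarrow> 'a::real_normed_vector"
  assumes f: "f \<in> borel_measurable (lebesgue_on {a..b})"
    and s: "simple_bochner_integrable (lebesgue_on {a..b}) s"
    and e: "(\<integral>\<^sup>+ t. ennreal (norm (f t - s t)) \<partial>lebesgue_on {a..b}) < ennreal e"
  obtains i where "((\<lambda>t. norm (f t - s t)) has_integral i) {a..b}" "i < e"
proof -
  let ?M = "lebesgue_on {a..b}" and ?g = "\<lambda>t. norm (f t - s t)"
  have g: "?g \<in> borel_measurable ?M"
    by (rule borel_measurable_norm_diff_simple[OF f s])
  have int: "integrable ?M ?g"
    using g order.strict_trans[OF e ennreal_less_top] by (intro integrableI_nonneg) auto
  then have "ennreal (integral\<^sup>L ?M ?g) < ennreal e"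
    using e nn_integral_eq_integral[OF int] by simp
  then have "integral\<^sup>L ?M ?g < e"
    using ennreal_leI[of e "integral\<^sup>L ?M ?g"] by (meson leD leI)
  moreover have "(?g has_integral integral\<^sup>L ?M ?g) {a..b}"
    using int by (intro has_integral_integral_lebesgue_on) auto
  ultimately show thesis
    by (rule that[rotated])
qed

lemma has_Bochner_simple_approx:
  fixes f :: "real \<Rightarrow> 'a::real_normed_vector"
  assumes "has_Bochner (lebesgue_on {a..b}) f y" "e > 0"
  obtains s i where "simple_bochner_integrable (lebesgue_on {a..b}) s"
    "norm (simple_bochner_integral (lebesgue_on {a..b}) s - y) < e"
    "((\<lambda>t. norm (f t - s t)) has_integral i) {a..b}" "i < e"
proof -
  from assms(1) obtain s where f: "f \<in> borel_measurable (lebesgue_on {a..b})"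
    and s: "\<And>i::nat. simple_bochner_integrable (lebesgue_on {a..b}) (s i)"
    and s0: "(\<lambda>i. \<integral>\<^sup>+ t. ennreal (norm (f t - s i t)) \<partial>lebesgue_on {a..b}) \<longlonglongrightarrow> 0"
    and sy: "(\<lambda>i. simple_bochner_integral (lebesgue_on {a..b}) (s i)) \<longlonglongrightarrow> y"
    unfolding has_Bochner_def by blast
  have "\<forall>\<^sub>F i in sequentially. (\<integral>\<^sup>+ t. ennreal (norm (f t - s i t)) \<partial>lebesgue_on {a..b}) < ennreal e"
    using assms(2) by (intro order_tendstoD(2)[OF s0]) simp
  moreover have "\<forall>\<^sub>F i in sequentially. norm (simple_bochner_integral (lebesgue_on {a..b}) (s i) - y) < e"
    using tendstoD[OF sy assms(2)] by (simp add: dist_norm)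
  ultimately have "\<forall>\<^sub>F i in sequentially. (\<integral>\<^sup>+ t. ennreal (norm (f t - s i t)) \<partial>lebesgue_on {a..b}) < ennreal e
      \<and> norm (simple_bochner_integral (lebesgue_on {a..b}) (s i) - y) < e"
    by eventually_elim simp
  then obtain i where i: "(\<integral>\<^sup>+ t. ennreal (norm (f t - s i t)) \<partial>lebesgue_on {a..b}) < ennreal e"
    "norm (simple_bochner_integral (lebesgue_on {a..b}) (s i) - y) < e"
    using eventually_happens'[OF sequentially_bot] by blast
  from norm_diff_simple_has_integral[OF f s i(1)] show thesis
    using that[OF s i(2)] by blast
qed

text \<open>The library compares Lebesgue and gauge integrals only for Euclidean range spaces. Here the
  Riemann sums of \<open>f - s\<close> are dominated by those of the real function \<open>norm (f - s)\<close>.\<close>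

lemma has_Bochner_imp_has_integral:
  fixes f :: "real \<Rightarrow> 'a::real_normed_vector"
  assumes "has_Bochner (lebesgue_on {a..b}) f y"
  shows "(f has_integral y) {a..b}"
  unfolding has_integral_real
proof (intro allI impI)
  fix e :: real
  assume "e > 0"
  then obtain s i where s: "simple_bochner_integrable (lebesgue_on {a..b}) s"
    and sy: "norm (simple_bochner_integral (lebesgue_on {a..b}) s - y) < e / 4"
    and g: "((\<lambda>t. norm (f t - s t)) has_integral i) {a..b}" "i < e / 4"
    using has_Bochner_simple_approx[OF assms, of "e / 4"] by auto
  define I where "I = simple_bochner_integral (lebesgue_on {a..b}) s"
  from \<open>e > 0\<close> have e4: "e / 4 > 0"
    by simp
  obtain \<gamma>1 where "gauge \<gamma>1 \<and> (\<forall>\<D>. \<D> tagged_division_of {a..b} \<and> \<gamma>1 fine \<D> \<longrightarrow>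
      norm ((\<Sum>(x,k)\<in>\<D>. measure lborel k *\<^sub>R s x) - I) < e / 4)"
    using simple_bochner_has_integral[OF s, unfolded has_integral_real, rule_format, OF e4]
    unfolding I_def by (rule exE)
  then have \<gamma>1: "gauge \<gamma>1" "\<And>\<D>. \<D> tagged_division_of {a..b} \<Longrightarrow> \<gamma>1 fine \<D> \<Longrightarrow>
      norm ((\<Sum>(x,k)\<in>\<D>. measure lborel k *\<^sub>R s x) - I) < e / 4"
    by simp_all
  obtain \<gamma>2 where "gauge \<gamma>2 \<and> (\<forall>\<D>. \<D> tagged_division_of {a..b} \<and> \<gamma>2 fine \<D> \<longrightarrow>
      norm ((\<Sum>(x,k)\<in>\<D>. measure lborel k *\<^sub>R norm (f x - s x)) - i) < e / 4)"
    using g(1)[unfolded has_integral_real, rule_format, OF e4] by (rule exE)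
  then have \<gamma>2: "gauge \<gamma>2" "\<And>\<D>. \<D> tagged_division_of {a..b} \<Longrightarrow> \<gamma>2 fine \<D> \<Longrightarrow>
      norm ((\<Sum>(x,k)\<in>\<D>. measure lborel k *\<^sub>R norm (f x - s x)) - i) < e / 4"
    by simp_all
  show "\<exists>\<gamma>. gauge \<gamma> \<and> (\<forall>\<D>. \<D> tagged_division_of {a..b} \<and> \<gamma> fine \<D> \<longrightarrow>
      norm ((\<Sum>(x,k)\<in>\<D>. measure lborel k *\<^sub>R f x) - y) < e)"
  proof (intro exI conjI allI impI)
    show "gauge (\<lambda>x. \<gamma>1 x \<inter> \<gamma>2 x)"
      using \<gamma>1(1) \<gamma>2(1) by (rule gauge_Int)
    fix \<D>
    assume D: "\<D> tagged_division_of {a..b} \<and> (\<lambda>x. \<gamma>1 x \<inter> \<gamma>2 x) fine \<D>"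
    then have d: "\<D> tagged_division_of {a..b}" "\<gamma>1 fine \<D>" "\<gamma>2 fine \<D>"
      by (auto simp: fine_Int)
    let ?f = "\<Sum>(x,k)\<in>\<D>. measure lborel k *\<^sub>R f x" and ?s = "\<Sum>(x,k)\<in>\<D>. measure lborel k *\<^sub>R s x"
    have "?f - ?s = (\<Sum>(x,k)\<in>\<D>. measure lborel k *\<^sub>R (f x - s x))"
      by (simp add: scaleR_diff_right sum_subtractf case_prod_unfold)
    also have "norm \<dots> \<le> (\<Sum>(x,k)\<in>\<D>. measure lborel k *\<^sub>R norm (f x - s x))"
      by (rule sum_norm_le) auto
    finally have "norm (?f - ?s) \<le> (\<Sum>(x,k)\<in>\<D>. measure lborel k *\<^sub>R norm (f x - s x))" .
    \<comment> \<open>The Riemann sum is within e/4 of i, and i itself is below e/4.\<close>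
    moreover have "(\<Sum>(x,k)\<in>\<D>. measure lborel k *\<^sub>R norm (f x - s x)) < e / 2"
      using \<gamma>2(2)[OF d(1,3)] g(2) by (simp add: abs_if split: if_splits)
    moreover have "norm (?s - I) < e / 4"
      using \<gamma>1(2)[OF d(1,2)] .
    moreover have "norm (?f - y) \<le> norm (?f - ?s) + norm (?s - I) + norm (I - y)"
      using norm_triangle_ineq[of "?f - ?s" "?s - y"] norm_triangle_ineq[of "?s - I" "I - y"] by simp
    ultimately show "norm (?f - y) < e"
      using sy unfolding I_def by linarith
  qed
qed

lemma Bochner_integral_eq_integral:
  fixes f :: "real \<Rightarrow> 'a::real_normed_vector"
  assumes "Bochner_integrable (lebesgue_on {a..b}) f"
  shows "f integrable_on {a..b}" "Bochner_integral (lebesgue_on {a..b}) f = integral {a..b} f"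
proof -
  obtain y where y: "has_Bochner (lebesgue_on {a..b}) f y"
    using assms unfolding Bochner_integrable_def by blast
  have "(THE y. has_Bochner (lebesgue_on {a..b}) f y) = y"
    using y has_Bochner_unique by blast
  then have "Bochner_integral (lebesgue_on {a..b}) f = y"
    using assms by (simp add: Bochner_integral_def)
  with has_Bochner_imp_has_integral[OF y]
  show "f integrable_on {a..b}" "Bochner_integral (lebesgue_on {a..b}) f = integral {a..b} f"
    by (auto simp: integral_unique)
qed

text \<open>Sampling on the grid of mesh 1/N: t is rounded down, and the maximum with
  \<open>a\<close> keeps the sample point in the interval when the grid point falls to the left of
  it. Only finitely many sample points occur.\<close>

lemma simple_bochner_integrable_step:
  fixes f :: "real \<Rightarrow> 'a::real_normed_vector"
  assumes "N > 0"
  shows "simple_bochner_integrable (lebesgue_on {a..b}) (\<lambda>t. f (max a (\<lfloor>t * real N\<rfloor> / N)))"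
proof -
  let ?q = "\<lambda>t. max a (real_of_int \<lfloor>t * real N\<rfloor> / N)" and ?M = "lebesgue_on {a..b}"
  have "?q \<in> borel_measurable lborel"
    by measurable
  then have meas: "?q \<in> borel_measurable ?M"
    by (intro measurable_restrict_space1 measurable_completion)
  have "(\<lambda>t. \<lfloor>t * real N\<rfloor>) ` {a..b} \<subseteq> {\<lfloor>a * real N\<rfloor>..\<lfloor>b * real N\<rfloor>}"
    by (auto intro!: floor_mono mult_right_mono)
  then have "finite ((\<lambda>t. \<lfloor>t * real N\<rfloor>) ` {a..b})"
    by (rule finite_subset) simp
  then have "finite ((\<lambda>i. max a (real_of_int i / N)) ` (\<lambda>t. \<lfloor>t * real N\<rfloor>) ` {a..b})"
    by (rule finite_imageI)
  then have "finite (?q ` {a..b})"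
    by (simp add: image_image)
  then have "simple_function ?M ?q"
    using meas by (intro simple_function_borel_measurable) auto
  from simple_function_compose1[OF this, of f] have s: "simple_function ?M (\<lambda>t. f (?q t))" .
  have "emeasure ?M {t \<in> space ?M. f (?q t) \<noteq> 0} \<le> emeasure ?M (space ?M)"
    by (rule emeasure_space)
  also have "\<dots> < \<infinity>"
    by (simp add: emeasure_restrict_space emeasure_lborel_Icc_eq)
  finally show ?thesis
    using s by (intro simple_bochner_integrable.intros) auto
qed

text \<open>\<open>Bochner_integral\<close> defaults to 0, so the limit in
  \<open>boundary_function\<close> carries information about \<open>G_transform x\<close> only once
  the integrands on the circles of radius r > 1 are known to be integrable. By uniform continuity
  the step functions sampled on a grid converge uniformly, hence in mean.\<close>

lemma Bochner_integrable_continuous: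
  fixes f :: "real \<Rightarrow> 'a::banach"
  assumes f: "continuous_on {a..b} f" and "a \<le> b"
  shows "Bochner_integrable (lebesgue_on {a..b}) f"
proof -
  let ?M = "lebesgue_on {a..b}"
  define q where "q = (\<lambda>N t. max a (real_of_int \<lfloor>t * real (Suc N)\<rfloor> / Suc N))"
  define s where "s = (\<lambda>N t. f (q N t))"
  have q: "q N t \<in> {a..b}" "\<bar>q N t - t\<bar> \<le> 1 / Suc N" if "t \<in> {a..b}" for N t
  proof -
    define u where "u = real_of_int \<lfloor>t * real (Suc N)\<rfloor>"
    have u: "u \<le> t * Suc N" "t * Suc N < u + 1"
      unfolding u_def by linarith+
    then have "u / Suc N \<le> t" "t \<le> u / Suc N + 1 / Suc N"
      by (auto simp: field_simps)
    then show "q N t \<in> {a..b}" "\<bar>q N t - t\<bar> \<le> 1 / Suc N"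
      using that unfolding q_def u_def[symmetric] by auto
  qed
  have s: "simple_bochner_integrable ?M (s N)" for N
    unfolding s_def q_def by (rule simple_bochner_integrable_step) simp
  have unif: "uniform_limit {a..b} s f sequentially"
  proof (rule uniform_limitI)
    fix e :: real
    assume "e > 0"
    then obtain d where "d > 0" and d: "\<And>t t'. t \<in> {a..b} \<Longrightarrow> t' \<in> {a..b} \<Longrightarrow> dist t' t < d \<Longrightarrow> dist (f t') (f t) < e"
      using compact_uniformly_continuous[OF f] unfolding uniformly_continuous_on_def by (metis compact_Icc)
    have "\<forall>\<^sub>F N in sequentially. 1 / real (Suc N) < d"
      using order_tendstoD(2)[OF LIMSEQ_Suc[OF lim_inverse_n'] \<open>d > 0\<close>] by simp
    then show "\<forall>\<^sub>F N in sequentially. \<forall>t\<in>{a..b}. dist (s N t) (f t) < e"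
    proof eventually_elim
      case (elim N)
      then show ?case
        using q[of _ N] unfolding s_def by (intro ballI d) (force simp: dist_real_def)+
    qed
  qed
  \<comment> \<open>The added 1 covers a = b and makes the product with b - a strictly smaller than
    r.\<close>
  have close: "\<forall>\<^sub>F N in sequentially. \<forall>t\<in>{a..b}. norm (f t - s N t) \<le> r / (b - a + 1)" if "r > 0" for r
  proof -
    have "r / (b - a + 1) > 0"
      using that \<open>a \<le> b\<close> by simp
    from uniform_limitD[OF unif this] show ?thesis
      by eventually_elim (force simp: dist_norm norm_minus_commute)
  qed
  have small: "r / (b - a + 1) * (b - a) < r" if "r > 0" for r
    using that \<open>a \<le> b\<close> by (simp add: field_simps)
  have lim: "(\<lambda>N. simple_bochner_integral ?M (s N)) \<longlonglongrightarrow> integral {a..b} f"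
  proof (rule tendstoI)
    fix r :: real
    assume r: "r > 0"
    from close[OF r] show "\<forall>\<^sub>F N in sequentially. dist (simple_bochner_integral ?M (s N)) (integral {a..b} f) < r"
    proof eventually_elim
      case (elim N)
      have "((\<lambda>t. f t - s N t) has_integral integral {a..b} f - simple_bochner_integral ?M (s N)) {a..b}"
        using integrable_integral[OF integrable_continuous_real[OF f]] simple_bochner_has_integral[OF s]
        by (rule has_integral_diff)
      from has_integral_bound_real[OF _ finite.emptyI this, of "r / (b - a + 1)"] elim r \<open>a \<le> b\<close>
      have "norm (integral {a..b} f - simple_bochner_integral ?M (s N)) \<le> r / (b - a + 1) * (b - a)"
        by simp
      with small[OF r] show ?case
        by (simp add: dist_norm norm_minus_commute)
    qed
  qed
  have meas: "f \<in> borel_measurable ?M"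
    using f by (rule continuous_imp_measurable_on_sets_lebesgue) auto
  have "(\<lambda>N. \<integral>\<^sup>+ t. ennreal (norm (f t - s N t)) \<partial>?M) \<longlonglongrightarrow> 0"
  proof (rule order_tendstoI)
    fix c :: ennreal
    assume "0 < c"
    then obtain r where r: "r > 0" "ennreal r \<le> c"
      by (cases c) (auto intro: that[of 1])
    from close[OF r(1)] show "\<forall>\<^sub>F N in sequentially. (\<integral>\<^sup>+ t. ennreal (norm (f t - s N t)) \<partial>?M) < c"
    proof eventually_elim
      case (elim N)
      have "(\<integral>\<^sup>+ t. ennreal (norm (f t - s N t)) \<partial>?M) \<le> (\<integral>\<^sup>+ t. ennreal (r / (b - a + 1)) \<partial>?M)"
        using elim by (intro nn_integral_mono ennreal_leI) auto
      also have "\<dots> = ennreal (r / (b - a + 1) * (b - a))"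
        using r \<open>a \<le> b\<close> by (simp add: emeasure_restrict_space flip: ennreal_mult)
      also have "\<dots> < ennreal r"
        using small[OF r(1)] r(1) by (intro ennreal_lessI)
      finally show ?case
        using r(2) by (rule less_le_trans)
    qed
  qed simp
  then show ?thesis
    unfolding Bochner_integrable_def has_Bochner_def using meas s lim by blast
qed

section \<open>The Riemann--Lebesgue lemma\<close>

lemma continuous_integrable_on_lmeasurable:
  fixes f :: "real \<Rightarrow> 'a::euclidean_space"
  assumes "continuous_on {a..b} f" "A \<in> sets lebesgue" "A \<subseteq> {a..b}"
  shows "f integrable_on A"
  using set_integrable_subset[OF absolutely_integrable_continuous_real[OF assms(1)]] assms(2,3)
    set_lebesgue_integral_eq_integral(1) by blast

lemma has_vector_derivative_cis:
  "((\<lambda>t. cis (c * t)) has_vector_derivative \<i> * of_real c * cis (c * t)) (at t within S)"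
proof -
  have eq: "cis (c * t) = exp (t *\<^sub>R (\<i> * of_real c))" for t
    by (simp add: cis_conv_exp scaleR_conv_of_real mult_ac)
  show ?thesis
    using exp_scaleR_has_vector_derivative_right[of "\<i> * of_real c" t S]
    unfolding eq by (simp add: mult.commute)
qed

lemma has_integral_cis:
  "((\<lambda>\<theta>. cis (of_int p * \<theta>)) has_integral (if p = 0 then 2 * pi else 0)) {-pi..pi}"
proof (cases "p = 0")
  case True
  have "((\<lambda>\<theta>. cis (of_int p * \<theta>)) has_integral measure lborel {-pi..pi} *\<^sub>R 1) {-pi..pi}"
    using True has_integral_const_real[of "1::complex" "-pi" pi] by simp
  then show ?thesis
    using True by (simp add: scaleR_conv_of_real)
next
  case False
  have eq: "cis (of_int p * pi) = cis (of_int p * (- pi))"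
    using sin_npi_int[of p] by (simp add: complex_eq_iff mult.commute)
  have "((\<lambda>\<theta>. cis (of_int p * \<theta>)) has_integral
      cis (of_int p * pi) / (\<i> * of_int p) - cis (of_int p * (- pi)) / (\<i> * of_int p)) {-pi..pi}"
  proof (rule fundamental_theorem_of_calculus)
    fix t :: real
    show "((\<lambda>\<theta>. cis (of_int p * \<theta>) / (\<i> * of_int p)) has_vector_derivative cis (of_int p * t))
        (at t within {-pi..pi})"
      using has_vector_derivative_divide[OF has_vector_derivative_cis[of "of_int p" t "{-pi..pi}"], of "\<i> * of_int p"]
        False by simp
  qed simp
  then show ?thesis
    using False eq by simp
qed

text \<open>By duality: with \<open>P = \<Sum> cnj c\<^sub>n e\<^sup>i\<^sup>n\<^sup>\<theta>\<close>, the integral of \<open>P\<close> over \<open>A\<close> is the sum \<open>S\<close> to be bounded, while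
  \<open>|P| \<le> \<pi> + |P|\<^sup>2 / (4 \<pi>)\<close> and orthogonality give \<open>S \<le> 2 \<pi>\<^sup>2 + S / 2\<close>.\<close>

lemma bessel_indicator:
  assumes A: "A \<in> sets lebesgue" "A \<subseteq> {-pi..pi}"
  shows "(\<Sum>n<N. (cmod (integral A (\<lambda>\<theta>. cis (real n * \<theta>))))\<^sup>2) \<le> 4 * pi\<^sup>2"
proof -
  define c where "c n = integral A (\<lambda>\<theta>. cis (real n * \<theta>))" for n :: nat
  define S where "S = (\<Sum>n<N. (cmod (c n))\<^sup>2)"
  define P where "P \<theta> = (\<Sum>n<N. cnj (c n) * cis (real n * \<theta>))" for \<theta>
  have cont_cis: "continuous_on T (\<lambda>\<theta>. cis (real n * \<theta>))" for n and T
    by (intro continuous_intros)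
  have cont: "continuous_on T P" for T
    unfolding P_def by (intro continuous_intros)
  have "(P has_integral (\<Sum>n<N. cnj (c n) * c n)) A"
    unfolding P_def c_def
    by (intro has_integral_sum has_integral_mult_right integrable_integral
        continuous_integrable_on_lmeasurable[OF cont_cis A]) auto
  moreover have "(\<Sum>n<N. cnj (c n) * c n) = of_real S"
    by (simp only: S_def complex_norm_square mult.commute of_real_sum)
  ultimately have int_P: "(P has_integral of_real S) A"
    by simp
  have "((\<lambda>\<theta>. \<Sum>n<N. \<Sum>k<N. cnj (c n) * c k * cis (of_int (int n - int k) * \<theta>)) has_integral
      (\<Sum>n<N. \<Sum>k<N. cnj (c n) * c k * (if int n - int k = 0 then 2 * pi else 0))) {-pi..pi}"
    by (intro has_integral_sum has_integral_mult_right has_integral_cis) auto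
  moreover have "(\<Sum>n<N. \<Sum>k<N. cnj (c n) * c k * cis (of_int (int n - int k) * \<theta>))
      = of_real ((cmod (P \<theta>))\<^sup>2)" for \<theta>
  proof -
    have "of_real ((cmod (P \<theta>))\<^sup>2) = P \<theta> * cnj (P \<theta>)"
      by (rule complex_norm_square)
    also have "\<dots> = (\<Sum>n<N. \<Sum>k<N. (cnj (c n) * cis (real n * \<theta>)) * (c k * cis (- (real k * \<theta>))))"
      unfolding P_def by (simp add: sum_product cis_cnj)
    also have "\<dots> = (\<Sum>n<N. \<Sum>k<N. cnj (c n) * c k * (cis (real n * \<theta>) * cis (- (real k * \<theta>))))"
      by (simp add: mult_ac)
    finally show ?thesis
      by (simp add: cis_mult algebra_simps)
  qed
  moreover have "(\<Sum>n<N. \<Sum>k<N. cnj (c n) * c k * (if int n - int k = 0 then 2 * pi else 0))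
      = of_real (2 * pi * S)"
  proof -
    have "(\<Sum>k<N. cnj (c n) * c k * (if int n - int k = 0 then 2 * pi else 0))
        = of_real (2 * pi * (cmod (c n))\<^sup>2)" if "n < N" for n
    proof -
      have "(\<Sum>k<N. cnj (c n) * c k * (if int n - int k = 0 then 2 * pi else 0))
          = (\<Sum>k<N. if n = k then cnj (c n) * c n * (2 * pi) else 0)"
        by (intro sum.cong) auto
      then show ?thesis
        using that complex_norm_square[of "c n"] by (simp add: mult_ac)
    qed
    then show ?thesis
      unfolding S_def by (simp add: sum_distrib_left)
  qed
  ultimately have "((\<lambda>\<theta>. complex_of_real ((cmod (P \<theta>))\<^sup>2)) has_integral of_real (2 * pi * S)) {-pi..pi}"
    by simp
  from has_integral_Re[OF this] have "((\<lambda>\<theta>. (cmod (P \<theta>))\<^sup>2) has_integral 2 * pi * S) {-pi..pi}"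
    by simp
  then have "((\<lambda>\<theta>. pi + (cmod (P \<theta>))\<^sup>2 / (4 * pi)) has_integral
      measure lborel {-pi..pi} *\<^sub>R pi + 2 * pi * S / (4 * pi)) {-pi..pi}"
    by (intro has_integral_add has_integral_const_real has_integral_divide)
  then have g: "((\<lambda>\<theta>. pi + (cmod (P \<theta>))\<^sup>2 / (4 * pi)) has_integral 2 * pi\<^sup>2 + S / 2) {-pi..pi}"
    by (simp add: power2_eq_square mult.assoc)
  have gA: "(\<lambda>\<theta>. pi + (cmod (P \<theta>))\<^sup>2 / (4 * pi)) integrable_on A"
    by (intro continuous_integrable_on_lmeasurable[OF _ A] continuous_intros cont) auto
  have "cmod (P \<theta>) \<le> pi + (cmod (P \<theta>))\<^sup>2 / (4 * pi)" for \<theta>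
  proof -
    have "0 \<le> (cmod (P \<theta>) - 2 * pi)\<^sup>2"
      by simp
    then show ?thesis
      by (simp add: field_simps power2_eq_square)
  qed
  then have "norm (integral A P) \<le> integral A (\<lambda>\<theta>. pi + (cmod (P \<theta>))\<^sup>2 / (4 * pi))"
    using int_P gA by (intro integral_norm_bound_integral) (auto simp: has_integral_integrable)
  \<comment> \<open>The majorant is non-negative, so A may be enlarged to the full period, where
    orthogonality has given its integral.\<close>
  also have "\<dots> \<le> integral {-pi..pi} (\<lambda>\<theta>. pi + (cmod (P \<theta>))\<^sup>2 / (4 * pi))"
    using g gA A by (intro integral_subset_le) (auto simp: has_integral_integrable)
  also have "\<dots> = 2 * pi\<^sup>2 + S / 2"
    using g by (rule integral_unique)
  finally have "\<bar>S\<bar> \<le> 2 * pi\<^sup>2 + S / 2"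
    using int_P by (simp add: integral_unique)
  then have "S \<le> 4 * pi\<^sup>2"
    by linarith
  then show ?thesis
    unfolding S_def c_def .
qed

text \<open>Bessel's bound does not depend on N, so the series of squared coefficients converges and
  its terms tend to zero.\<close>

lemma riemann_lebesgue_indicator:
  assumes "A \<in> sets lebesgue" "A \<subseteq> {-pi..pi}"
  shows "(\<lambda>n. integral A (\<lambda>\<theta>. cis (real n * \<theta>))) \<longlonglongrightarrow> 0"
proof -
  have "summable (\<lambda>n. (cmod (integral A (\<lambda>\<theta>. cis (real n * \<theta>))))\<^sup>2)"
    using bessel_indicator[OF assms, of "Suc _"]
    by (intro bounded_imp_summable[of _ "4 * pi\<^sup>2"]) (auto simp: lessThan_Suc_atMost)
  then have "(\<lambda>n. (cmod (integral A (\<lambda>\<theta>. cis (real n * \<theta>))))\<^sup>2) \<longlonglongrightarrow> 0"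
    by (rule summable_LIMSEQ_zero)
  from tendsto_real_sqrt[OF this] show ?thesis
    by (simp add: tendsto_norm_zero_iff)
qed

text \<open>A simple function close to h in mean reduces the claim to finitely many indicators;
  since \<open>cis\<close> has modulus one, the approximation error is the same for every n.
  Integrability of the products is assumed rather than derived: in the application each of them is
  again a test function times F.\<close>

lemma riemann_lebesgue_Bochner:
  fixes h :: "real \<Rightarrow> 'a::complex_banach"
  assumes h: "Bochner_integrable (lebesgue_on {-pi..pi}) h"
    and int: "\<And>n. (\<lambda>\<theta>. cis (real n * \<theta>) *\<^sub>C h \<theta>) integrable_on {-pi..pi}"
  shows "(\<lambda>n. integral {-pi..pi} (\<lambda>\<theta>. cis (real n * \<theta>) *\<^sub>C h \<theta>)) \<longlonglongrightarrow> 0"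
proof (rule tendstoI)
  fix e :: real
  assume "e > 0"
  obtain y where "has_Bochner (lebesgue_on {-pi..pi}) h y"
    using h unfolding Bochner_integrable_def by blast
  with \<open>e > 0\<close> obtain s i where s: "simple_bochner_integrable (lebesgue_on {-pi..pi}) s"
    and i: "((\<lambda>t. norm (h t - s t)) has_integral i) {-pi..pi}" "i < e / 2"
    by (elim has_Bochner_simple_approx[of "-pi" pi h y "e / 2"]) auto
  define A where "A y = {t \<in> {-pi..pi}. s t = y}" for y
  have A: "A y \<in> sets lebesgue" "A y \<subseteq> {-pi..pi}" for y
    using simple_bochner_integrable_fibres(2)[OF s] by (auto simp: A_def)
  have fin: "finite (s ` {-pi..pi})"
    using simple_bochner_integrable_fibres(1)[OF s] .
  define c where "c n y = integral (A y) (\<lambda>\<theta>. cis (real n * \<theta>))" for n :: nat and y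
  have int_s: "((\<lambda>\<theta>. cis (real n * \<theta>) *\<^sub>C s \<theta>) has_integral (\<Sum>y\<in>s ` {-pi..pi}. c n y *\<^sub>C y)) {-pi..pi}" for n
  proof -
    have "((\<lambda>\<theta>. if \<theta> \<in> A y then cis (real n * \<theta>) else 0) has_integral c n y) {-pi..pi}" for y
      unfolding has_integral_restrict[OF A(2)] c_def
      by (intro integrable_integral continuous_integrable_on_lmeasurable[OF _ A] continuous_intros)
    from has_integral_linear[OF this scaleC.bounded_linear_left]
    have "((\<lambda>\<theta>. (if \<theta> \<in> A y then cis (real n * \<theta>) else 0) *\<^sub>C y) has_integral c n y *\<^sub>C y) {-pi..pi}" for y
      by (simp add: o_def)
    then have "((\<lambda>\<theta>. \<Sum>y\<in>s ` {-pi..pi}. (if \<theta> \<in> A y then cis (real n * \<theta>) else 0) *\<^sub>C y)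
        has_integral (\<Sum>y\<in>s ` {-pi..pi}. c n y *\<^sub>C y)) {-pi..pi}"
      using fin by (intro has_integral_sum)
    then show ?thesis
    proof (rule has_integral_eq[rotated])
      fix \<theta>
      assume \<theta>: "\<theta> \<in> {-pi..pi}"
      have "(\<Sum>y\<in>s ` {-pi..pi}. (if \<theta> \<in> A y then cis (real n * \<theta>) else 0) *\<^sub>C y)
          = (\<Sum>y\<in>s ` {-pi..pi}. if s \<theta> = y then cis (real n * \<theta>) *\<^sub>C y else 0)"
        using \<theta> by (intro sum.cong) (auto simp: A_def scaleC.zero_left)
      also have "\<dots> = cis (real n * \<theta>) *\<^sub>C s \<theta>"
        using \<theta> fin by (subst sum.delta') auto
      finally show "(\<Sum>y\<in>s ` {-pi..pi}. (if \<theta> \<in> A y then cis (real n * \<theta>) else 0) *\<^sub>C y)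
          = cis (real n * \<theta>) *\<^sub>C s \<theta>" .
    qed
  qed
  have "(\<lambda>n. \<Sum>y\<in>s ` {-pi..pi}. c n y *\<^sub>C y) \<longlonglongrightarrow> (\<Sum>y\<in>s ` {-pi..pi}. 0 *\<^sub>C y)"
    unfolding c_def by (intro tendsto_sum scaleC.tendsto riemann_lebesgue_indicator A tendsto_const)
  then have "(\<lambda>n. \<Sum>y\<in>s ` {-pi..pi}. c n y *\<^sub>C y) \<longlonglongrightarrow> 0"
    by (simp add: scaleC.zero_left)
  from tendstoD[OF this, of "e / 2"] \<open>e > 0\<close>
  have "\<forall>\<^sub>F n in sequentially. norm (\<Sum>y\<in>s ` {-pi..pi}. c n y *\<^sub>C y) < e / 2"
    by simp
  then show "\<forall>\<^sub>F n in sequentially. dist (integral {-pi..pi} (\<lambda>\<theta>. cis (real n * \<theta>) *\<^sub>C h \<theta>)) 0 < e"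
  proof eventually_elim
    case (elim n)
    let ?J = "integral {-pi..pi} (\<lambda>\<theta>. cis (real n * \<theta>) *\<^sub>C h \<theta>)"
      and ?S = "\<Sum>y\<in>s ` {-pi..pi}. c n y *\<^sub>C y"
    have d: "((\<lambda>\<theta>. cis (real n * \<theta>) *\<^sub>C h \<theta> - cis (real n * \<theta>) *\<^sub>C s \<theta>) has_integral ?J - ?S) {-pi..pi}"
      by (intro has_integral_diff integrable_integral int int_s)
    have "norm (?J - ?S) \<le> i"
    proof -
      have "norm (integral {-pi..pi} (\<lambda>\<theta>. cis (real n * \<theta>) *\<^sub>C h \<theta> - cis (real n * \<theta>) *\<^sub>C s \<theta>))
          \<le> integral {-pi..pi} (\<lambda>t. norm (h t - s t))"
        using d i(1) by (intro integral_norm_bound_integral)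
          (auto simp: has_integral_integrable norm_scaleC simp flip: scaleC.diff_right)
      then show ?thesis
        using d i(1) by (simp add: integral_unique)
    qed
    then have "norm ?J \<le> i + norm ?S"
      using norm_triangle_ineq[of "?J - ?S" ?S] by simp
    then show ?case
      using elim i(2) by simp
  qed
qed

section \<open>Smooth cutoff functions\<close>

text \<open>The number of derivatives taken of a cutoff is known in advance (orders 2 and k serve
  (a), order 2 serves (b)), so finite smoothness is enough and powers of positive parts can replace
  the exponential bump function. The derivative is existential, so that each integration by parts
  obtains its own witness.\<close>

primrec continuously_differentiable :: "nat \<Rightarrow> (real \<Rightarrow> real) \<Rightarrow> bool" where
  "continuously_differentiable 0 f \<longleftrightarrow> continuous_on UNIV f"
| "continuously_differentiable (Suc q) f \<longleftrightarrow>
     (\<exists>f'. (\<forall>t. (f has_real_derivative f' t) (at t)) \<and> continuously_differentiable q f')"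

lemma continuously_differentiable_SucI:
  assumes "\<And>t. (f has_real_derivative f' t) (at t)" "continuously_differentiable q f'"
  shows "continuously_differentiable (Suc q) f"
  using assms by auto

lemma continuously_differentiable_Suc_lower:
  "continuously_differentiable (Suc q) f \<Longrightarrow> continuously_differentiable q f"
proof (induction q arbitrary: f)
  case 0
  then show ?case
    by (auto intro: DERIV_continuous_on[of UNIV f])
next
  case (Suc q)
  from Suc.prems obtain f' where "\<And>t. (f has_real_derivative f' t) (at t)"
    "continuously_differentiable (Suc q) f'"
    unfolding continuously_differentiable.simps(2)[of "Suc q"] by blast
  then show ?case
    using Suc.IH by (intro continuously_differentiable_SucI)
qed

lemma continuously_differentiable_antimono:
  "continuously_differentiable q f \<Longrightarrow> p \<le> q \<Longrightarrow> continuously_differentiable p f"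
  using lift_Suc_antimono_le[of "\<lambda>q. continuously_differentiable q f" p q]
    continuously_differentiable_Suc_lower by auto

lemma continuously_differentiable_const: "continuously_differentiable q (\<lambda>_. c)"
proof (induction q arbitrary: c)
  case (Suc q)
  show ?case
    by (rule continuously_differentiable_SucI[OF _ Suc[of 0]]) simp
qed simp

lemma continuously_differentiable_add:
  "continuously_differentiable q f \<Longrightarrow> continuously_differentiable q g \<Longrightarrow>
    continuously_differentiable q (\<lambda>t. f t + g t)"
proof (induction q arbitrary: f g)
  case 0
  then show ?case
    by (auto intro: continuous_intros)
next
  case (Suc q)
  then obtain f' g' where "\<And>t. (f has_real_derivative f' t) (at t)" "continuously_differentiable q f'"
    "\<And>t. (g has_real_derivative g' t) (at t)" "continuously_differentiable q g'"
    by auto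
  then show ?case
    using Suc.IH by (intro continuously_differentiable_SucI[where f' = "\<lambda>t. f' t + g' t"] DERIV_add)
qed

lemma continuously_differentiable_mult:
  "continuously_differentiable q f \<Longrightarrow> continuously_differentiable q g \<Longrightarrow>
    continuously_differentiable q (\<lambda>t. f t * g t)"
proof (induction q arbitrary: f g)
  case 0
  then show ?case
    by (auto intro: continuous_intros)
next
  case (Suc q)
  then obtain f' g' where fg: "\<And>t. (f has_real_derivative f' t) (at t)" "continuously_differentiable q f'"
    "\<And>t. (g has_real_derivative g' t) (at t)" "continuously_differentiable q g'"
    by auto
  have "continuously_differentiable q (\<lambda>t. f' t * g t + g' t * f t)"
    using fg continuously_differentiable_Suc_lower[OF Suc.prems(1)]
      continuously_differentiable_Suc_lower[OF Suc.prems(2)]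
    by (intro continuously_differentiable_add Suc.IH)
  then show ?case
    using fg by (intro continuously_differentiable_SucI[where f' = "\<lambda>t. f' t * g t + g' t * f t"] DERIV_mult)
qed

lemma continuously_differentiable_inverse:
  assumes "\<And>t. f t > 0"
  shows "continuously_differentiable q f \<Longrightarrow> continuously_differentiable q (\<lambda>t. inverse (f t))"
proof (induction q)
  case 0
  have "f t \<noteq> 0" for t
    using assms[of t] by simp
  then show ?case
    using 0 by (simp add: continuous_on_inverse)
next
  case (Suc q)
  then obtain f' where f: "\<And>t. (f has_real_derivative f' t) (at t)" "continuously_differentiable q f'"
    by auto
  have inv: "continuously_differentiable q (\<lambda>t. inverse (f t))"
    using Suc continuously_differentiable_Suc_lower by blast
  have "continuously_differentiable q (\<lambda>t. (- 1) * (inverse (f t) * f' t * inverse (f t)))"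
    by (intro continuously_differentiable_mult inv f continuously_differentiable_const)
  moreover have "((\<lambda>t. inverse (f t)) has_real_derivative (- 1) * (inverse (f t) * f' t * inverse (f t))) (at t)" for t
    using DERIV_inverse'[OF f(1)[of t]] assms[of t] by simp
  ultimately show ?case
    by (intro continuously_differentiable_SucI[where f' = "\<lambda>t. (- 1) * (inverse (f t) * f' t * inverse (f t))"])
qed

text \<open>The only delicate point is u = 0: the difference quotient is at most |h|^(q+1), which
  tends to 0 because the exponent of the power is at least two.\<close>

lemma DERIV_pos_part_power:
  "((\<lambda>u::real. max 0 u ^ Suc (Suc q)) has_real_derivative real (Suc (Suc q)) * max 0 u ^ Suc q) (at u)"
proof -
  consider "u > 0" | "u < 0" | "u = 0"
    by linarith
  then show ?thesis
  proof cases
    case 1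
    have "((\<lambda>u. u ^ Suc (Suc q)) has_real_derivative real (Suc (Suc q)) * u ^ Suc q) (at u)"
      using DERIV_pow[of "Suc (Suc q)" u UNIV] by simp
    then show ?thesis
      using 1 by (subst DERIV_cong_ev[OF refl _ refl, of _ "\<lambda>u. u ^ Suc (Suc q)"])
        (auto intro!: eventually_mono[OF eventually_nhds_in_open[of "{0<..}" u]])
  next
    case 2
    show ?thesis
      using 2 by (subst DERIV_cong_ev[OF refl _ refl, of _ "\<lambda>u. 0"])
        (auto intro!: eventually_mono[OF eventually_nhds_in_open[of "{..<0}" u]])
  next
    case 3
    have "((\<lambda>h::real. max 0 h ^ Suc (Suc q) / h) \<longlongrightarrow> 0) (at 0)"
    proof (rule Lim_null_comparison[where g = "\<lambda>h. \<bar>h\<bar> ^ Suc q"])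
      show "\<forall>\<^sub>F h in at 0. norm (max 0 h ^ Suc (Suc q) / h) \<le> \<bar>h\<bar> ^ Suc q"
      proof (intro always_eventually allI)
        fix h :: real
        have "0 \<le> \<bar>h\<bar> ^ Suc q"
          by (rule zero_le_power) simp
        then show "norm (max 0 h ^ Suc (Suc q) / h) \<le> \<bar>h\<bar> ^ Suc q"
          by (cases "h > 0") (simp_all add: max_def del: power_Suc, simp)
      qed
      show "((\<lambda>h::real. \<bar>h\<bar> ^ Suc q) \<longlongrightarrow> 0) (at 0)"
        by (auto intro!: tendsto_eq_intros)
    qed
    then show ?thesis
      using 3 by (simp add: DERIV_def)
  qed
qed

text \<open>Both ingredients of the cutoff have this form, with t^2 - 1 and 4 - t^2 inside. Each
  derivative lowers the exponent by one and produces a polynomial factor; after q of them one power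
  is left, which is still continuous.\<close>

lemma continuously_differentiable_pos_part:
  "continuously_differentiable q (\<lambda>t. max 0 (a + b * t\<^sup>2) ^ Suc q)"
proof (induction q)
  case 0
  show ?case
    by (auto intro!: continuous_intros)
next
  case (Suc q)
  have lin: "continuously_differentiable q (\<lambda>t. t)" for q
    by (cases q) (auto intro: exI[of _ "\<lambda>_. 1"] continuously_differentiable_const)
  have "continuously_differentiable q (\<lambda>t. real (Suc (Suc q)) * max 0 (a + b * t\<^sup>2) ^ Suc q * (2 * b * t))"
    by (intro continuously_differentiable_mult Suc lin continuously_differentiable_const)
  moreover have "((\<lambda>t. max 0 (a + b * t\<^sup>2) ^ Suc (Suc q)) has_real_derivative
      real (Suc (Suc q)) * max 0 (a + b * t\<^sup>2) ^ Suc q * (2 * b * t)) (at t)" for t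
    by (rule DERIV_chain2[OF DERIV_pos_part_power]) (auto intro!: derivative_eq_intros)
  ultimately show ?case
    by (rule continuously_differentiable_SucI[rotated])
qed

text \<open>The outer value is a parameter so that the class is closed under differentiation: the
  cutoff itself has c = 1, while its derivatives have c = 0 and so live on 1 \<le> |t| \<le>
  2.\<close>

definition cutoff :: "nat \<Rightarrow> real \<Rightarrow> (real \<Rightarrow> real) \<Rightarrow> bool" where
  "cutoff q c h \<longleftrightarrow> continuously_differentiable q h \<and>
     (\<forall>t. \<bar>t\<bar> < 1 \<longrightarrow> h t = 0) \<and> (\<forall>t. \<bar>t\<bar> > 2 \<longrightarrow> h t = c)"

lemma cutoff_antimono: "cutoff q c h \<Longrightarrow> p \<le> q \<Longrightarrow> cutoff p c h"
  by (auto simp: cutoff_def intro: continuously_differentiable_antimono)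

lemma cutoff_continuous: "cutoff q c h \<Longrightarrow> continuous_on S h"
  using cutoff_antimono[of q c h 0] by (auto simp: cutoff_def intro: continuous_on_subset)

lemma cutoff_inner: "cutoff q c h \<Longrightarrow> \<bar>t\<bar> < 1 \<Longrightarrow> h t = 0"
  and cutoff_outer: "cutoff q c h \<Longrightarrow> \<bar>t\<bar> > 2 \<Longrightarrow> h t = c"
  by (auto simp: cutoff_def)

lemma cutoff_derivative:
  assumes "cutoff (Suc q) c h"
  obtains h' where "\<And>t. (h has_real_derivative h' t) (at t)" "cutoff q 0 h'"
proof -
  obtain h' where h': "\<And>t. (h has_real_derivative h' t) (at t)" "continuously_differentiable q h'"
    using assms by (auto simp: cutoff_def)
  have loc: "h' t = 0" if "open U" "t \<in> U" "\<And>s. s \<in> U \<Longrightarrow> h s = d" for U t d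
  proof -
    have "(h has_real_derivative 0) (at t)"
      using that by (subst DERIV_cong_ev[OF refl _ refl, of _ "\<lambda>_. d"])
        (auto intro!: eventually_mono[OF eventually_nhds_in_open[of U t]])
    then show ?thesis
      using h'(1) DERIV_unique by blast
  qed
  have "h' t = 0" if "\<bar>t\<bar> < 1" for t
    using loc[of "{-1<..<1}" t 0] that cutoff_inner[OF assms] by (simp add: abs_less_iff)
  moreover have "h' t = 0" if "\<bar>t\<bar> > 2" for t
    using that by (intro loc[of "{..<-2} \<union> {2<..}" t c] cutoff_outer[OF assms]) auto
  ultimately have "cutoff q 0 h'"
    using h'(2) by (auto simp: cutoff_def)
  with h'(1) show thesis
    using that by blast
qed

lemma cutoff_bounded:
  assumes "cutoff q c h"
  obtains B where "B > 0" "\<And>t. \<bar>h t\<bar> \<le> B"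
proof -
  have "bounded (h ` {-2..2})"
    by (intro compact_imp_bounded compact_continuous_image cutoff_continuous[OF assms]) auto
  then obtain B where B: "B > 0" "\<And>t. t \<in> {-2..2} \<Longrightarrow> \<bar>h t\<bar> \<le> B"
    by (auto simp: bounded_pos)
  have "\<bar>h t\<bar> \<le> max B \<bar>c\<bar>" for t
  proof (cases "\<bar>t\<bar> > 2")
    case False
    then have "t \<in> {-2..2}"
      by auto
    from B(2)[OF this] show ?thesis
      by simp
  qed (simp add: cutoff_outer[OF assms])
  then show thesis
    using B(1) that[of "max B \<bar>c\<bar>"] by simp
qed

text \<open>The quotient u / (u + v), where u vanishes for |t| \<le> 1 and v for |t| \<ge> 2; at
  every point one of the two is positive, so the denominator has no zero.\<close>

lemma cutoff_exists: "\<exists>h. cutoff q 1 h"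
proof -
  define u v where "u t = max 0 (- 1 + 1 * t\<^sup>2) ^ Suc q" and "v t = max 0 (4 + (- 1) * t\<^sup>2) ^ Suc q" for t :: real
  have "u t + v t > 0" for t
  proof (cases "t\<^sup>2 > 1")
    case True
    then have "u t > 0" "v t \<ge> 0"
      unfolding u_def v_def by auto
    then show ?thesis
      by simp
  next
    case False
    then have "u t \<ge> 0" "v t > 0"
      unfolding u_def v_def by auto
    then show ?thesis
      by simp
  qed
  moreover have "continuously_differentiable q u" "continuously_differentiable q v"
    unfolding u_def[abs_def] v_def[abs_def] by (rule continuously_differentiable_pos_part)+
  ultimately have "continuously_differentiable q (\<lambda>t. u t * inverse (u t + v t))"
    by (intro continuously_differentiable_mult continuously_differentiable_inverse
        continuously_differentiable_add)
  moreover have "u t = 0" if "\<bar>t\<bar> < 1" for t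
    using that abs_square_less_1[of t] by (simp add: u_def)
  moreover have "v t = 0 \<and> u t \<noteq> 0" if "\<bar>t\<bar> > 2" for t
  proof -
    have "2\<^sup>2 < \<bar>t\<bar>\<^sup>2"
      using that by (intro power_strict_mono) auto
    then show ?thesis
      by (simp add: u_def v_def)
  qed
  ultimately have "cutoff q 1 (\<lambda>t. u t * inverse (u t + v t))"
    by (auto simp: cutoff_def)
  then show ?thesis
    by blast
qed

section \<open>Fourier coefficients of the low-frequency cutoff\<close>

lemma norm_integral_le_of_support:
  fixes f :: "real \<Rightarrow> 'a::banach"
  assumes f: "f integrable_on {-pi..pi}" and d: "0 \<le> d" "d \<le> pi"
    and B: "\<And>t. \<bar>t\<bar> \<le> d \<Longrightarrow> norm (f t) \<le> B" and z: "\<And>t. \<bar>t\<bar> > d \<Longrightarrow> f t = 0"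
  shows "norm (integral {-pi..pi} f) \<le> 2 * d * B"
proof -
  let ?g = "\<lambda>t. if t \<in> {-d..d} then B else 0"
  have "((\<lambda>t. B) has_integral measure lborel {-d..d} *\<^sub>R B) {-d..d}"
    by (rule has_integral_const_real)
  then have g: "(?g has_integral measure lborel {-d..d} *\<^sub>R B) {-pi..pi}"
    using d by (subst has_integral_restrict) auto
  have "norm (integral {-pi..pi} f) \<le> integral {-pi..pi} ?g"
  proof (rule integral_norm_bound_integral[OF f has_integral_integrable[OF g]])
    fix t
    show "norm (f t) \<le> ?g t"
      using B[of t] z[of t] by (cases "\<bar>t\<bar> \<le> d") (auto simp: abs_le_iff)
  qed
  also have "\<dots> = 2 * d * B"
    using integral_unique[OF g] d by simp
  finally show ?thesis .
qed

lemma norm_one_minus_cis_le: "cmod (1 - cis t) \<le> \<bar>t\<bar>"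
proof -
  have "cmod (1 - cis t) = 2 * \<bar>sin (t / 2)\<bar>"
    using dist_exp_i_1[of t] by (simp add: cis_conv_exp norm_minus_commute)
  also have "\<dots> \<le> \<bar>t\<bar>"
    using abs_sin_x_le_abs_x[of "t / 2"] by simp
  finally show ?thesis .
qed

text \<open>Not normalised by \<open>1 / (2 \<pi>)\<close>, and with frequency \<open>-p\<close> in the usual convention.\<close>

definition low_coeff :: "(real \<Rightarrow> real) \<Rightarrow> real \<Rightarrow> int \<Rightarrow> complex" where
  "low_coeff h \<epsilon> p = integral {-pi..pi} (\<lambda>\<theta>. of_real (1 - h (\<theta> / \<epsilon>)) * cis (of_int p * \<theta>))"

lemma integral_cis_by_parts_twice:
  fixes g g' g'' :: "real \<Rightarrow> complex"
  assumes g: "\<And>t. (g has_vector_derivative g' t) (at t)" "\<And>t. (g' has_vector_derivative g'' t) (at t)"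
    and c: "continuous_on UNIV g''"
    and z: "g pi = 0" "g (-pi) = 0" "g' pi = 0" "g' (-pi) = 0"
  shows "of_int p ^ 2 * integral {-pi..pi} (\<lambda>t. g t * cis (of_int p * t))
    = - integral {-pi..pi} (\<lambda>t. g'' t * cis (of_int p * t))"
proof -
  have "continuous_on {-pi..pi} g"
    by (rule continuous_at_imp_continuous_on) (use g(1) has_vector_derivative_continuous in blast)
  then have i1: "(\<lambda>t. g t * cis (of_int p * t)) integrable_on {-pi..pi}"
    by (intro integrable_continuous_real continuous_intros)
  have i2: "(\<lambda>t. g'' t * cis (of_int p * t)) integrable_on {-pi..pi}"
    by (intro integrable_continuous_real continuous_intros continuous_on_subset[OF c]) auto
  let ?c = "\<lambda>t. cis (of_int p * t)"
  \<comment> \<open>The derivative of this function is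
    \<open>g'' t * ?c t + of_int p ^ 2 * (g t * ?c t)\<close>, so one use of the fundamental theorem
    performs both integrations by parts.\<close>
  let ?H = "\<lambda>t. g' t * ?c t - \<i> * of_int p * (g t * ?c t)"
  have "((\<lambda>t. g'' t * ?c t + of_int p ^ 2 * (g t * ?c t)) has_integral ?H pi - ?H (-pi)) {-pi..pi}"
  proof (rule fundamental_theorem_of_calculus)
    fix t
    have "(?H has_vector_derivative
        (g' t * (\<i> * of_real (of_int p) * ?c t) + g'' t * ?c t)
        - \<i> * of_int p * (g t * (\<i> * of_real (of_int p) * ?c t) + g' t * ?c t)) (at t within {-pi..pi})"
      by (intro has_vector_derivative_diff has_vector_derivative_mult has_vector_derivative_mult_right
          has_vector_derivative_cis has_vector_derivative_at_within[OF g(1)]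
          has_vector_derivative_at_within[OF g(2)])
    moreover have "(g' t * (\<i> * of_real (of_int p) * ?c t) + g'' t * ?c t)
        - \<i> * of_int p * (g t * (\<i> * of_real (of_int p) * ?c t) + g' t * ?c t)
        = g'' t * ?c t + of_int p ^ 2 * (g t * ?c t)"
      by (simp add: algebra_simps power2_eq_square)
    ultimately show "(?H has_vector_derivative g'' t * ?c t + of_int p ^ 2 * (g t * ?c t)) (at t within {-pi..pi})"
      by (rule has_vector_derivative_eq_rhs)
  qed simp
  then have "((\<lambda>t. g'' t * ?c t + of_int p ^ 2 * (g t * ?c t)) has_integral 0) {-pi..pi}"
    using z by simp
  moreover have "((\<lambda>t. g'' t * ?c t + of_int p ^ 2 * (g t * ?c t)) has_integral
      integral {-pi..pi} (\<lambda>t. g'' t * ?c t) + of_int p ^ 2 * integral {-pi..pi} (\<lambda>t. g t * ?c t)) {-pi..pi}"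
    by (intro has_integral_add has_integral_mult_right integrable_integral i1 i2)
  ultimately have "integral {-pi..pi} (\<lambda>t. g'' t * ?c t) + of_int p ^ 2 * integral {-pi..pi} (\<lambda>t. g t * ?c t) = 0"
    using has_integral_unique by blast
  then show ?thesis
    by (simp add: eq_neg_iff_add_eq_0 add.commute)
qed

text \<open>The integrand lives on |\<theta>| \<le> 2 \<epsilon>, which gives the first bound. A
  difference of neighbouring coefficients multiplies the integrand by
  \<open>1 - cis (- \<theta>)\<close>, of modulus at most 2 \<epsilon> there. This gains one factor
  \<epsilon>; it also lowers the second derivative from O(1/\<epsilon>^2) to O(1/\<epsilon>), so
  that two integrations by parts over a set of length 4 \<epsilon> leave a bound free of
  \<epsilon>.\<close>

lemma low_coeff_bounds:
  assumes h: "cutoff 2 1 h"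
  obtains K where "K > 0"
    "\<And>\<epsilon> p. 0 < \<epsilon> \<Longrightarrow> \<epsilon> \<le> 1 / 2 \<Longrightarrow> cmod (low_coeff h \<epsilon> p) \<le> K * \<epsilon>"
    "\<And>\<epsilon> p. 0 < \<epsilon> \<Longrightarrow> \<epsilon> \<le> 1 / 2 \<Longrightarrow> cmod (low_coeff h \<epsilon> p - low_coeff h \<epsilon> (p - 1)) \<le> K * \<epsilon>\<^sup>2"
    "\<And>\<epsilon> p. 0 < \<epsilon> \<Longrightarrow> \<epsilon> \<le> 1 / 2 \<Longrightarrow>
      (of_int p)\<^sup>2 * cmod (low_coeff h \<epsilon> p - low_coeff h \<epsilon> (p - 1)) \<le> K"
proof -
  have "cutoff (Suc (Suc 0)) 1 h"
    using h by (simp add: numeral_2_eq_2)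
  then obtain h1 where h1: "\<And>t. (h has_real_derivative h1 t) (at t)" "cutoff (Suc 0) 0 h1"
    by (rule cutoff_derivative) (rule that)
  from h1(2) obtain h2 where h2: "\<And>t. (h1 has_real_derivative h2 t) (at t)" "cutoff 0 0 h2"
    by (rule cutoff_derivative) (rule that)
  obtain B0 where B0: "B0 > 0" "\<And>t. \<bar>h t\<bar> \<le> B0"
    using h by (rule cutoff_bounded) (rule that)
  obtain B1 where B1: "B1 > 0" "\<And>t. \<bar>h1 t\<bar> \<le> B1"
    using h1(2) by (rule cutoff_bounded) (rule that)
  obtain B2 where B2: "B2 > 0" "\<And>t. \<bar>h2 t\<bar> \<le> B2"
    using h2(2) by (rule cutoff_bounded) (rule that)
  \<comment> \<open>The first summand covers the first two bounds, through \<open>phi\<close> and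
    \<open>g_le\<close>; the second covers the third, through \<open>g''_le\<close>.\<close>
  define K where "K = 8 * (1 + B0) + 4 * (2 * B2 + 2 * B1 + 1 + B0)"
  have K: "K > 0" "4 * (1 + B0) \<le> K" "8 * (1 + B0) \<le> K" "4 * (2 * B2 + 2 * B1 + 1 + B0) \<le> K"
    using B0(1) B1(1) B2(1) unfolding K_def by auto
  {
    fix \<epsilon> :: real and p :: int
    assume e: "0 < \<epsilon>" "\<epsilon> \<le> 1 / 2"
    define \<phi> where "\<phi> t = complex_of_real (1 - h (t / \<epsilon>))" for t
    define g where "g t = \<phi> t * (1 - cis (- t))" for t
    define g' where "g' t = \<phi> t * (\<i> * cis (- t)) - of_real (h1 (t / \<epsilon>) / \<epsilon>) * (1 - cis (- t))" for t
    define g'' where "g'' t = \<phi> t * cis (- t) - of_real (h1 (t / \<epsilon>) / \<epsilon>) * (\<i> * cis (- t))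
      - (of_real (h1 (t / \<epsilon>) / \<epsilon>) * (\<i> * cis (- t)) + of_real (h2 (t / \<epsilon>) / \<epsilon> / \<epsilon>) * (1 - cis (- t)))" for t
    have out: "\<bar>t / \<epsilon>\<bar> > 2" if "\<bar>t\<bar> > 2 * \<epsilon>" for t
      using that e by (simp add: abs_divide field_simps)
    have phi: "cmod (\<phi> t) \<le> 1 + B0" for t
      unfolding \<phi>_def norm_of_real using B0(2)[of "t / \<epsilon>"] by linarith
    have phi0: "\<phi> t = 0" if "\<bar>t\<bar> > 2 * \<epsilon>" for t
      using cutoff_outer[OF h out[OF that]] by (simp add: \<phi>_def)
    have he: "2 * \<epsilon> \<le> pi" "2 * \<epsilon> < pi"
      using e pi_gt3 by auto
    have cont_phi: "continuous_on UNIV \<phi>"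
      unfolding \<phi>_def[abs_def] using e
      by (intro continuous_intros continuous_on_compose2[OF cutoff_continuous[OF h, of UNIV]]) auto
    have cont_h1: "continuous_on UNIV (\<lambda>t. h1 (t / \<epsilon>))" and cont_h2: "continuous_on UNIV (\<lambda>t. h2 (t / \<epsilon>))"
      using e by (intro continuous_on_compose2[OF cutoff_continuous[OF h1(2), of UNIV]]
          continuous_on_compose2[OF cutoff_continuous[OF h2(2), of UNIV]] continuous_intros; auto)+
    have cont_g: "continuous_on UNIV g"
      unfolding g_def[abs_def] by (intro continuous_intros cont_phi)
    have cont_g'': "continuous_on UNIV g''"
      unfolding g''_def[abs_def] using e by (intro continuous_intros cont_phi cont_h1 cont_h2) auto
    have scaled: "((\<lambda>t. complex_of_real (f (t / \<epsilon>))) has_vector_derivative of_real (f' (t / \<epsilon>) / \<epsilon>)) (at t)"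
      if "\<And>t. (f has_real_derivative f' t) (at t)" for f f' t
    proof -
      have "((\<lambda>t. f (t / \<epsilon>)) has_real_derivative f' (t / \<epsilon>) * (1 / \<epsilon>)) (at t)"
        by (rule DERIV_chain2[OF that]) (use e in \<open>auto intro!: derivative_eq_intros\<close>)
      then show ?thesis
        by (intro has_vector_derivative_of_real) (simp add: has_real_derivative_iff_has_vector_derivative)
    qed
    have d_phi: "(\<phi> has_vector_derivative - of_real (h1 (t / \<epsilon>) / \<epsilon>)) (at t)" for t
      using has_vector_derivative_diff[OF has_vector_derivative_const scaled[OF h1(1)], of 1 t]
      by (simp add: \<phi>_def[abs_def])
    have d_h1: "((\<lambda>t. complex_of_real (h1 (t / \<epsilon>) / \<epsilon>)) has_vector_derivative of_real (h2 (t / \<epsilon>) / \<epsilon> / \<epsilon>)) (at t)" for t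
      using has_vector_derivative_divide[OF scaled[OF h2(1), of t], of "of_real \<epsilon>"] by simp
    have d_cis: "((\<lambda>t. cis (- t)) has_vector_derivative - (\<i> * cis (- t))) (at t)" for t
      using has_vector_derivative_cis[of "-1" t UNIV] by simp
    have d_1cis: "((\<lambda>t. 1 - cis (- t)) has_vector_derivative \<i> * cis (- t)) (at t)" for t
      using has_vector_derivative_diff[OF has_vector_derivative_const d_cis, of 1 t] by simp
    have d_icis: "((\<lambda>t. \<i> * cis (- t)) has_vector_derivative cis (- t)) (at t)" for t
      using has_vector_derivative_mult_right[OF d_cis, of \<i> t] by simp
    have g': "(g has_vector_derivative g' t) (at t)" for t
      using has_vector_derivative_mult[OF d_phi d_1cis, of t] by (simp add: g_def[abs_def] g'_def)
    have g'': "(g' has_vector_derivative g'' t) (at t)" for t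
      using has_vector_derivative_diff[OF has_vector_derivative_mult[OF d_phi d_icis, of t]
          has_vector_derivative_mult[OF d_h1 d_1cis, of t]]
      by (simp add: g'_def[abs_def] g''_def)
    have zero: "g t = 0" "g' t = 0" "g'' t = 0" if "\<bar>t\<bar> > 2 * \<epsilon>" for t
      using phi0[OF that] cutoff_outer[OF h1(2) out[OF that]] cutoff_outer[OF h2(2) out[OF that]]
      by (auto simp: g_def g'_def g''_def)
    have one_cis: "cmod (1 - cis (- t)) \<le> 2 * \<epsilon>" if "\<bar>t\<bar> \<le> 2 * \<epsilon>" for t
      using norm_one_minus_cis_le[of "- t"] that by simp
    have g_le: "cmod (g t) \<le> (1 + B0) * (2 * \<epsilon>)" if "\<bar>t\<bar> \<le> 2 * \<epsilon>" for t
      unfolding g_def norm_mult using B0(1) by (intro mult_mono phi one_cis that) auto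
    have g''_le: "cmod (g'' t) \<le> (2 * B2 + 2 * B1 + 1 + B0) / \<epsilon>" if "\<bar>t\<bar> \<le> 2 * \<epsilon>" for t
    proof -
      have n1: "cmod (of_real (h1 (t / \<epsilon>) / \<epsilon>) * (\<i> * cis (- t))) \<le> B1 / \<epsilon>"
        using e B1(2)[of "t / \<epsilon>"] by (simp add: norm_mult norm_divide divide_right_mono)
      have "cmod (of_real (h2 (t / \<epsilon>) / \<epsilon> / \<epsilon>) * (1 - cis (- t))) \<le> (B2 / \<epsilon> / \<epsilon>) * (2 * \<epsilon>)"
        unfolding norm_mult using e B2 one_cis[OF that]
        by (intro mult_mono) (auto simp: norm_divide norm_mult intro!: divide_right_mono)
      then have n2: "cmod (of_real (h2 (t / \<epsilon>) / \<epsilon> / \<epsilon>) * (1 - cis (- t))) \<le> 2 * B2 / \<epsilon>"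
        using e by (simp add: mult.commute)
      have "cmod (\<phi> t * cis (- t)) \<le> 1 + B0"
        using phi[of t] by (simp add: norm_mult)
      also have "\<dots> \<le> (1 + B0) / \<epsilon>"
        using e B0(1) mult_left_le[of \<epsilon> "1 + B0"] by (simp add: pos_le_divide_eq)
      finally have n0: "cmod (\<phi> t * cis (- t)) \<le> (1 + B0) / \<epsilon>" .
      have "cmod (g'' t) \<le> cmod (\<phi> t * cis (- t)) + cmod (of_real (h1 (t / \<epsilon>) / \<epsilon>) * (\<i> * cis (- t)))
          + (cmod (of_real (h1 (t / \<epsilon>) / \<epsilon>) * (\<i> * cis (- t)))
            + cmod (of_real (h2 (t / \<epsilon>) / \<epsilon> / \<epsilon>) * (1 - cis (- t))))"
        unfolding g''_def
        by (intro order.trans[OF norm_triangle_ineq4] add_mono order.refl norm_triangle_ineq norm_triangle_ineq4)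
      also have "\<dots> \<le> (1 + B0) / \<epsilon> + B1 / \<epsilon> + (B1 / \<epsilon> + 2 * B2 / \<epsilon>)"
        by (intro add_mono n0 n1 n2)
      finally show ?thesis
        by (simp add: add_divide_distrib)
    qed
    have int: "(\<lambda>\<theta>. \<phi> \<theta> * cis (of_int p * \<theta>)) integrable_on {-pi..pi}" for p
      by (intro integrable_continuous_real continuous_intros continuous_on_subset[OF cont_phi]) auto
    have "cmod (low_coeff h \<epsilon> p) \<le> 2 * (2 * \<epsilon>) * (1 + B0)"
      unfolding low_coeff_def \<phi>_def[symmetric] using e he int phi phi0
      by (intro norm_integral_le_of_support) (auto simp: norm_mult)
    also have "\<dots> \<le> K * \<epsilon>"
      using K(2) e by (simp add: mult_right_mono mult.commute mult.left_commute)
    finally have r1: "cmod (low_coeff h \<epsilon> p) \<le> K * \<epsilon>" .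
    have "low_coeff h \<epsilon> p - low_coeff h \<epsilon> (p - 1)
        = integral {-pi..pi} (\<lambda>\<theta>. \<phi> \<theta> * cis (of_int p * \<theta>) - \<phi> \<theta> * cis (of_int (p - 1) * \<theta>))"
      unfolding low_coeff_def \<phi>_def[symmetric] by (intro integral_diff[symmetric] int)
    also have "(\<lambda>\<theta>. \<phi> \<theta> * cis (of_int p * \<theta>) - \<phi> \<theta> * cis (of_int (p - 1) * \<theta>))
        = (\<lambda>\<theta>. g \<theta> * cis (of_int p * \<theta>))"
    proof
      fix \<theta> :: real
      have "cis (of_int (p - 1) * \<theta>) = cis (- \<theta>) * cis (of_int p * \<theta>)"
        by (simp add: cis_mult algebra_simps)
      then show "\<phi> \<theta> * cis (of_int p * \<theta>) - \<phi> \<theta> * cis (of_int (p - 1) * \<theta>) = g \<theta> * cis (of_int p * \<theta>)"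
        by (simp add: g_def algebra_simps)
    qed
    finally have diff: "low_coeff h \<epsilon> p - low_coeff h \<epsilon> (p - 1)
        = integral {-pi..pi} (\<lambda>\<theta>. g \<theta> * cis (of_int p * \<theta>))" .
    have "cmod (low_coeff h \<epsilon> p - low_coeff h \<epsilon> (p - 1)) \<le> 2 * (2 * \<epsilon>) * ((1 + B0) * (2 * \<epsilon>))"
      unfolding diff using e he g_le zero
      by (intro norm_integral_le_of_support integrable_continuous_real continuous_intros
          continuous_on_subset[OF cont_g]) (auto simp: norm_mult)
    also have "\<dots> \<le> K * \<epsilon>\<^sup>2"
      using mult_right_mono[OF K(3), of "\<epsilon>\<^sup>2"] by (simp add: power2_eq_square algebra_simps)
    finally have r2: "cmod (low_coeff h \<epsilon> p - low_coeff h \<epsilon> (p - 1)) \<le> K * \<epsilon>\<^sup>2" .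
    have "(of_int p)\<^sup>2 * cmod (low_coeff h \<epsilon> p - low_coeff h \<epsilon> (p - 1))
        = cmod (of_int p ^ 2 * integral {-pi..pi} (\<lambda>\<theta>. g \<theta> * cis (of_int p * \<theta>)))"
      unfolding diff by (simp add: norm_mult norm_power)
    also have "\<dots> = cmod (integral {-pi..pi} (\<lambda>\<theta>. g'' \<theta> * cis (of_int p * \<theta>)))"
      using he by (subst integral_cis_by_parts_twice[OF g' g'' cont_g'']) (auto intro: zero)
    also have "\<dots> \<le> 2 * (2 * \<epsilon>) * ((2 * B2 + 2 * B1 + 1 + B0) / \<epsilon>)"
      using e he g''_le zero
      by (intro norm_integral_le_of_support integrable_continuous_real continuous_intros
          continuous_on_subset[OF cont_g'']) (auto simp: norm_mult)
    also have "\<dots> \<le> K"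
      using e K(4) by simp
    finally have r3: "(of_int p)\<^sup>2 * cmod (low_coeff h \<epsilon> p - low_coeff h \<epsilon> (p - 1)) \<le> K" .
    note r1 r2 r3
  }
  then show thesis
    using K(1) by (intro that[of K])
qed

section \<open>Estimating a term by an oscillatory integral\<close>

lemma sum_even_le:
  fixes g :: "nat \<Rightarrow> real"
  assumes "\<And>q. g q \<ge> 0"
  shows "(\<Sum>k<N. g (nat \<bar>int n - int k\<bar>)) \<le> (\<Sum>q<Suc n. g q) + (\<Sum>q<N. g q)"
proof -
  let ?A = "{k. k < N \<and> k \<le> n}" and ?B = "{k. k < N \<and> n < k}"
  have "(\<Sum>k<N. g (nat \<bar>int n - int k\<bar>)) = (\<Sum>k\<in>?A \<union> ?B. g (nat \<bar>int n - int k\<bar>))"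
    by (intro sum.cong) auto
  also have "\<dots> = (\<Sum>k\<in>?A. g (nat \<bar>int n - int k\<bar>)) + (\<Sum>k\<in>?B. g (nat \<bar>int n - int k\<bar>))"
    by (intro sum.union_disjoint) auto
  also have "(\<Sum>k\<in>?A. g (nat \<bar>int n - int k\<bar>)) = (\<Sum>k\<in>?A. g (n - k))"
    by (intro sum.cong) (auto simp: nat_diff_distrib intro!: arg_cong[of _ _ g])
  also have "\<dots> = (\<Sum>q\<in>(\<lambda>k. n - k) ` ?A. g q)"
    by (subst sum.reindex) (auto simp: inj_on_def)
  also have "\<dots> \<le> (\<Sum>q<Suc n. g q)"
    using assms by (intro sum_mono2) auto
  also have "(\<Sum>k\<in>?B. g (nat \<bar>int n - int k\<bar>)) = (\<Sum>k\<in>?B. g (k - n))"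
    by (intro sum.cong) (auto intro!: arg_cong[of _ _ g])
  also have "\<dots> = (\<Sum>q\<in>(\<lambda>k. k - n) ` ?B. g q)"
    by (subst sum.reindex) (auto simp: inj_on_def)
  also have "\<dots> \<le> (\<Sum>q<N. g q)"
    using assms by (intro sum_mono2) auto
  finally show ?thesis
    by simp
qed

text \<open>With u = 1/\<epsilon> the two bounds combine to f p \<le> 4 K / (|p| + u)^2, which is
  dominated by a telescoping difference. Its sum over p \<ge> 0 is at most 4 K / (u - 1), and this
  is at most 8 K \<epsilon> because \<epsilon> \<le> 1/2 means u \<ge> 2. The two signs of p double
  the constant.\<close>

lemma sum_min_kernel_le:
  fixes f :: "int \<Rightarrow> real"
  assumes e: "0 < \<epsilon>" "\<epsilon> \<le> 1 / 2" and K: "K \<ge> 0"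
    and f: "\<And>p. f p \<le> K * \<epsilon>\<^sup>2" "\<And>p. (of_int p)\<^sup>2 * f p \<le> K"
  shows "(\<Sum>k<N. f (int n - int k)) \<le> 16 * K * \<epsilon>"
proof -
  define u where "u = 1 / \<epsilon>"
  have u: "u \<ge> 2" "\<epsilon> = 1 / u"
    using e by (auto simp: u_def field_simps)
  define g where "g q = 4 * K * (1 / (real q + u - 1) - 1 / (real (Suc q) + u - 1))" for q
  have g_nonneg: "g q \<ge> 0" for q
    unfolding g_def using u K by (intro mult_nonneg_nonneg) (auto intro!: divide_left_mono)
  have fg: "f p \<le> g (nat \<bar>p\<bar>)" for p
  proof -
    define q where "q = real_of_int \<bar>p\<bar>"
    have q: "q \<ge> 0" "real (nat \<bar>p\<bar>) = q" "(of_int p)\<^sup>2 = q\<^sup>2"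
      by (auto simp: q_def)
    have "(q + u)\<^sup>2 * f p \<le> 4 * K"
    proof (cases "f p \<ge> 0")
      case True
      have "(q + u)\<^sup>2 \<le> 2 * q\<^sup>2 + 2 * u\<^sup>2"
        using sum_squares_bound[of q u] by (simp add: power2_eq_square algebra_simps)
      then have "(q + u)\<^sup>2 * f p \<le> (2 * q\<^sup>2 + 2 * u\<^sup>2) * f p"
        using True by (rule mult_right_mono)
      also have "\<dots> = 2 * ((of_int p)\<^sup>2 * f p) + 2 * (u\<^sup>2 * f p)"
        unfolding q(3) by (simp add: algebra_simps)
      also have "u\<^sup>2 * f p \<le> u\<^sup>2 * (K * \<epsilon>\<^sup>2)"
        by (intro mult_left_mono f) auto
      also have "\<dots> = K"
        using u by (simp add: power_divide)
      finally show ?thesis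
        using f(2)[of p] by simp
    next
      case False
      then have "(q + u)\<^sup>2 * f p \<le> 0"
        by (simp add: mult_nonneg_nonpos)
      then show ?thesis
        using K by linarith
    qed
    then have "f p \<le> 4 * K / (q + u)\<^sup>2"
      using q u by (simp add: pos_le_divide_eq mult.commute)
    also have "\<dots> \<le> 4 * K / ((q + u - 1) * (q + u))"
      using q u K by (intro divide_left_mono) (auto simp: power2_eq_square intro!: mult_right_mono)
    also have "\<dots> = g (nat \<bar>p\<bar>)"
      unfolding g_def using q u by (simp add: field_simps)
    finally show ?thesis .
  qed
  have tele: "(\<Sum>q<M. g q) \<le> 8 * K * \<epsilon>" for M
  proof -
    have "(\<Sum>q<M. g q) = 4 * K * (\<Sum>q<M. 1 / (real q + u - 1) - 1 / (real (Suc q) + u - 1))"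
      unfolding g_def by (simp add: sum_distrib_left)
    also have "\<dots> = 4 * K * (1 / (u - 1) - 1 / (real M + u - 1))"
      using sum_lessThan_telescope'[of "\<lambda>q. 1 / (real q + u - 1)" M] by simp
    also have "\<dots> \<le> 4 * K * (2 * \<epsilon>)"
    proof -
      have "1 / (u - 1) \<le> 2 * (1 / u)" "0 \<le> 1 / (real M + u - 1)"
        using u(1) by (auto simp: field_simps)
      then show ?thesis
        unfolding u(2) using K by (intro mult_left_mono) linarith+
    qed
    finally show ?thesis
      by simp
  qed
  have "(\<Sum>k<N. f (int n - int k)) \<le> (\<Sum>k<N. g (nat \<bar>int n - int k\<bar>))"
    by (intro sum_mono fg)
  also have "\<dots> \<le> (\<Sum>q<Suc n. g q) + (\<Sum>q<N. g q)"
    by (intro sum_even_le g_nonneg)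
  also have "\<dots> \<le> 16 * K * \<epsilon>"
    using tele[of "Suc n"] tele[of N] by simp
  finally show ?thesis .
qed

lemma norm_sum_by_parts_le:
  fixes y :: "nat \<Rightarrow> 'a::complex_banach"
  assumes M: "\<And>j. norm (\<Sum>k<j. y k) \<le> M"
  shows "norm (\<Sum>k<N. d k *\<^sub>C y k) \<le> M * (cmod (d N) + (\<Sum>k<N. cmod (d k - d (Suc k))))"
proof -
  have eq: "(\<Sum>k<N. d k *\<^sub>C y k) = d N *\<^sub>C (\<Sum>k<N. y k) + (\<Sum>k<N. (d k - d (Suc k)) *\<^sub>C (\<Sum>i<Suc k. y i))"
    by (induction N) (simp_all add: scaleC.diff_left scaleC.add_right scaleC.zero_right)
  have "norm (\<Sum>k<N. d k *\<^sub>C y k) \<le> cmod (d N) * M + (\<Sum>k<N. cmod (d k - d (Suc k)) * M)"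
    unfolding eq
    by (intro norm_triangle_mono sum_norm_le) (auto simp: norm_scaleC intro!: mult_left_mono M simp del: sum.lessThan_Suc)
  then show ?thesis
    by (simp add: distrib_left sum_distrib_left mult.commute)
qed

text \<open>The weights decrease, so their variation and the last weight add up to \<rho>. The
  resulting bound is free of \<rho>, which is what allows r to tend to 1 later, with \<rho> =
  1/r.\<close>

lemma norm_geometric_sum_le:
  fixes x :: "nat \<Rightarrow> 'a::complex_banach"
  assumes M: "\<And>j. norm (\<Sum>k<j. x k) \<le> M" and "0 \<le> \<rho>" "\<rho> \<le> 1"
  shows "norm (\<Sum>k<j. of_real (\<rho> ^ Suc k) *\<^sub>C x k) \<le> M"
proof -
  have M0: "M \<ge> 0"
    using M[of 0] by simp
  have "cmod (of_real (\<rho> ^ Suc k) - of_real (\<rho> ^ Suc (Suc k))) = \<rho> ^ Suc k - \<rho> ^ Suc (Suc k)" for k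
  proof -
    have "\<rho> ^ Suc (Suc k) \<le> \<rho> ^ Suc k"
      using assms by (intro power_decreasing) auto
    then show ?thesis
      by (simp flip: of_real_diff of_real_power of_real_mult add: norm_of_real del: power_Suc)
  qed
  then have "(\<Sum>k<j. cmod (of_real (\<rho> ^ Suc k) - of_real (\<rho> ^ Suc (Suc k)))) = \<rho> - \<rho> ^ Suc j"
    using sum_lessThan_telescope'[of "\<lambda>k. \<rho> ^ Suc k" j] by simp
  moreover have "cmod (of_real (\<rho> ^ Suc j)) = \<rho> ^ Suc j"
    using assms(2) by (simp add: norm_power norm_mult)
  ultimately have "norm (\<Sum>k<j. of_real (\<rho> ^ Suc k) *\<^sub>C x k) \<le> M * \<rho>"
    using norm_sum_by_parts_le[of x M "\<lambda>k. of_real (\<rho> ^ Suc k)" j] M by simp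
  also have "\<dots> \<le> M"
    using M0 assms(3) by (rule mult_left_le[rotated])
  finally show ?thesis .
qed

text \<open>The frequency is \<open>Suc n\<close> because x_n is the coefficient of the power -(n+1)
  in \<open>G_transform x\<close>. The function \<Phi> is a parameter: it stands for F, for its
  derivatives along the circle and for the dilates of \<open>G_transform x\<close>.\<close>

definition osc_integral :: "(complex \<Rightarrow> 'a::complex_banach) \<Rightarrow> nat \<Rightarrow> (real \<Rightarrow> real) \<Rightarrow> real \<Rightarrow> 'a" where
  "osc_integral \<Phi> n h \<epsilon> =
     integral {-pi..pi} (\<lambda>\<theta>. (of_real (h (\<theta> / \<epsilon>)) * cis (real (Suc n) * \<theta>)) *\<^sub>C \<Phi> (cis \<theta>))"

lemma test_function_cutoff:
  assumes h: "cutoff q c h" and e: "0 < \<epsilon>" "2 * \<epsilon> < pi"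
  shows "test_function (\<lambda>\<theta>. of_real (h (\<theta> / \<epsilon>)) * cis (real (Suc n) * \<theta>))"
  unfolding test_function_def
proof (intro conjI)
  show "continuous_on {-pi..pi} (\<lambda>\<theta>. of_real (h (\<theta> / \<epsilon>)) * cis (real (Suc n) * \<theta>))"
    using e by (intro continuous_intros continuous_on_compose2[OF cutoff_continuous[OF h, of UNIV]]) auto
  show "\<exists>\<delta>>0. \<forall>\<theta>\<in>{-pi..pi}. \<bar>\<theta>\<bar> < \<delta> \<longrightarrow> complex_of_real (h (\<theta> / \<epsilon>)) * cis (real (Suc n) * \<theta>) = 0"
    using e by (intro exI[of _ \<epsilon>]) (auto simp: cutoff_inner[OF h] abs_divide)
  have "cis (real (Suc n) * (- pi)) = cis (real (Suc n) * pi)"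
    using sin_npi[of "Suc n"] by (simp add: complex_eq_iff del: sin_npi of_nat_Suc)
  then show "complex_of_real (h (- pi / \<epsilon>)) * cis (real (Suc n) * - pi)
      = complex_of_real (h (pi / \<epsilon>)) * cis (real (Suc n) * pi)"
    using e by (simp add: cutoff_outer[OF h] abs_divide field_simps)
qed

text \<open>On a circle of radius r > 1 the series of \<open>G_transform x\<close> converges
  uniformly and may be integrated term by term. Writing the cutoff as 1 - (1 - h) splits the k-th
  coefficient into 2 \<pi> for k = n and the low-frequency coefficient at n - k.\<close>

lemma osc_integral_G_transform:
  fixes x :: "nat \<Rightarrow> 'a::complex_banach"
  assumes x: "bounded (range x)" and r: "r > 1" and h: "cutoff 2 1 h" and e: "0 < \<epsilon>" "\<epsilon> \<le> 1 / 2"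
  shows "continuous_on {-pi..pi} (\<lambda>\<theta>. (of_real (h (\<theta> / \<epsilon>)) * cis (real (Suc n) * \<theta>)) *\<^sub>C G_transform x (of_real r * cis \<theta>))"
    and "(\<lambda>N. \<Sum>k<N. (of_real ((1 / r) ^ Suc k) * ((if k = n then 2 * pi else 0) - low_coeff h \<epsilon> (int n - int k))) *\<^sub>C x k)
       \<longlonglongrightarrow> osc_integral (\<lambda>z. G_transform x (of_real r * z)) n h \<epsilon>"
proof -
  obtain B where B: "\<And>k. norm (x k) \<le> B"
    using x by (auto simp: bounded_iff)
  obtain B0 where B0: "B0 > 0" "\<And>t. \<bar>h t\<bar> \<le> B0"
    using h by (rule cutoff_bounded) (rule that)
  define \<psi> where "\<psi> \<theta> = complex_of_real (h (\<theta> / \<epsilon>)) * cis (real (Suc n) * \<theta>)" for \<theta>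
  have cont_h: "continuous_on S (\<lambda>\<theta>. h (\<theta> / \<epsilon>))" for S
    using e by (intro continuous_intros continuous_on_compose2[OF cutoff_continuous[OF h, of UNIV]]) auto
  have cont_psi: "continuous_on S \<psi>" for S
    unfolding \<psi>_def[abs_def] by (intro continuous_intros cont_h)
  define f where "f k \<theta> = inverse ((of_real r * cis \<theta>) ^ (k + 1)) *\<^sub>C x k" for k and \<theta> :: real
  have inv: "inverse ((of_real r * cis \<theta>) ^ (k + 1)) = of_real ((1 / r) ^ Suc k) * cis (- (real (Suc k) * \<theta>))" for k \<theta>
  proof -
    have "(of_real r * cis \<theta>) ^ (k + 1) = of_real (r ^ Suc k) * cis (real (Suc k) * \<theta>)"
      by (simp only: power_mult_distrib Complex.DeMoivre Suc_eq_plus1 of_real_power)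
    then have "inverse ((of_real r * cis \<theta>) ^ (k + 1))
        = of_real (inverse (r ^ Suc k)) * cis (- (real (Suc k) * \<theta>))"
      by (simp only: inverse_mult_distrib cis_inverse of_real_inverse)
    then show ?thesis
      by (simp only: power_one_over inverse_eq_divide)
  qed
  have nf: "norm (f k \<theta>) \<le> (1 / r) ^ Suc k * B" for k \<theta>
    unfolding f_def inv using r B[of k]
    by (simp add: norm_scaleC norm_mult norm_power norm_divide mult_left_mono divide_right_mono del: power_Suc)
  have summ: "summable (\<lambda>k. (1 / r) ^ Suc k * B)"
  proof (rule summable_mult2)
    have "summable (\<lambda>k. (1 / r) ^ k)"
      using r by (intro summable_geometric) simp
    then show "summable (\<lambda>k. (1 / r) ^ Suc k)"
      by (rule summable_Suc_iff[THEN iffD2])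
  qed
  have sum_f: "summable (\<lambda>k. f k \<theta>)" for \<theta>
    using nf by (intro summable_comparison_test'[OF summ]) auto
  have G: "G_transform x (of_real r * cis \<theta>) = (\<Sum>k. f k \<theta>)" for \<theta>
    by (simp add: G_transform_def f_def)
  have bound: "norm (\<psi> \<theta> *\<^sub>C f k \<theta>) \<le> B0 * ((1 / r) ^ Suc k * B)" for k \<theta>
    unfolding norm_scaleC using B0 nf
    by (intro mult_mono) (auto simp: \<psi>_def norm_mult)
  have cont_f: "continuous_on S (\<lambda>\<theta>. \<psi> \<theta> *\<^sub>C f k \<theta>)" for S k
    unfolding f_def inv by (intro scaleC.continuous_on continuous_intros cont_psi)
  have "uniform_limit {-pi..pi} (\<lambda>N \<theta>. \<Sum>k<N. \<psi> \<theta> *\<^sub>C f k \<theta>) (\<lambda>\<theta>. \<Sum>k. \<psi> \<theta> *\<^sub>C f k \<theta>) sequentially"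
    using bound by (intro Weierstrass_m_test[of _ _ "\<lambda>k. B0 * ((1 / r) ^ Suc k * B)"] summable_mult summ)
  also have "(\<lambda>\<theta>. \<Sum>k. \<psi> \<theta> *\<^sub>C f k \<theta>) = (\<lambda>\<theta>. \<psi> \<theta> *\<^sub>C G_transform x (of_real r * cis \<theta>))"
    unfolding G by (intro ext bounded_linear.suminf[OF scaleC.bounded_linear_right, symmetric] sum_f)
  finally have ul: "uniform_limit {-pi..pi} (\<lambda>N \<theta>. \<Sum>k<N. \<psi> \<theta> *\<^sub>C f k \<theta>)
      (\<lambda>\<theta>. \<psi> \<theta> *\<^sub>C G_transform x (of_real r * cis \<theta>)) sequentially" .
  have cont_sum: "continuous_on {-pi..pi} (\<lambda>\<theta>. \<Sum>k<N. \<psi> \<theta> *\<^sub>C f k \<theta>)" for N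
    by (intro continuous_on_sum cont_f)
  then show "continuous_on {-pi..pi} (\<lambda>\<theta>. (of_real (h (\<theta> / \<epsilon>)) * cis (real (Suc n) * \<theta>)) *\<^sub>C G_transform x (of_real r * cis \<theta>))"
    using uniform_limit_theorem[OF _ ul] unfolding \<psi>_def by simp
  define c where "c k = of_real ((1 / r) ^ Suc k) * ((if k = n then 2 * pi else 0) - low_coeff h \<epsilon> (int n - int k))" for k
  have int_f: "((\<lambda>\<theta>. \<psi> \<theta> *\<^sub>C f k \<theta>) has_integral c k *\<^sub>C x k) {-pi..pi}" for k
  proof -
    let ?p = "int n - int k"
    have "(\<lambda>\<theta>. of_real (1 - h (\<theta> / \<epsilon>)) * cis (of_int ?p * \<theta>)) integrable_on {-pi..pi}"
      by (intro integrable_continuous_real continuous_intros cont_h)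
    then have "((\<lambda>\<theta>. of_real (1 - h (\<theta> / \<epsilon>)) * cis (of_int ?p * \<theta>)) has_integral low_coeff h \<epsilon> ?p) {-pi..pi}"
      unfolding low_coeff_def by (rule integrable_integral)
    from has_integral_mult_right[OF has_integral_diff[OF has_integral_cis[of ?p] this], of "of_real ((1 / r) ^ Suc k)"]
    moreover have "cis (of_int ?p * \<theta>) - of_real (1 - h (\<theta> / \<epsilon>)) * cis (of_int ?p * \<theta>)
        = of_real (h (\<theta> / \<epsilon>)) * cis (of_int ?p * \<theta>)" for \<theta>
      by (simp add: left_diff_distrib)
    moreover have "c k = of_real ((1 / r) ^ Suc k) * ((if ?p = 0 then 2 * pi else 0) - low_coeff h \<epsilon> ?p)"
      by (simp add: c_def)
    ultimately have "((\<lambda>\<theta>. of_real ((1 / r) ^ Suc k) * (of_real (h (\<theta> / \<epsilon>)) * cis (of_int ?p * \<theta>))) has_integral c k) {-pi..pi}"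
      by (simp only:)
    from has_integral_linear[OF this scaleC.bounded_linear_left[of "x k"]]
    have "((\<lambda>\<theta>. (of_real ((1 / r) ^ Suc k) * (of_real (h (\<theta> / \<epsilon>)) * cis (of_int ?p * \<theta>))) *\<^sub>C x k)
        has_integral c k *\<^sub>C x k) {-pi..pi}"
      by (simp add: o_def)
    moreover have "(of_real ((1 / r) ^ Suc k) * (of_real (h (\<theta> / \<epsilon>)) * cis (of_int ?p * \<theta>))) *\<^sub>C x k
        = \<psi> \<theta> *\<^sub>C f k \<theta>" for \<theta>
    proof -
      have "cis (of_int ?p * \<theta>) = cis (real (Suc n) * \<theta>) * cis (- (real (Suc k) * \<theta>))"
        by (simp add: cis_mult algebra_simps)
      then show ?thesis
        unfolding f_def inv \<psi>_def scaleC_scaleC by (simp add: mult_ac)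
    qed
    ultimately show ?thesis
      by simp
  qed
  have int_sum: "((\<lambda>\<theta>. \<Sum>k<N. \<psi> \<theta> *\<^sub>C f k \<theta>) has_integral (\<Sum>k<N. c k *\<^sub>C x k)) {-pi..pi}" for N
    by (intro has_integral_sum int_f) auto
  obtain I L where I: "\<And>N. ((\<lambda>\<theta>. \<Sum>k<N. \<psi> \<theta> *\<^sub>C f k \<theta>) has_integral I N) {-pi..pi}"
    and L: "((\<lambda>\<theta>. \<psi> \<theta> *\<^sub>C G_transform x (of_real r * cis \<theta>)) has_integral L) {-pi..pi}" and lim: "I \<longlonglongrightarrow> L"
    by (rule uniform_limit_integral[OF ul cont_sum sequentially_bot]) (rule that)
  have "I = (\<lambda>N. \<Sum>k<N. c k *\<^sub>C x k)"
    using I int_sum has_integral_unique by blast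
  moreover have "L = osc_integral (\<lambda>z. G_transform x (of_real r * z)) n h \<epsilon>"
    using L by (simp add: osc_integral_def \<psi>_def integral_unique)
  ultimately show "(\<lambda>N. \<Sum>k<N. (of_real ((1 / r) ^ Suc k) * ((if k = n then 2 * pi else 0) - low_coeff h \<epsilon> (int n - int k))) *\<^sub>C x k)
       \<longlonglongrightarrow> osc_integral (\<lambda>z. G_transform x (of_real r * z)) n h \<epsilon>"
    using lim unfolding c_def by simp
qed

text \<open>The estimate is made for partial sums of length N at a fixed r > 1, with an error bound
  that depends on neither. Then N tends to infinity, and afterwards r tends to 1; the boundary
  function enters in this last limit. The constant is uniform in n and \<epsilon>, so \<epsilon> may
  later depend on n.\<close>

lemma norm_term_le_osc_integral:
  fixes x :: "nat \<Rightarrow> 'a::complex_banach"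
  assumes x: "bounded (range x)" and s: "bounded (range (\<lambda>n. \<Sum>k\<le>n. x k))"
    and F: "boundary_function (G_transform x) F" and h: "cutoff 2 1 h"
  obtains K where "K > 0" "\<And>n \<epsilon>. 0 < \<epsilon> \<Longrightarrow> \<epsilon> \<le> 1 / 2 \<Longrightarrow>
    2 * pi * norm (x n) \<le> norm (osc_integral F n h \<epsilon>) + K * \<epsilon>"
proof -
  obtain M where M': "M > 0" "\<And>n. norm (\<Sum>k\<le>n. x k) \<le> M"
    using s by (auto simp: bounded_pos)
  have M: "norm (\<Sum>k<j. x k) \<le> M" for j
    using M' by (cases j) (auto simp: lessThan_Suc_atMost)
  obtain K where K: "K > 0"
    "\<And>\<epsilon> p. 0 < \<epsilon> \<Longrightarrow> \<epsilon> \<le> 1 / 2 \<Longrightarrow> cmod (low_coeff h \<epsilon> p) \<le> K * \<epsilon>"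
    "\<And>\<epsilon> p. 0 < \<epsilon> \<Longrightarrow> \<epsilon> \<le> 1 / 2 \<Longrightarrow> cmod (low_coeff h \<epsilon> p - low_coeff h \<epsilon> (p - 1)) \<le> K * \<epsilon>\<^sup>2"
    "\<And>\<epsilon> p. 0 < \<epsilon> \<Longrightarrow> \<epsilon> \<le> 1 / 2 \<Longrightarrow>
      (of_int p)\<^sup>2 * cmod (low_coeff h \<epsilon> p - low_coeff h \<epsilon> (p - 1)) \<le> K"
    using h by (rule low_coeff_bounds) (rule that)
  \<comment> \<open>17 = 16 + 1: the variation of the coefficients from
    \<open>sum_min_kernel_le\<close>, and the last coefficient.\<close>
  have "2 * pi * norm (x n) \<le> norm (osc_integral F n h \<epsilon>) + M * (17 * K) * \<epsilon>"
    if e: "0 < \<epsilon>" "\<epsilon> \<le> 1 / 2" for n \<epsilon>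
  proof -
    let ?\<psi> = "\<lambda>\<theta>. complex_of_real (h (\<theta> / \<epsilon>)) * cis (real (Suc n) * \<theta>)"
    define d where "d k = low_coeff h \<epsilon> (int n - int k)" for k
    have tf: "test_function ?\<psi>"
      using e pi_gt3 by (intro test_function_cutoff[OF h]) auto
    have le: "2 * pi * (1 / r) ^ Suc n * norm (x n)
        \<le> norm (osc_integral (\<lambda>z. G_transform x (of_real r * z)) n h \<epsilon>) + M * (17 * K) * \<epsilon>" if r: "r > 1" for r
    proof (rule tendsto_lowerbound)
      define y where "y k = of_real ((1 / r) ^ Suc k) *\<^sub>C x k" for k
      let ?T = "\<lambda>N. \<Sum>k<N. (of_real ((1 / r) ^ Suc k) * ((if k = n then 2 * pi else 0) - d k)) *\<^sub>C x k"
      show "(\<lambda>N. norm (?T N) + M * (17 * K) * \<epsilon>) \<longlonglongrightarrow>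
          norm (osc_integral (\<lambda>z. G_transform x (of_real r * z)) n h \<epsilon>) + M * (17 * K) * \<epsilon>"
        unfolding d_def by (intro tendsto_intros osc_integral_G_transform(2)[OF x r h e])
      show "\<forall>\<^sub>F N in sequentially. 2 * pi * (1 / r) ^ Suc n * norm (x n) \<le> norm (?T N) + M * (17 * K) * \<epsilon>"
      proof (rule eventually_sequentiallyI[of "Suc n"])
        fix N
        assume N: "Suc n \<le> N"
        have y: "norm (\<Sum>k<j. y k) \<le> M" for j
          unfolding y_def using r M by (intro norm_geometric_sum_le) auto
        have "(\<Sum>k<N. cmod (d k - d (Suc k))) \<le> 16 * K * \<epsilon>"
        proof -
          \<comment> \<open>Raising k by one lowers the frequency by one, so the variation in k is
            the one bounded by \<open>low_coeff_bounds\<close>.\<close>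
          have "d (Suc k) = low_coeff h \<epsilon> ((int n - int k) - 1)" for k
            by (simp add: d_def algebra_simps)
          then show ?thesis
            using sum_min_kernel_le[OF e, of K "\<lambda>p. cmod (low_coeff h \<epsilon> p - low_coeff h \<epsilon> (p - 1))" n N] K e
            by (simp add: d_def)
        qed
        moreover have "cmod (d N) \<le> K * \<epsilon>"
          using K(2) e by (simp add: d_def)
        ultimately have "M * (cmod (d N) + (\<Sum>k<N. cmod (d k - d (Suc k)))) \<le> M * (17 * K * \<epsilon>)"
          using M'(1) by (intro mult_left_mono) auto
        then have D: "norm (\<Sum>k<N. d k *\<^sub>C y k) \<le> M * (17 * K) * \<epsilon>"
          using norm_sum_by_parts_le[OF y, of d N] by simp
        have "?T N = (\<Sum>k<N. (if k = n then 2 * pi else 0) *\<^sub>C y k) - (\<Sum>k<N. d k *\<^sub>C y k)"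
          unfolding y_def
          unfolding sum_subtractf[symmetric] scaleC.diff_left[symmetric] scaleC_scaleC
          by (intro sum.cong arg_cong2[of _ _ _ _ scaleC] refl) (simp add: algebra_simps)
        also have "(\<Sum>k<N. (if k = n then 2 * pi else 0) *\<^sub>C y k) = (\<Sum>k<N. if k = n then of_real (2 * pi) *\<^sub>C y k else 0)"
          by (intro sum.cong) (auto simp: scaleC.zero_left)
        also have "\<dots> = of_real (2 * pi) *\<^sub>C y n"
          using N by (subst sum.delta) auto
        finally have "of_real (2 * pi) *\<^sub>C y n = ?T N + (\<Sum>k<N. d k *\<^sub>C y k)"
          by simp
        then have "norm (complex_of_real (2 * pi) *\<^sub>C y n) \<le> norm (?T N) + M * (17 * K) * \<epsilon>"
          using norm_triangle_ineq[of "?T N" "\<Sum>k<N. d k *\<^sub>C y k"] D by simp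
        moreover have "norm (complex_of_real (2 * pi) *\<^sub>C y n) = 2 * pi * (1 / r) ^ Suc n * norm (x n)"
          using r unfolding y_def norm_scaleC norm_of_real by simp
        ultimately show "2 * pi * (1 / r) ^ Suc n * norm (x n) \<le> norm (?T N) + M * (17 * K) * \<epsilon>"
          by simp
      qed
    qed simp
    have int_G: "Bochner_integral (lebesgue_on {-pi..pi}) (\<lambda>\<theta>. ?\<psi> \<theta> *\<^sub>C G_transform x (complex_of_real r * cis \<theta>))
        = osc_integral (\<lambda>z. G_transform x (of_real r * z)) n h \<epsilon>" if r: "r > 1" for r
      unfolding osc_integral_def
      by (intro Bochner_integral_eq_integral Bochner_integrable_continuous osc_integral_G_transform(1)[OF x r h e]) simp
    have "Bochner_integrable (lebesgue_on {-pi..pi}) (\<lambda>\<theta>. ?\<psi> \<theta> *\<^sub>C F (cis \<theta>))"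
      using F tf unfolding boundary_function_def L1_loc_def by blast
    then have int_F: "Bochner_integral (lebesgue_on {-pi..pi}) (\<lambda>\<theta>. ?\<psi> \<theta> *\<^sub>C F (cis \<theta>)) = osc_integral F n h \<epsilon>"
      unfolding osc_integral_def by (rule Bochner_integral_eq_integral)
    have "((\<lambda>r. Bochner_integral (lebesgue_on {-pi..pi}) (\<lambda>\<theta>. ?\<psi> \<theta> *\<^sub>C G_transform x (complex_of_real r * cis \<theta>)))
        \<longlongrightarrow> osc_integral F n h \<epsilon>) (at_right 1)"
      using F tf unfolding boundary_function_def int_F[symmetric] by blast
    then have lim: "((\<lambda>r. osc_integral (\<lambda>z. G_transform x (of_real r * z)) n h \<epsilon>) \<longlongrightarrow> osc_integral F n h \<epsilon>) (at_right 1)"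
      by (rule Lim_transform_eventually)
        (use int_G in \<open>auto intro: eventually_mono[OF eventually_at_right_less]\<close>)
    have "2 * pi * (1 / 1) ^ Suc n * norm (x n) \<le> norm (osc_integral F n h \<epsilon>) + M * (17 * K) * \<epsilon>"
    proof (rule tendsto_le)
      show "((\<lambda>r. norm (osc_integral (\<lambda>z. G_transform x (of_real r * z)) n h \<epsilon>) + M * (17 * K) * \<epsilon>)
          \<longlongrightarrow> norm (osc_integral F n h \<epsilon>) + M * (17 * K) * \<epsilon>) (at_right 1)"
        by (intro tendsto_intros lim)
      show "((\<lambda>r. 2 * pi * (1 / r) ^ Suc n * norm (x n)) \<longlongrightarrow> 2 * pi * (1 / 1) ^ Suc n * norm (x n)) (at_right 1)"
        by (intro tendsto_intros) auto
      show "\<forall>\<^sub>F r in at_right 1. 2 * pi * (1 / r) ^ Suc n * norm (x n)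
          \<le> norm (osc_integral (\<lambda>z. G_transform x (of_real r * z)) n h \<epsilon>) + M * (17 * K) * \<epsilon>"
        using le by (auto intro: eventually_mono[OF eventually_at_right_less] simp del: power_Suc)
    qed simp
    then show ?thesis
      by simp
  qed
  then show thesis
    using M'(1) K(1) by (intro that[of "M * (17 * K)"]) auto
qed

section \<open>Integration by parts\<close>

lemma tendsto_zero_of_boundary_function:
  fixes x :: "nat \<Rightarrow> 'a::complex_banach"
  assumes x: "bounded (range x)" and s: "bounded (range (\<lambda>n. \<Sum>k\<le>n. x k))"
    and F: "boundary_function (G_transform x) F"
  shows "x \<longlonglongrightarrow> 0"
proof (rule tendstoI)
  fix e :: real
  assume "e > 0"
  obtain h where h: "cutoff 2 1 h"
    using cutoff_exists by blast
  obtain K where K: "K > 0" "\<And>n \<epsilon>. 0 < \<epsilon> \<Longrightarrow> \<epsilon> \<le> 1 / 2 \<Longrightarrow>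
      2 * pi * norm (x n) \<le> norm (osc_integral F n h \<epsilon>) + K * \<epsilon>"
    using x s F h by (rule norm_term_le_osc_integral) (rule that)
  \<comment> \<open>Fixed before n, with K \<epsilon> \<le> e: the integrand then depends on n
    through its frequency only, as Riemann--Lebesgue requires.\<close>
  define \<epsilon> where "\<epsilon> = min (1 / 2) (e / K)"
  have e: "0 < \<epsilon>" "\<epsilon> \<le> 1 / 2"
    unfolding \<epsilon>_def using \<open>e > 0\<close> K(1) by (simp, intro min.cobounded1)
  then have e3: "2 * \<epsilon> < pi"
    using pi_gt3 by linarith
  have "\<epsilon> \<le> e / K"
    by (simp add: \<epsilon>_def)
  then have Ke: "K * \<epsilon> \<le> e"
    using K(1) by (simp add: field_simps)
  \<comment> \<open>Riemann--Lebesgue is applied to \<open>w 0\<close>, which already has frequency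
    1. Multiplying it by \<open>cis (real n * \<theta>)\<close> gives exactly \<open>w n\<close>,
    whose integrability is an instance of \<open>L1_loc\<close>.\<close>
  define w where "w n \<theta> = (of_real (h (\<theta> / \<epsilon>)) * cis (real (Suc n) * \<theta>)) *\<^sub>C F (cis \<theta>)" for n \<theta>
  have w: "Bochner_integrable (lebesgue_on {-pi..pi}) (w n)" for n
    using F test_function_cutoff[OF h e(1) e3] unfolding boundary_function_def L1_loc_def w_def by blast
  have w0: "cis (real n * \<theta>) *\<^sub>C w 0 \<theta> = w n \<theta>" for n \<theta>
  proof -
    have "cis (real (Suc n) * \<theta>) = cis (real n * \<theta>) * cis (real (Suc 0) * \<theta>)"
      by (simp add: cis_mult algebra_simps)
    then show ?thesis
      unfolding w_def scaleC_scaleC by (simp add: mult_ac)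
  qed
  have "(\<lambda>n. integral {-pi..pi} (\<lambda>\<theta>. cis (real n * \<theta>) *\<^sub>C w 0 \<theta>)) \<longlonglongrightarrow> 0"
    by (intro riemann_lebesgue_Bochner w) (use Bochner_integral_eq_integral(1)[OF w] w0 in simp)
  then have "(\<lambda>n. osc_integral F n h \<epsilon>) \<longlonglongrightarrow> 0"
    unfolding w0 by (simp add: osc_integral_def w_def)
  from tendstoD[OF this \<open>e > 0\<close>]
  show "\<forall>\<^sub>F n in sequentially. dist (x n) 0 < e"
  proof eventually_elim
    case (elim n)
    then have "2 * pi * norm (x n) < 2 * e"
      using K(2)[OF e, of n] Ke by simp
    moreover have "2 * norm (x n) \<le> 2 * pi * norm (x n)"
      using pi_gt3 by (intro mult_right_mono) auto
    ultimately show ?case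
      by simp
  qed
qed

section \<open>Cutoff integrals over the punctured circle and their integration by parts\<close>

lemma cis_in_punctured_circle:
  assumes "0 < \<bar>\<theta>\<bar>" "\<bar>\<theta>\<bar> \<le> pi"
  shows "cis \<theta> \<in> punctured_circle"
proof -
  have "cos \<bar>\<theta>\<bar> < cos 0"
    using assms by (intro cos_monotone_0_pi) auto
  then have "cos \<theta> \<noteq> 1"
    by simp
  then have "cis \<theta> \<noteq> 1"
    by (auto simp: complex_eq_iff)
  then show ?thesis
    by (simp add: punctured_circle_def)
qed

text \<open>\<Phi> is arbitrary at 1, so continuity is glued from two closed sets meeting at
  |\<theta>| = \<epsilon>/2: on the outer one \<Phi> is continuous, and on the inner one the cutoff,
  zero for |\<theta>| < \<epsilon>, annihilates it.\<close>

lemma continuous_on_cutoff_scaleC: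
  fixes \<Phi> :: "complex \<Rightarrow> 'a::complex_banach"
  assumes \<Phi>: "continuous_on punctured_circle \<Phi>" and h: "cutoff q c h" and e: "0 < \<epsilon>"
    and w: "continuous_on UNIV w"
  shows "continuous_on {-pi..pi} (\<lambda>\<theta>. (of_real (h (\<theta> / \<epsilon>)) * w \<theta>) *\<^sub>C \<Phi> (cis \<theta>))" (is "continuous_on _ ?f")
proof -
  let ?A = "{-pi..pi} \<inter> {\<theta>. \<epsilon> / 2 \<le> \<bar>\<theta>\<bar>}" and ?B = "{-pi..pi} \<inter> {\<theta>. \<bar>\<theta>\<bar> \<le> \<epsilon> / 2}"
  have cA: "closed ?A" and cB: "closed ?B"
    by (intro closed_Int closed_real_atLeastAtMost closed_Collect_le continuous_intros)+
  have "cis ` ?A \<subseteq> punctured_circle"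
    using e by (auto intro!: cis_in_punctured_circle)
  then have "continuous_on ?A (\<lambda>\<theta>. \<Phi> (cis \<theta>))"
    by (intro continuous_on_compose2[OF \<Phi>] continuous_intros)
  then have A: "continuous_on ?A ?f"
    using e by (intro scaleC.continuous_on continuous_intros continuous_on_subset[OF w]
        continuous_on_compose2[OF cutoff_continuous[OF h, of UNIV]]) auto
  have "?f \<theta> = 0" if "\<theta> \<in> ?B" for \<theta>
    using that e by (simp add: cutoff_inner[OF h] abs_divide scaleC.zero_left)
  then have B: "continuous_on ?B ?f"
    by (subst continuous_on_cong[OF refl]) (auto intro: continuous_on_const)
  have "continuous_on (?A \<union> ?B) ?f"
    using cA cB A B by (rule continuous_on_closed_Un)
  moreover have "?A \<union> ?B = {-pi..pi}"
    by auto
  ultimately show ?thesis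
    by simp
qed

text \<open>One statement for both kinds of cutoff: d = \<pi> for the full cutoff, and d = 2
  \<epsilon> for a derivative of it, where c = 0 and the short support supplies a factor
  \<epsilon>.\<close>

lemma norm_osc_integral_le:
  fixes \<Phi> :: "complex \<Rightarrow> 'a::complex_banach"
  assumes \<Phi>: "continuous_on punctured_circle \<Phi>" and h: "cutoff q c h" "\<And>t. \<bar>h t\<bar> \<le> B"
    and e: "0 < \<epsilon>" and d: "0 \<le> d" "d \<le> pi" "d < pi \<Longrightarrow> c = 0 \<and> 2 * \<epsilon> \<le> d"
    and D: "D \<ge> 0" "\<And>\<theta>. \<epsilon> \<le> \<bar>\<theta>\<bar> \<Longrightarrow> \<bar>\<theta>\<bar> \<le> d \<Longrightarrow> norm (\<Phi> (cis \<theta>)) \<le> D"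
  shows "norm (osc_integral \<Phi> n h \<epsilon>) \<le> 2 * d * (B * D)"
proof -
  let ?f = "\<lambda>\<theta>. (of_real (h (\<theta> / \<epsilon>)) * cis (real (Suc n) * \<theta>)) *\<^sub>C \<Phi> (cis \<theta>)"
  \<comment> \<open>Truncated because \<open>norm_integral_le_of_support\<close> wants an integrand
    on the whole line that vanishes beyond d, also when d = \<pi>.\<close>
  let ?g = "\<lambda>\<theta>. if \<bar>\<theta>\<bar> \<le> pi then ?f \<theta> else 0"
  have B0: "B \<ge> 0"
    using h(2)[of 0] by linarith
  have "?f integrable_on {-pi..pi}"
    by (intro integrable_continuous_real continuous_on_cutoff_scaleC[OF \<Phi> h(1) e] continuous_intros)
  then have "?g integrable_on {-pi..pi}"
    by (rule integrable_eq) auto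
  moreover have "norm (?g \<theta>) \<le> B * D" if "\<bar>\<theta>\<bar> \<le> d" for \<theta>
  proof (cases "\<epsilon> \<le> \<bar>\<theta>\<bar>")
    case True
    have "norm (?f \<theta>) = \<bar>h (\<theta> / \<epsilon>)\<bar> * norm (\<Phi> (cis \<theta>))"
      by (simp add: norm_scaleC norm_mult)
    also have "\<dots> \<le> B * D"
      using True that D B0 by (intro mult_mono h(2)) auto
    finally show ?thesis
      using B0 D(1) by simp
  next
    case False
    then have "h (\<theta> / \<epsilon>) = 0"
      using e by (intro cutoff_inner[OF h(1)]) (simp add: abs_divide)
    then show ?thesis
      using B0 D(1) by (simp add: scaleC.zero_left)
  qed
  moreover have "?g \<theta> = 0" if "\<bar>\<theta>\<bar> > d" for \<theta>
  proof (cases "\<bar>\<theta>\<bar> \<le> pi")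
    case True
    then have "c = 0" "2 * \<epsilon> < \<bar>\<theta>\<bar>"
      using d(3) that by linarith+
    then have "h (\<theta> / \<epsilon>) = 0"
      using e cutoff_outer[OF h(1), of "\<theta> / \<epsilon>"] by (simp add: abs_divide field_simps)
    then show ?thesis
      by (simp add: scaleC.zero_left)
  qed simp
  ultimately have "norm (integral {-pi..pi} ?g) \<le> 2 * d * (B * D)"
    using d by (intro norm_integral_le_of_support) auto
  also have "integral {-pi..pi} ?g = osc_integral \<Phi> n h \<epsilon>"
    unfolding osc_integral_def by (intro integral_cong) auto
  finally show ?thesis .
qed

text \<open>Differentiating \<Phi> along the circle produces an extra factor
  \<open>cis \<theta>\<close>, which raises the frequency; hence \<open>Suc n\<close> next to
  \<Phi>'. The boundary terms cancel: the frequency is an integer, and 2 \<epsilon> < \<pi> puts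
  both endpoints where the cutoff is constant.\<close>

lemma osc_integral_by_parts:
  fixes \<Phi> \<Phi>' :: "complex \<Rightarrow> 'a::complex_banach"
  assumes \<Phi>: "continuous_on punctured_circle \<Phi>" "continuous_on punctured_circle \<Phi>'"
    and d\<Phi>: "\<And>\<theta>. cis \<theta> \<in> punctured_circle \<Longrightarrow>
      ((\<lambda>t. \<Phi> (cis t)) has_vector_derivative (\<i> * cis \<theta>) *\<^sub>C \<Phi>' (cis \<theta>)) (at \<theta>)"
    and h: "cutoff q c h" "cutoff q' 0 h'" "\<And>t. (h has_real_derivative h' t) (at t)"
    and e: "0 < \<epsilon>" "2 * \<epsilon> < pi"
  shows "real (Suc n) * norm (osc_integral \<Phi> n h \<epsilon>)
    \<le> norm (osc_integral \<Phi>' (Suc n) h \<epsilon>) + norm (osc_integral \<Phi> n h' \<epsilon>) / \<epsilon>"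
proof -
  let ?c = "\<lambda>t. cis (real (Suc n) * t)" and ?h = "\<lambda>t. complex_of_real (h (t / \<epsilon>))"
    and ?h' = "\<lambda>t. complex_of_real (h' (t / \<epsilon>))"
  let ?H = "\<lambda>t. (?h t * ?c t) *\<^sub>C \<Phi> (cis t)"
  let ?D1 = "\<lambda>t. (?h t * cis (real (Suc (Suc n)) * t)) *\<^sub>C \<Phi>' (cis t)"
  let ?D2 = "\<lambda>t. (?h' t * ?c t) *\<^sub>C \<Phi> (cis t)"
  let ?D = "\<lambda>t. \<i> *\<^sub>C ?D1 t + (\<i> * of_nat (Suc n)) *\<^sub>C ?H t + (1 / \<epsilon>) *\<^sub>R ?D2 t"
  have dH: "(?H has_vector_derivative ?D t) (at t)" if t: "\<bar>t\<bar> \<le> pi" for t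
  proof (cases "\<bar>t\<bar> < \<epsilon>")
    case True
    \<comment> \<open>Here \<Phi> need not be differentiable, but the product vanishes identically
      near t.\<close>
    have zero: "h (s / \<epsilon>) = 0" "h' (s / \<epsilon>) = 0" if "\<bar>s\<bar> < \<epsilon>" for s
      using that e cutoff_inner[OF h(1), of "s / \<epsilon>"] cutoff_inner[OF h(2), of "s / \<epsilon>"]
      by (simp_all add: abs_divide)
    have "((\<lambda>_. 0) has_vector_derivative 0) (at t)"
      by simp
    then have "(?H has_vector_derivative 0) (at t)"
      by (rule has_vector_derivative_transform_within_open[of _ _ _ "{-\<epsilon><..<\<epsilon>}"])
        (use True zero in \<open>auto simp: scaleC.zero_left abs_less_iff\<close>)
    then show ?thesis
      using zero[OF True] by (simp add: scaleC.zero_left scaleC.zero_right)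
  next
    case False
    then have "cis t \<in> punctured_circle"
      using t e by (intro cis_in_punctured_circle) auto
    note d\<Phi>t = d\<Phi>[OF this]
    have "((\<lambda>t. h (t / \<epsilon>)) has_real_derivative h' (t / \<epsilon>) * (1 / \<epsilon>)) (at t)"
      by (rule DERIV_chain2[OF h(3)]) (use e in \<open>auto intro!: derivative_eq_intros\<close>)
    then have dh: "(?h has_vector_derivative of_real (h' (t / \<epsilon>) / \<epsilon>)) (at t)"
      by (intro has_vector_derivative_of_real) (simp add: has_real_derivative_iff_has_vector_derivative)
    have dp: "((\<lambda>t. ?h t * ?c t) has_vector_derivative
        ?h t * (\<i> * of_real (real (Suc n)) * ?c t) + of_real (h' (t / \<epsilon>) / \<epsilon>) * ?c t) (at t)"
      by (rule has_vector_derivative_mult[OF dh has_vector_derivative_cis])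
    have "(?H has_vector_derivative (?h t * ?c t) *\<^sub>C (\<i> * cis t) *\<^sub>C \<Phi>' (cis t)
        + (?h t * (\<i> * of_real (real (Suc n)) * ?c t) + of_real (h' (t / \<epsilon>) / \<epsilon>) * ?c t) *\<^sub>C \<Phi> (cis t)) (at t)"
      by (rule scaleC.has_vector_derivative[OF dp d\<Phi>t])
    moreover have "(?h t * ?c t) *\<^sub>C (\<i> * cis t) *\<^sub>C \<Phi>' (cis t) = \<i> *\<^sub>C ?D1 t"
    proof -
      have "cis (real (Suc (Suc n)) * t) = ?c t * cis t"
        by (simp add: cis_mult algebra_simps)
      then show ?thesis
        unfolding scaleC_scaleC by (simp add: mult_ac)
    qed
    moreover have "(?h t * (\<i> * of_real (real (Suc n)) * ?c t) + of_real (h' (t / \<epsilon>) / \<epsilon>) * ?c t) *\<^sub>C \<Phi> (cis t)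
        = (\<i> * of_nat (Suc n)) *\<^sub>C ?H t + (1 / \<epsilon>) *\<^sub>R ?D2 t"
      unfolding scaleC_of_real[symmetric] scaleC_scaleC scaleC_add_left[symmetric]
      by (simp add: algebra_simps)
    ultimately show ?thesis
      by (simp only: add.assoc)
  qed
  have "cis (real (Suc n) * (- pi)) = cis (real (Suc n) * pi)"
    using sin_npi[of "Suc n"] by (simp add: complex_eq_iff del: sin_npi of_nat_Suc)
  moreover have "cis (- pi) = cis pi"
    by (simp add: complex_eq_iff)
  moreover have "h (- pi / \<epsilon>) = h (pi / \<epsilon>)"
    using e by (simp add: cutoff_outer[OF h(1)] abs_divide field_simps)
  ultimately have periodic: "?H (- pi) = ?H pi"
    by (simp only:)
  have int: "?H integrable_on {-pi..pi}" "?D1 integrable_on {-pi..pi}" "?D2 integrable_on {-pi..pi}"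
    by (intro integrable_continuous_real continuous_on_cutoff_scaleC[OF \<Phi>(1) h(1) e(1)]
        continuous_on_cutoff_scaleC[OF \<Phi>(2) h(1) e(1)] continuous_on_cutoff_scaleC[OF \<Phi>(1) h(2) e(1)]
        continuous_intros)+
  let ?I = "osc_integral \<Phi> n h \<epsilon>" and ?I1 = "osc_integral \<Phi>' (Suc n) h \<epsilon>" and ?I2 = "osc_integral \<Phi> n h' \<epsilon>"
  have "(?D has_integral ?H pi - ?H (- pi)) {-pi..pi}"
  proof (rule fundamental_theorem_of_calculus)
    fix t
    assume "t \<in> {-pi..pi}"
    then have "\<bar>t\<bar> \<le> pi"
      by auto
    then show "(?H has_vector_derivative ?D t) (at t within {-pi..pi})"
      by (rule has_vector_derivative_at_within[OF dH])
  qed simp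
  moreover have "(?D has_integral \<i> *\<^sub>C ?I1 + (\<i> * of_nat (Suc n)) *\<^sub>C ?I + (1 / \<epsilon>) *\<^sub>R ?I2) {-pi..pi}"
    unfolding osc_integral_def
    using int[THEN integrable_integral]
    by (intro has_integral_add has_integral_cmul
        has_integral_linear[OF _ scaleC.bounded_linear_right, unfolded o_def])
  ultimately have "\<i> *\<^sub>C ?I1 + (\<i> * of_nat (Suc n)) *\<^sub>C ?I + (1 / \<epsilon>) *\<^sub>R ?I2 = 0"
    using has_integral_unique periodic by (metis (no_types, lifting) diff_self)
  then have "(\<i> * of_nat (Suc n)) *\<^sub>C ?I = - (\<i> *\<^sub>C ?I1 + (1 / \<epsilon>) *\<^sub>R ?I2)"
    by (simp only: eq_neg_iff_add_eq_0 add.commute add.left_commute)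
  then have "norm ((\<i> * of_nat (Suc n)) *\<^sub>C ?I) = norm (\<i> *\<^sub>C ?I1 + (1 / \<epsilon>) *\<^sub>R ?I2)"
    by (simp only: norm_minus_cancel)
  also have "\<dots> \<le> norm (\<i> *\<^sub>C ?I1) + norm ((1 / \<epsilon>) *\<^sub>R ?I2)"
    by (rule norm_triangle_ineq)
  finally show ?thesis
    using e by (simp add: norm_scaleC norm_mult del: of_nat_Suc)
qed

lemma osc_integral_circle_derivs_by_parts:
  fixes F :: "complex \<Rightarrow> 'a::complex_banach"
  assumes F: "F \<in> C_k k" "j < k"
    and h: "cutoff q c h" "cutoff q' 0 h'" "\<And>t. (h has_real_derivative h' t) (at t)"
    and e: "0 < \<epsilon>" "2 * \<epsilon> < pi"
  shows "real (Suc n) * norm (osc_integral (circle_derivs j F) n h \<epsilon>)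
    \<le> norm (osc_integral (circle_derivs (Suc j) F) (Suc n) h \<epsilon>) + norm (osc_integral (circle_derivs j F) n h' \<epsilon>) / \<epsilon>"
proof (rule osc_integral_by_parts[OF _ _ _ h e])
  show "continuous_on punctured_circle (circle_derivs j F)"
    "continuous_on punctured_circle (circle_derivs (Suc j) F)"
    using F unfolding C_k_def mem_Collect_eq using less_imp_le Suc_leI by blast+
qed (rule circle_derivs_has_vector_derivative[OF F])

section \<open>Decay of the oscillatory integrals\<close>

lemma C_k_continuous_on:
  assumes "F \<in> C_k k" "j \<le> k"
  shows "continuous_on punctured_circle (circle_derivs j F)"
  using assms unfolding C_k_def by blast

text \<open>Each integration by parts either raises \<open>j\<close> or costs a factor \<open>1 / \<epsilon>\<close>; on \<open>\<epsilon> \<le> |\<theta>| \<le> 2 \<epsilon>\<close> both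
  change the bound by the same power of \<open>\<epsilon>\<close>.\<close>

lemma osc_integral_bound_compact:
  fixes F :: "complex \<Rightarrow> 'a::complex_banach"
  assumes F: "F \<in> C_k k" and C: "C > 0" and m: "antimono_on {0<..pi} m" "\<And>t. t \<in> {0<..pi} \<Longrightarrow> 1 \<le> m t"
    and bnd: "\<And>\<theta> j. 0 < \<bar>\<theta>\<bar> \<Longrightarrow> \<bar>\<theta>\<bar> \<le> pi \<Longrightarrow> j \<le> k \<Longrightarrow>
      norm (circle_derivs j F (cis \<theta>)) \<le> C * \<bar>\<theta>\<bar> ^ (k - j) * m \<bar>\<theta>\<bar> ^ (k + 1)"
  shows "j + q \<le> k \<Longrightarrow> cutoff q 0 h \<Longrightarrow> \<exists>K\<ge>0. \<forall>\<epsilon> n. 0 < \<epsilon> \<longrightarrow> \<epsilon> \<le> 1 / 2 \<longrightarrow>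
    norm (osc_integral (circle_derivs j F) n h \<epsilon>) * real (Suc n) ^ q \<le> K * \<epsilon> ^ (k - j + 1 - q) * m \<epsilon> ^ (k + 1)"
proof (induction q arbitrary: j h)
  case 0
  obtain B where B: "B > 0" "\<And>t. \<bar>h t\<bar> \<le> B"
    using 0(2) by (rule cutoff_bounded) (rule that)
  show ?case
  proof (intro exI conjI allI impI)
    show "0 \<le> 4 * B * C * 2 ^ (k - j)"
      using B C by simp
    fix \<epsilon> :: real and n
    assume e: "0 < \<epsilon>" "\<epsilon> \<le> 1 / 2"
    then have pi: "2 * \<epsilon> \<le> pi" "\<epsilon> \<in> {0<..pi}"
      using pi_gt3 by auto
    have m1: "1 \<le> m \<epsilon>"
      using m(2) pi by blast
    have D: "norm (circle_derivs j F (cis \<theta>)) \<le> C * (2 * \<epsilon>) ^ (k - j) * m \<epsilon> ^ (k + 1)"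
      if "\<epsilon> \<le> \<bar>\<theta>\<bar>" "\<bar>\<theta>\<bar> \<le> 2 * \<epsilon>" for \<theta>
    proof -
      have t: "0 < \<bar>\<theta>\<bar>" "\<bar>\<theta>\<bar> \<le> pi"
        using that e pi by linarith+
      have "1 \<le> m \<bar>\<theta>\<bar>" "m \<bar>\<theta>\<bar> \<le> m \<epsilon>"
        using m(2)[of "\<bar>\<theta>\<bar>"] monotone_onD[OF m(1), of \<epsilon> "\<bar>\<theta>\<bar>"] t that pi by auto
      then have "C * \<bar>\<theta>\<bar> ^ (k - j) * m \<bar>\<theta>\<bar> ^ (k + 1) \<le> C * (2 * \<epsilon>) ^ (k - j) * m \<epsilon> ^ (k + 1)"
        using C that e by (intro mult_mono power_mono) auto
      then show ?thesis
        using bnd[OF t, of j] 0(1) by linarith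
    qed
    have "norm (osc_integral (circle_derivs j F) n h \<epsilon>) \<le> 2 * (2 * \<epsilon>) * (B * (C * (2 * \<epsilon>) ^ (k - j) * m \<epsilon> ^ (k + 1)))"
      using e pi m1 C 0 B D
      by (intro norm_osc_integral_le[OF C_k_continuous_on[OF F] 0(2)]) auto
    also have "\<dots> = 4 * B * C * 2 ^ (k - j) * \<epsilon> ^ (k - j + 1 - 0) * m \<epsilon> ^ (k + 1)"
      by (simp add: power_mult_distrib)
    finally show "norm (osc_integral (circle_derivs j F) n h \<epsilon>) * real (Suc n) ^ 0
        \<le> 4 * B * C * 2 ^ (k - j) * \<epsilon> ^ (k - j + 1 - 0) * m \<epsilon> ^ (k + 1)"
      by simp
  qed
next
  case (Suc q)
  obtain h' where h': "\<And>t. (h has_real_derivative h' t) (at t)" "cutoff q 0 h'"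
    using Suc.prems(2) by (rule cutoff_derivative) (rule that)
  have hq: "cutoff q 0 h"
    using Suc.prems(2) by (rule cutoff_antimono) simp
  obtain K1 where K1: "K1 \<ge> 0" "\<And>\<epsilon> n. 0 < \<epsilon> \<Longrightarrow> \<epsilon> \<le> 1 / 2 \<Longrightarrow>
      norm (osc_integral (circle_derivs (Suc j) F) n h \<epsilon>) * real (Suc n) ^ q \<le> K1 * \<epsilon> ^ (k - Suc j + 1 - q) * m \<epsilon> ^ (k + 1)"
    using Suc.IH[of "Suc j" h] Suc.prems hq by auto
  obtain K2 where K2: "K2 \<ge> 0" "\<And>\<epsilon> n. 0 < \<epsilon> \<Longrightarrow> \<epsilon> \<le> 1 / 2 \<Longrightarrow>
      norm (osc_integral (circle_derivs j F) n h' \<epsilon>) * real (Suc n) ^ q \<le> K2 * \<epsilon> ^ (k - j + 1 - q) * m \<epsilon> ^ (k + 1)"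
    using Suc.IH[of j h'] Suc.prems h' by auto
  show ?case
  proof (intro exI conjI allI impI)
    show "0 \<le> K1 + K2"
      using K1 K2 by simp
    fix \<epsilon> :: real and n
    assume e: "0 < \<epsilon>" "\<epsilon> \<le> 1 / 2"
    then have pi: "2 * \<epsilon> < pi"
      using pi_gt3 by linarith
    let ?a = "norm (osc_integral (circle_derivs j F) n h \<epsilon>)"
      and ?b = "norm (osc_integral (circle_derivs (Suc j) F) (Suc n) h \<epsilon>)"
      and ?c = "norm (osc_integral (circle_derivs j F) n h' \<epsilon>)"
    \<comment> \<open>No subtraction is truncated, because \<open>j + Suc q \<le> k\<close>. The
      second equation supplies the \<epsilon> that cancels the 1/\<epsilon> from differentiating the
      cutoff.\<close>
    have exps: "k - Suc j + 1 - q = k - j + 1 - Suc q" "k - j + 1 - q = Suc (k - j + 1 - Suc q)"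
      using Suc.prems(1) by auto
    have "?a * real (Suc n) ^ Suc q = (real (Suc n) * ?a) * real (Suc n) ^ q"
      by simp
    also have "\<dots> \<le> (?b + ?c / \<epsilon>) * real (Suc n) ^ q"
      using Suc.prems(1) by (intro mult_right_mono
          osc_integral_circle_derivs_by_parts[OF F _ Suc.prems(2) h'(2,1) e(1) pi]) auto
    also have "\<dots> = ?b * real (Suc n) ^ q + ?c * real (Suc n) ^ q / \<epsilon>"
      by (simp add: distrib_right)
    \<comment> \<open>The induction hypothesis for the raised frequency \<open>Suc n\<close> carries
      the factor \<open>Suc (Suc n)\<close>.\<close>
    also have "\<dots> \<le> ?b * real (Suc (Suc n)) ^ q + ?c * real (Suc n) ^ q / \<epsilon>"
      by (intro add_right_mono mult_left_mono power_mono) auto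
    also have "\<dots> \<le> K1 * \<epsilon> ^ (k - Suc j + 1 - q) * m \<epsilon> ^ (k + 1) + K2 * \<epsilon> ^ (k - j + 1 - q) * m \<epsilon> ^ (k + 1) / \<epsilon>"
      using e by (intro add_mono divide_right_mono K1 K2) auto
    also have "\<dots> = (K1 + K2) * \<epsilon> ^ (k - j + 1 - Suc q) * m \<epsilon> ^ (k + 1)"
      using e unfolding exps by (simp add: distrib_right)
    finally show "?a * real (Suc n) ^ Suc q \<le> (K1 + K2) * \<epsilon> ^ (k - j + 1 - Suc q) * m \<epsilon> ^ (k + 1)" .
  qed
qed

text \<open>Each step moves one derivative onto F and leaves a term with h', to which the compactly
  supported case applies. In that term j + p + 1 = k, so its bound contains \<epsilon>^2: one power
  pays for the factor 1/\<epsilon>, and the other is at most one. At j = k the power of |\<theta>|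
  in the hypothesis is gone, and m^(k+1) is estimated at \<epsilon>.\<close>

lemma osc_integral_bound:
  fixes F :: "complex \<Rightarrow> 'a::complex_banach"
  assumes F: "F \<in> C_k k" and C: "C > 0" and m: "antimono_on {0<..pi} m" "\<And>t. t \<in> {0<..pi} \<Longrightarrow> 1 \<le> m t"
    and bnd: "\<And>\<theta> j. 0 < \<bar>\<theta>\<bar> \<Longrightarrow> \<bar>\<theta>\<bar> \<le> pi \<Longrightarrow> j \<le> k \<Longrightarrow>
      norm (circle_derivs j F (cis \<theta>)) \<le> C * \<bar>\<theta>\<bar> ^ (k - j) * m \<bar>\<theta>\<bar> ^ (k + 1)"
  shows "j + p = k \<Longrightarrow> cutoff p c h \<Longrightarrow> \<exists>K\<ge>0. \<forall>\<epsilon> n. 0 < \<epsilon> \<longrightarrow> \<epsilon> \<le> 1 / 2 \<longrightarrow>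
    norm (osc_integral (circle_derivs j F) n h \<epsilon>) * real (Suc n) ^ p \<le> K * m \<epsilon> ^ (k + 1)"
proof (induction p arbitrary: j)
  case 0
  obtain B where B: "B > 0" "\<And>t. \<bar>h t\<bar> \<le> B"
    using 0(2) by (rule cutoff_bounded) (rule that)
  show ?case
  proof (intro exI conjI allI impI)
    show "0 \<le> 2 * pi * B * C"
      using B C by simp
    fix \<epsilon> :: real and n
    assume e: "0 < \<epsilon>" "\<epsilon> \<le> 1 / 2"
    then have pi: "\<epsilon> \<in> {0<..pi}"
      using pi_gt3 by auto
    have m1: "1 \<le> m \<epsilon>"
      using m(2) pi by blast
    have D: "norm (circle_derivs j F (cis \<theta>)) \<le> C * m \<epsilon> ^ (k + 1)" if "\<epsilon> \<le> \<bar>\<theta>\<bar>" "\<bar>\<theta>\<bar> \<le> pi" for \<theta>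
    proof -
      have t: "0 < \<bar>\<theta>\<bar>"
        using that e by linarith
      have "1 \<le> m \<bar>\<theta>\<bar>" "m \<bar>\<theta>\<bar> \<le> m \<epsilon>"
        using m(2)[of "\<bar>\<theta>\<bar>"] monotone_onD[OF m(1), of \<epsilon> "\<bar>\<theta>\<bar>"] t that pi by auto
      then have "C * m \<bar>\<theta>\<bar> ^ (k + 1) \<le> C * m \<epsilon> ^ (k + 1)"
        using C by (intro mult_left_mono power_mono) auto
      then show ?thesis
        using bnd[OF t that(2), of j] 0(1) by simp
    qed
    have "norm (osc_integral (circle_derivs j F) n h \<epsilon>) \<le> 2 * pi * (B * (C * m \<epsilon> ^ (k + 1)))"
      using e pi m1 C 0 B D
      by (intro norm_osc_integral_le[OF C_k_continuous_on[OF F] 0(2)]) auto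
    then show "norm (osc_integral (circle_derivs j F) n h \<epsilon>) * real (Suc n) ^ 0 \<le> 2 * pi * B * C * m \<epsilon> ^ (k + 1)"
      by simp
  qed
next
  case (Suc p)
  obtain h' where h': "\<And>t. (h has_real_derivative h' t) (at t)" "cutoff p 0 h'"
    using Suc.prems(2) by (rule cutoff_derivative) (rule that)
  have hp: "cutoff p c h"
    using Suc.prems(2) by (rule cutoff_antimono) simp
  obtain K1 where K1: "K1 \<ge> 0" "\<And>\<epsilon> n. 0 < \<epsilon> \<Longrightarrow> \<epsilon> \<le> 1 / 2 \<Longrightarrow>
      norm (osc_integral (circle_derivs (Suc j) F) n h \<epsilon>) * real (Suc n) ^ p \<le> K1 * m \<epsilon> ^ (k + 1)"
    using Suc.IH[of "Suc j"] Suc.prems hp by auto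
  have "j + p \<le> k"
    using Suc.prems by simp
  from osc_integral_bound_compact[OF F C m bnd this h'(2)]
  obtain K2 where K2: "K2 \<ge> 0" "\<And>\<epsilon> n. 0 < \<epsilon> \<Longrightarrow> \<epsilon> \<le> 1 / 2 \<Longrightarrow>
      norm (osc_integral (circle_derivs j F) n h' \<epsilon>) * real (Suc n) ^ p \<le> K2 * \<epsilon> ^ (k - j + 1 - p) * m \<epsilon> ^ (k + 1)"
    by auto
  show ?case
  proof (intro exI conjI allI impI)
    show "0 \<le> K1 + K2"
      using K1 K2 by simp
    fix \<epsilon> :: real and n
    assume e: "0 < \<epsilon>" "\<epsilon> \<le> 1 / 2"
    then have pi: "2 * \<epsilon> < pi" "\<epsilon> \<in> {0<..pi}"
      using pi_gt3 by auto
    have m1: "1 \<le> m \<epsilon>"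
      using m(2) pi by blast
    let ?a = "norm (osc_integral (circle_derivs j F) n h \<epsilon>)"
      and ?b = "norm (osc_integral (circle_derivs (Suc j) F) (Suc n) h \<epsilon>)"
      and ?c = "norm (osc_integral (circle_derivs j F) n h' \<epsilon>)"
    have exps: "k - j + 1 - p = Suc (Suc 0)"
      using Suc.prems(1) by auto
    have "?a * real (Suc n) ^ Suc p = (real (Suc n) * ?a) * real (Suc n) ^ p"
      by simp
    also have "\<dots> \<le> (?b + ?c / \<epsilon>) * real (Suc n) ^ p"
      using Suc.prems(1) by (intro mult_right_mono
          osc_integral_circle_derivs_by_parts[OF F _ Suc.prems(2) h'(2,1) e(1) pi(1)]) auto
    also have "\<dots> = ?b * real (Suc n) ^ p + ?c * real (Suc n) ^ p / \<epsilon>"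
      by (simp add: distrib_right)
    also have "\<dots> \<le> ?b * real (Suc (Suc n)) ^ p + ?c * real (Suc n) ^ p / \<epsilon>"
      by (intro add_right_mono mult_left_mono power_mono) auto
    also have "\<dots> \<le> K1 * m \<epsilon> ^ (k + 1) + K2 * \<epsilon> ^ (k - j + 1 - p) * m \<epsilon> ^ (k + 1) / \<epsilon>"
      using e by (intro add_mono divide_right_mono K1 K2) auto
    also have "K2 * \<epsilon> ^ (k - j + 1 - p) * m \<epsilon> ^ (k + 1) / \<epsilon> = (K2 * m \<epsilon> ^ (k + 1)) * \<epsilon>"
      using e unfolding exps by simp
    also have "\<dots> \<le> K2 * m \<epsilon> ^ (k + 1)"
      using K2(1) m1 e by (intro mult_left_le) auto
    finally show "?a * real (Suc n) ^ Suc p \<le> (K1 + K2) * m \<epsilon> ^ (k + 1)"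
      by (simp add: distrib_right)
  qed
qed

section \<open>Bounds for factorials times powers\<close>

lemma fact_Suc_le: "fact (Suc q) \<le> exp 1 * real (Suc q) * (real (Suc q) / exp 1) ^ Suc q"
proof (induction q)
  case (Suc q)
  define r where "r = Suc q"
  have r: "real r > 0"
    by (simp add: r_def)
  \<comment> \<open>This inequality, in the form r^(r+1) \<le> (r+1)^(r+1) / e, is the whole
    induction step of this upper half of Stirling's formula.\<close>
  have "(1 - 1 / real (Suc r)) ^ Suc r \<le> exp (- 1)"
    by (rule exp_ge_one_minus_x_over_n_power_n) auto
  moreover have "1 - 1 / real (Suc r) = real r / real (Suc r)"
    by (simp add: field_simps)
  ultimately have key: "real r ^ Suc r \<le> exp (- 1) * real (Suc r) ^ Suc r"
    by (simp add: power_divide pos_divide_le_eq del: power_Suc)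
  have "fact (Suc r) = real (Suc r) * fact r"
    by simp
  also have "\<dots> \<le> real (Suc r) * (exp 1 * real r * (real r / exp 1) ^ r)"
    using Suc unfolding r_def by (intro mult_left_mono) auto
  also have "\<dots> = exp 1 * real (Suc r) * (real r ^ Suc r / exp 1 ^ r)"
    by (simp add: power_divide)
  also have "\<dots> \<le> exp 1 * real (Suc r) * ((exp (- 1) * real (Suc r) ^ Suc r) / exp 1 ^ r)"
    using key by (intro mult_left_mono divide_right_mono) auto
  also have "(exp (- 1) * real (Suc r) ^ Suc r) / exp 1 ^ r = (real (Suc r) / exp 1) ^ Suc r"
    by (simp add: power_divide exp_minus inverse_eq_divide)
  finally show ?case
    unfolding r_def .
qed simp

text \<open>Stirling's q^q is absorbed by (q w)^q \<le> 1, leaving exp(-q); the summand 1 takes care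
  of q = 0.\<close>

lemma fact_mult_power_le:
  fixes w :: real
  assumes "0 \<le> w" "real q * w \<le> 1"
  shows "fact q * w ^ q \<le> exp 1 * (real q + 1) * exp (- real q)"
proof (cases q)
  case (Suc p)
  have "fact q * w ^ q \<le> exp 1 * real q * (real q / exp 1) ^ q * w ^ q"
    using fact_Suc_le[of p] assms(1) unfolding Suc by (intro mult_right_mono) auto
  also have "\<dots> = exp 1 * real q * exp (- real q) * (real q * w) ^ q"
    by (simp add: power_divide power_mult_distrib exp_minus inverse_eq_divide flip: exp_of_nat_mult)
  also have "\<dots> \<le> exp 1 * real q * exp (- real q) * 1"
    using assms by (intro mult_left_mono power_le_one) auto
  also have "\<dots> \<le> exp 1 * (real q + 1) * exp (- real q)"
    by (simp add: mult_left_mono)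
  finally show ?thesis .
qed simp

text \<open>Meant for the terms left behind by the integrations by parts. They already carry the
  factors \<epsilon> and w, and there are q of them with q w \<le> 1, so no exponential gain is
  required of them.\<close>

lemma fact_mult_power_le_1:
  fixes w :: real
  assumes "0 \<le> w" "real j * w \<le> 1"
  shows "fact j * w ^ j \<le> 1"
proof -
  have "(fact j :: real) \<le> real j ^ j"
    using fact_le_power[of j, where 'a = real] by simp
  then have "fact j * w ^ j \<le> real j ^ j * w ^ j"
    using assms(1) by (intro mult_right_mono) auto
  also have "\<dots> = (real j * w) ^ j"
    by (simp add: power_mult_distrib)
  also have "\<dots> \<le> 1"
    using assms by (intro power_le_one) auto
  finally show ?thesis .
qed

section \<open>Decay rates\<close>

text \<open>The terms with h' are collected and not integrated further. A cutoff that is constant on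
  an interval but not everywhere is not analytic, so its higher derivatives admit no bound of the
  form A^(j+1) j!, and differentiating it repeatedly would spoil the factorial estimate. The growing
  frequencies \<open>n + j\<close> are bounded below by n.\<close>

lemma osc_integral_unroll:
  fixes F :: "complex \<Rightarrow> 'a::complex_banach"
  assumes F: "F \<in> C_infinity"
    and h: "cutoff (Suc 0) c h" "cutoff 0 0 h'" "\<And>t. (h has_real_derivative h' t) (at t)"
    and e: "0 < \<epsilon>" "2 * \<epsilon> < pi" and n: "n > 0"
    and b: "\<And>j. norm (osc_integral (circle_derivs j F) (n + j) h' \<epsilon>) / \<epsilon> \<le> b j"
  shows "norm (osc_integral F n h \<epsilon>)
    \<le> (\<Sum>j<q. b j / real n ^ Suc j) + norm (osc_integral (circle_derivs q F) (n + q) h \<epsilon>) / real n ^ q"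
proof (induction q)
  case (Suc q)
  let ?a = "\<lambda>q. norm (osc_integral (circle_derivs q F) (n + q) h \<epsilon>)"
  have "F \<in> C_k (Suc q)"
    using F unfolding C_infinity_def by auto
  from osc_integral_circle_derivs_by_parts[OF this _ h e, of q "n + q"]
  have "real (Suc (n + q)) * ?a q \<le> ?a (Suc q) + b q"
    using b[of q] by simp
  moreover have "real n * ?a q \<le> real (Suc (n + q)) * ?a q"
    by (intro mult_right_mono) auto
  ultimately have "real n * ?a q \<le> ?a (Suc q) + b q"
    by linarith
  then have "?a q \<le> (?a (Suc q) + b q) / real n"
    using n by (simp add: pos_le_divide_eq mult.commute)
  then have "?a q / real n ^ q \<le> (?a (Suc q) + b q) / real n / real n ^ q"
    by (intro divide_right_mono) auto
  also have "\<dots> = b q / real n ^ Suc q + ?a (Suc q) / real n ^ Suc q"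
    by (simp add: add_divide_distrib)
  finally show ?case
    using Suc by simp
qed simp

text \<open>The factor |\<theta>| in the hypothesis, at most 2 \<epsilon> on the support of h',
  compensates the 1/\<epsilon> from differentiating the cutoff, and the length of the support leaves
  a further \<epsilon>. Hence the collected terms sum to O(\<epsilon>), and only the final term
  needs the smallness of q! (m/n)^q.\<close>

lemma osc_integral_bound_factorial:
  fixes F :: "complex \<Rightarrow> 'a::complex_banach"
  assumes F: "F \<in> C_infinity" and C: "C > 0" and m: "antimono_on {0<..pi} m" "\<And>t. t \<in> {0<..pi} \<Longrightarrow> 1 \<le> m t"
    and bnd: "\<And>\<theta> j. 0 < \<bar>\<theta>\<bar> \<Longrightarrow> \<bar>\<theta>\<bar> \<le> pi \<Longrightarrow>
      norm (circle_derivs j F (cis \<theta>)) \<le> C * fact j * \<bar>\<theta>\<bar> * m \<bar>\<theta>\<bar> ^ (j + 1)"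
    and h: "cutoff (Suc 0) 1 h"
  obtains K where "K > 0" "\<And>\<epsilon> n q. 0 < \<epsilon> \<Longrightarrow> \<epsilon> \<le> 1 / 2 \<Longrightarrow> n > 0 \<Longrightarrow> real q * (m \<epsilon> / real n) \<le> 1 \<Longrightarrow>
    norm (osc_integral F n h \<epsilon>) \<le> K * (\<epsilon> + m \<epsilon> * (fact q * (m \<epsilon> / real n) ^ q))"
proof -
  obtain h' where h': "\<And>t. (h has_real_derivative h' t) (at t)" "cutoff 0 0 h'"
    using h by (rule cutoff_derivative) (rule that)
  obtain B where B: "B > 0" "\<And>t. \<bar>h t\<bar> \<le> B"
    using h by (rule cutoff_bounded) (rule that)
  obtain B1 where B1: "B1 > 0" "\<And>t. \<bar>h' t\<bar> \<le> B1"
    using h'(2) by (rule cutoff_bounded) (rule that)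
  \<comment> \<open>8 = 4 * 2 from a support of length 4 \<epsilon> on which |\<theta>| \<le> 2
    \<epsilon>; the second summand bounds the final term over the full period, where |\<theta>|
    \<le> \<pi>.\<close>
  define K where "K = 8 * B1 * C + 2 * pi * B * C * pi"
  have K: "K > 0" "8 * B1 * C \<le> K" "2 * pi * B * C * pi \<le> K"
    unfolding K_def using B(1) B1(1) C by (auto intro!: add_pos_pos)
  have "norm (osc_integral F n h \<epsilon>) \<le> K * (\<epsilon> + m \<epsilon> * (fact q * (m \<epsilon> / real n) ^ q))"
    if e: "0 < \<epsilon>" "\<epsilon> \<le> 1 / 2" and n: "n > 0" and q: "real q * (m \<epsilon> / real n) \<le> 1" for \<epsilon> n q
  proof -
    have pi: "2 * \<epsilon> < pi" "\<epsilon> \<in> {0<..pi}"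
      using e pi_gt3 by auto
    have m1: "1 \<le> m \<epsilon>"
      using m(2) pi by blast
    define w where "w = m \<epsilon> / real n"
    have w: "0 \<le> w" "real q * w \<le> 1"
      using m1 q by (auto simp: w_def)
    have cont: "continuous_on punctured_circle (circle_derivs j F)" for j
      by (rule C_k_continuous_on[of _ "Suc j"]) (use F in \<open>auto simp: C_infinity_def\<close>)
    have D: "norm (circle_derivs j F (cis \<theta>)) \<le> C * fact j * d * m \<epsilon> ^ (j + 1)"
      if "\<epsilon> \<le> \<bar>\<theta>\<bar>" "\<bar>\<theta>\<bar> \<le> d" "d \<le> pi" for \<theta> j d
    proof -
      have t: "0 < \<bar>\<theta>\<bar>" "\<bar>\<theta>\<bar> \<le> pi"
        using that e by linarith+
      have "1 \<le> m \<bar>\<theta>\<bar>" "m \<bar>\<theta>\<bar> \<le> m \<epsilon>"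
        using m(2)[of "\<bar>\<theta>\<bar>"] monotone_onD[OF m(1), of \<epsilon> "\<bar>\<theta>\<bar>"] t that pi by auto
      then have "C * fact j * \<bar>\<theta>\<bar> * m \<bar>\<theta>\<bar> ^ (j + 1) \<le> C * fact j * d * m \<epsilon> ^ (j + 1)"
        using C that e by (intro mult_mono power_mono) auto
      then show ?thesis
        using bnd[OF t, of j] by linarith
    qed
    let ?b = "\<lambda>j. 8 * B1 * C * \<epsilon> * (fact j * m \<epsilon> ^ (j + 1))"
    have b: "norm (osc_integral (circle_derivs j F) (n + j) h' \<epsilon>) / \<epsilon> \<le> ?b j" for j
    proof -
      have "norm (osc_integral (circle_derivs j F) (n + j) h' \<epsilon>)
          \<le> 2 * (2 * \<epsilon>) * (B1 * (C * fact j * (2 * \<epsilon>) * m \<epsilon> ^ (j + 1)))"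
        using e pi m1 C B1 D
        by (intro norm_osc_integral_le[OF cont h'(2)]) auto
      also have "\<dots> = ?b j * \<epsilon>"
        by simp
      finally show ?thesis
        using e by (simp add: pos_divide_le_eq del: power_Suc)
    qed
    have "(\<Sum>j<q. ?b j / real n ^ Suc j) \<le> 8 * B1 * C * \<epsilon>"
    proof -
      have "(\<Sum>j<q. ?b j / real n ^ Suc j) = (\<Sum>j<q. 8 * B1 * C * \<epsilon> * (w * (fact j * w ^ j)))"
        by (intro sum.cong) (simp_all add: w_def power_divide)
      also have "\<dots> \<le> (\<Sum>j<q. 8 * B1 * C * \<epsilon> * (w * 1))"
      proof (intro sum_mono mult_left_mono fact_mult_power_le_1 w)
        fix j
        assume "j \<in> {..<q}"
        then have "real j * w \<le> real q * w"
          using w by (intro mult_right_mono) auto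
        then show "real j * w \<le> 1"
          using w by simp
      qed (use B1 C e in auto)
      also have "\<dots> = 8 * B1 * C * \<epsilon> * (real q * w)"
        by simp
      also have "\<dots> \<le> 8 * B1 * C * \<epsilon> * 1"
        using w B1 C e by (intro mult_left_mono) auto
      finally show ?thesis
        by simp
    qed
    moreover have "norm (osc_integral (circle_derivs q F) (n + q) h \<epsilon>) / real n ^ q
        \<le> 2 * pi * B * C * pi * (m \<epsilon> * (fact q * w ^ q))"
    proof -
      have "norm (osc_integral (circle_derivs q F) (n + q) h \<epsilon>)
          \<le> 2 * pi * (B * (C * fact q * pi * m \<epsilon> ^ (q + 1)))"
        using e pi m1 C B D
        by (intro norm_osc_integral_le[OF cont h]) auto
      then have "norm (osc_integral (circle_derivs q F) (n + q) h \<epsilon>) / real n ^ q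
          \<le> 2 * pi * (B * (C * fact q * pi * m \<epsilon> ^ (q + 1))) / real n ^ q"
        by (intro divide_right_mono) auto
      also have "\<dots> = 2 * pi * B * C * pi * (m \<epsilon> * (fact q * w ^ q))"
        by (simp add: w_def power_divide)
      finally show ?thesis .
    qed
    ultimately have "norm (osc_integral F n h \<epsilon>)
        \<le> 8 * B1 * C * \<epsilon> + 2 * pi * B * C * pi * (m \<epsilon> * (fact q * w ^ q))"
      using osc_integral_unroll[OF F h h'(2,1) e(1) pi(1) n b, of q] by linarith
    also have "\<dots> \<le> K * \<epsilon> + K * (m \<epsilon> * (fact q * w ^ q))"
      using K e m1 w by (intro add_mono mult_right_mono) auto
    finally show ?thesis
      by (simp add: w_def distrib_left)
  qed
  then show thesis
    using K(1) by (intro that[of K]) auto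
qed

text \<open>By Stirling, \<open>q! (m / n)\<^sup>q\<close> is about \<open>e\<^sup>-\<^sup>n\<^sup>/\<^sup>m\<close> for \<open>q \<approx> n / m\<close>; the room left by \<open>c < 1\<close> absorbs the
  polynomial factor.\<close>

lemma mult_fact_floor_le:
  fixes m \<epsilon> c n :: real
  assumes e: "\<epsilon> > 0" and m: "m \<ge> 1" and c: "0 < c" "c < 1" and n: "m * ln (1 + m / \<epsilon>) = c * n" "n > 0"
    and q: "q = nat \<lfloor>n / m\<rfloor>"
  shows "real q * (m / n) \<le> 1" "m * (fact q * (m / n) ^ q) \<le> exp 2 / (1 - c) * \<epsilon>"
proof -
  have nm: "n / m > 0"
    using n(2) m by simp
  then have "real q = of_int \<lfloor>n / m\<rfloor>"
    unfolding q by simp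
  then have q: "real q \<le> n / m" "n / m - 1 \<le> real q"
    by linarith+
  then show qw: "real q * (m / n) \<le> 1"
    using n(2) m by (simp add: field_simps)
  define L where "L = ln (1 + m / \<epsilon>)"
  have pos: "1 + m / \<epsilon> > 0"
    using e m by (intro add_pos_nonneg) auto
  have L: "L \<ge> 0" "exp L = 1 + m / \<epsilon>"
    unfolding L_def using e m pos by auto
  have nL: "n / m = L / c"
    using n(1) c m unfolding L_def by (simp add: field_simps)
  \<comment> \<open>The room left by c < 1: the amount by which n/m = L/c exceeds L. It turns the
    polynomial factor 1 + L/c into exp y / (1 - c).\<close>
  define y where "y = L / c - L"
  have y: "y \<ge> 0" "(1 - c) * (L / c) = y"
    unfolding y_def using L c mult_left_le[OF less_imp_le[OF c(2)] L(1)] by (auto simp: field_simps)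
  have "(1 - c) * (1 + L / c) \<le> 1 + y"
    using y c by (simp add: distrib_left)
  also have "\<dots> \<le> exp y"
    by (rule exp_ge_add_one_self)
  finally have key: "1 + L / c \<le> exp y / (1 - c)"
    using c by (simp add: pos_le_divide_eq mult.commute)
  have "fact q * (m / n) ^ q \<le> exp 1 * (real q + 1) * exp (- real q)"
    using n(2) m by (intro fact_mult_power_le qw) auto
  \<comment> \<open>Rounding n/m = L/c down loses at most one, hence the exponent 1 - L/c.\<close>
  also have "\<dots> \<le> exp 1 * (1 + L / c) * exp (1 - L / c)"
    using q unfolding nL by (intro mult_mono) auto
  also have "\<dots> \<le> exp 1 * (exp y / (1 - c)) * exp (1 - L / c)"
    using key by (intro mult_right_mono mult_left_mono) auto
  also have "\<dots> = exp (1 + y + (1 - L / c)) / (1 - c)"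
    by (simp only: exp_add times_divide_eq_left times_divide_eq_right)
  also have "1 + y + (1 - L / c) = 2 - L"
    by (simp add: y_def)
  \<comment> \<open>Here exp(-L) becomes 1 / (1 + m/\<epsilon>), and m times this is at most
    \<epsilon>.\<close>
  also have "exp (2 - L) / (1 - c) = exp 2 / (1 - c) / (1 + m / \<epsilon>)"
    by (simp add: exp_diff L(2))
  finally have "m * (fact q * (m / n) ^ q) \<le> m * (exp 2 / (1 - c) / (1 + m / \<epsilon>))"
    using m by (intro mult_left_mono) auto
  also have "\<dots> = exp 2 / (1 - c) * (m / (1 + m / \<epsilon>))"
    by simp
  also have "\<dots> \<le> exp 2 / (1 - c) * \<epsilon>"
    using c e m pos by (intro mult_left_mono) (auto simp: field_simps)
  finally show "m * (fact q * (m / n) ^ q) \<le> exp 2 / (1 - c) * \<epsilon>" .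
qed

section \<open>The rate functions and their inverses\<close>

lemma eventually_rate_inv:
  assumes cont: "continuous_on {0<..pi} g"
    and dec: "\<And>s t. 0 < s \<Longrightarrow> s < t \<Longrightarrow> t \<le> pi \<Longrightarrow> g t < g s"
    and unb: "\<And>y. \<exists>\<delta>\<in>{0<..pi}. y \<le> g \<delta>" and c: "c > 0" and e: "\<epsilon>0 > 0"
  shows "\<forall>\<^sub>F n in sequentially. 0 < rate_inv g (c * real n) \<and> rate_inv g (c * real n) \<le> pi \<and>
    rate_inv g (c * real n) \<le> \<epsilon>0 \<and> g (rate_inv g (c * real n)) = c * real n"
proof -
  define d where "d = min \<epsilon>0 pi"
  have d: "0 < d" "d \<le> pi" "d \<le> \<epsilon>0"
    using e by (auto simp: d_def)
  have "\<forall>\<^sub>F n in sequentially. g d / c \<le> real n"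
    using filterlim_real_sequentially by (simp add: filterlim_at_top)
  then show ?thesis
  proof eventually_elim
    case (elim n)
    then have gd: "g d \<le> c * real n"
      using c by (simp add: pos_divide_le_eq mult.commute)
    \<comment> \<open>\<open>rate_inv\<close> has a meaning only on the range of g, so a preimage of
      c n has to be exhibited. The intermediate value theorem between \<delta> and d finds one that
      is also at most \<epsilon>0.\<close>
    obtain \<delta> where \<delta>: "\<delta> \<in> {0<..pi}" "c * real n \<le> g \<delta>"
      using unb by blast
    obtain s where s: "0 < s" "s \<le> d" "g s = c * real n"
    proof (cases "\<delta> \<le> d")
      case True
      have "continuous_on {\<delta>..d} g"
        using \<delta> d by (intro continuous_on_subset[OF cont]) auto
      then obtain s where "\<delta> \<le> s" "s \<le> d" "g s = c * real n"
        using IVT2'[of g d "c * real n" \<delta>] gd \<delta> True by auto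
      then show thesis
        using that[of s] \<delta> by auto
    next
      case False
      then have "g \<delta> < g d"
        using d \<delta> by (intro dec) auto
      then show thesis
        using gd \<delta> by simp
    qed
    have "inj_on g {0<..pi}"
    proof (rule inj_onI)
      fix s t
      assume "s \<in> {0<..pi}" "t \<in> {0<..pi}" "g s = g t"
      then show "s = t"
        using dec[of s t] dec[of t s] by (cases s t rule: linorder_cases) auto
    qed
    then have "rate_inv g (c * real n) = s"
      unfolding rate_inv_def by (rule the_inv_into_f_eq) (use s d in auto)
    then show ?case
      using s d by simp
  qed
qed

text \<open>m may be constant on intervals; the strictness of both rate functions comes from the
  factor 1/t and m \<ge> 1.\<close>

lemma ratio_strict_antimono:
  assumes m: "antimono_on {0<..pi} m" "\<And>t. t \<in> {0<..pi} \<Longrightarrow> (1::real) \<le> m t"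
    and st: "0 < s" "s < t" "t \<le> pi"
  shows "m t \<le> m s" "m t / t < m s / s"
proof -
  show le: "m t \<le> m s"
    using monotone_onD[OF m(1), of s t] st by auto
  have "1 \<le> m t"
    using m(2)[of t] st by auto
  then have "m t / t < m t / s"
    using st by (intro divide_strict_left_mono) auto
  also have "\<dots> \<le> m s / s"
    using le st by (intro divide_right_mono) auto
  finally show "m t / t < m s / s" .
qed

lemma m_pow_properties:
  assumes cm: "continuous_on {0<..pi} m" and m: "antimono_on {0<..pi} m" "\<And>t. t \<in> {0<..pi} \<Longrightarrow> 1 \<le> m t"
    and k: "k \<ge> 1"
  shows "continuous_on {0<..pi} (m_pow m k)"
    and "0 < s \<Longrightarrow> s < t \<Longrightarrow> t \<le> pi \<Longrightarrow> m_pow m k t < m_pow m k s"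
    and "\<exists>\<delta>\<in>{0<..pi}. y \<le> m_pow m k \<delta>"
    and "\<epsilon> \<in> {0<..pi} \<Longrightarrow> m_pow m k \<epsilon> ^ k = m \<epsilon> ^ (k + 1) / \<epsilon>"
proof -
  have pos: "m t / t > 0" "m t > 0" if "t \<in> {0<..pi}" for t
    using m(2)[OF that] that by auto
  show "continuous_on {0<..pi} (m_pow m k)"
    unfolding m_pow_def[abs_def] using pos by (intro continuous_intros cm) fastforce+
  show "m_pow m k t < m_pow m k s" if st: "0 < s" "s < t" "t \<le> pi"
  proof -
    note r = ratio_strict_antimono[OF m st]
    have "(m t / t) powr (1 / real k) < (m s / s) powr (1 / real k)"
      using r(2) pos[of t] st k by (intro powr_less_mono2) auto
    then show ?thesis
      unfolding m_pow_def using r(1) pos[of t] st by (intro mult_le_less_imp_less) auto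
  qed
  show "\<exists>\<delta>\<in>{0<..pi}. y \<le> m_pow m k \<delta>"
  proof
    define z where "z = max 1 y"
    have z: "1 \<le> z" "y \<le> z"
      by (auto simp: z_def)
    \<comment> \<open>Since m d \<ge> 1, the k-th root of m d / d is at least z.\<close>
    define d where "d = 1 / z ^ k"
    have zk: "1 \<le> z ^ k"
      using z by (intro one_le_power)
    then have "0 < d" "d \<le> 1"
      by (auto simp: d_def divide_le_eq_1)
    then show d: "d \<in> {0<..pi}"
      using pi_gt3 by auto
    have "z = (z ^ k) powr (1 / real k)"
      using z k by (simp add: powr_powr flip: powr_realpow)
    also have "\<dots> \<le> (m d / d) powr (1 / real k)"
      using m(2)[OF d] zk by (intro powr_mono2) (auto simp: d_def)
    also have "\<dots> \<le> m_pow m k d"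
      unfolding m_pow_def using m(2)[OF d] mult_right_mono[of 1 "m d" "(m d / d) powr (1 / real k)"] by simp
    finally show "y \<le> m_pow m k d"
      using z by simp
  qed
  show "m_pow m k \<epsilon> ^ k = m \<epsilon> ^ (k + 1) / \<epsilon>" if "\<epsilon> \<in> {0<..pi}"
  proof -
    have "((m \<epsilon> / \<epsilon>) powr (1 / real k)) ^ k = ((m \<epsilon> / \<epsilon>) powr (1 / real k)) powr real k"
      using pos[OF that] that by (intro powr_realpow[symmetric]) simp
    also have "\<dots> = m \<epsilon> / \<epsilon>"
      using pos[OF that] that k by (simp add: powr_powr)
    finally have "((m \<epsilon> / \<epsilon>) powr (1 / real k)) ^ k = m \<epsilon> / \<epsilon>" .
    then show ?thesis
      by (simp add: m_pow_def power_mult_distrib)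
  qed
qed

lemma m_log_properties:
  assumes cm: "continuous_on {0<..pi} m" and m: "antimono_on {0<..pi} m" "\<And>t. t \<in> {0<..pi} \<Longrightarrow> 1 \<le> m t"
  shows "continuous_on {0<..pi} (m_log m)"
    and "0 < s \<Longrightarrow> s < t \<Longrightarrow> t \<le> pi \<Longrightarrow> m_log m t < m_log m s"
    and "\<exists>\<delta>\<in>{0<..pi}. y \<le> m_log m \<delta>"
proof -
  have pos: "m t / t > 0" "m t > 0" if "t \<in> {0<..pi}" for t
    using m(2)[OF that] that by auto
  show "continuous_on {0<..pi} (m_log m)"
    unfolding m_log_def[abs_def] using pos by (intro continuous_intros cm) (fastforce simp: add_pos_pos)+
  show "m_log m t < m_log m s" if st: "0 < s" "s < t" "t \<le> pi"
  proof -
    note r = ratio_strict_antimono[OF m st]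
    have "ln (1 + m t / t) < ln (1 + m s / s)"
      using r(2) pos[of t] pos[of s] st by (subst ln_less_cancel_iff) (auto intro: add_pos_pos)
    moreover have "0 < ln (1 + m t / t)"
      using pos[of t] st by (intro ln_gt_zero) auto
    ultimately show ?thesis
      unfolding m_log_def using r(1) pos[of t] st by (intro mult_le_less_imp_less) auto
  qed
  show "\<exists>\<delta>\<in>{0<..pi}. y \<le> m_log m \<delta>"
  proof
    define z where "z = max 0 y"
    have z: "0 \<le> z" "y \<le> z"
      by (auto simp: z_def)
    \<comment> \<open>Since m d \<ge> 1, the logarithm of m d / d is at least z.\<close>
    define d where "d = exp (- z)"
    have "0 < d" "d \<le> 1"
      using z by (auto simp: d_def)
    then show d: "d \<in> {0<..pi}"
      using pi_gt3 by auto
    have "exp z = 1 / d"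
      by (simp add: d_def exp_minus field_simps)
    also have "\<dots> \<le> m d / d"
      using m(2)[OF d] d by (intro divide_right_mono) auto
    finally have ez: "exp z \<le> m d / d" .
    have "z = ln (exp z)"
      by simp
    also have "\<dots> \<le> ln (1 + m d / d)"
      using pos[OF d] ez by (subst ln_le_cancel_iff) (auto intro: add_pos_pos)
    also have "\<dots> \<le> m_log m d"
      unfolding m_log_def using m(2)[OF d] pos[OF d] mult_right_mono[of 1 "m d" "ln (1 + m d / d)"] by simp
    finally show "y \<le> m_log m d"
      using z by simp
  qed
qed

section \<open>Choice of \<epsilon> and proof of the two rates\<close>

lemma decay_rate_pow:
  fixes x :: "nat \<Rightarrow> 'a::complex_banach"
  assumes x: "bounded (range x)" "bounded (range (\<lambda>n. \<Sum>k\<le>n. x k))"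
    "boundary_function (G_transform x) F"
    and cm: "continuous_on {0<..pi} m" and m: "antimono_on {0<..pi} m" "\<And>t. t \<in> {0<..pi} \<Longrightarrow> 1 \<le> m t"
    and k: "k \<ge> 1" and F: "F \<in> C_k k" and C: "C > 0"
    and bnd: "\<And>\<theta> j. 0 < \<bar>\<theta>\<bar> \<Longrightarrow> \<bar>\<theta>\<bar> \<le> pi \<Longrightarrow> j \<le> k \<Longrightarrow>
      norm (circle_derivs j F (cis \<theta>)) \<le> C * \<bar>\<theta>\<bar> ^ (k - j) * m \<bar>\<theta>\<bar> ^ (k + 1)"
    and c: "c > 0"
  shows "(\<lambda>n. norm (x n)) \<in> O(\<lambda>n. rate_inv (m_pow m k) (c * real n))"
proof -
  \<comment> \<open>An order that dominates both 2, for the low-frequency error, and k, for the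
    integrations by parts.\<close>
  obtain h where "cutoff (k + 2) 1 h"
    using cutoff_exists by blast
  then have h: "cutoff 2 1 h" "cutoff k 1 h"
    by (auto intro: cutoff_antimono)
  obtain K1 where K1: "K1 > 0" "\<And>n \<epsilon>. 0 < \<epsilon> \<Longrightarrow> \<epsilon> \<le> 1 / 2 \<Longrightarrow>
      2 * pi * norm (x n) \<le> norm (osc_integral F n h \<epsilon>) + K1 * \<epsilon>"
    using x h(1) by (rule norm_term_le_osc_integral) (rule that)
  have "0 + k = k"
    by simp
  from osc_integral_bound[OF F C m bnd this h(2)]
  obtain K2 where K2: "K2 \<ge> 0" "\<And>\<epsilon> n. 0 < \<epsilon> \<Longrightarrow> \<epsilon> \<le> 1 / 2 \<Longrightarrow>
      norm (osc_integral F n h \<epsilon>) * real (Suc n) ^ k \<le> K2 * m \<epsilon> ^ (k + 1)"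
    by auto
  have "\<forall>\<^sub>F n in sequentially. 0 < rate_inv (m_pow m k) (c * real n) \<and> rate_inv (m_pow m k) (c * real n) \<le> pi \<and>
    rate_inv (m_pow m k) (c * real n) \<le> 1 / 2 \<and> m_pow m k (rate_inv (m_pow m k) (c * real n)) = c * real n"
    by (intro eventually_rate_inv m_pow_properties(1)[OF cm m k] m_pow_properties(2)[OF cm m k]
        m_pow_properties(3)[OF cm m k] c) auto
  then have "\<forall>\<^sub>F n in sequentially. norm (norm (x n)) \<le> (K2 * c ^ k + K1) * norm (rate_inv (m_pow m k) (c * real n))"
  proof eventually_elim
    case (elim n)
    define \<epsilon> where "\<epsilon> = rate_inv (m_pow m k) (c * real n)"
    have e: "0 < \<epsilon>" "\<epsilon> \<le> pi" "\<epsilon> \<le> 1 / 2" "m_pow m k \<epsilon> = c * real n"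
      using elim by (auto simp: \<epsilon>_def)
    \<comment> \<open>The k-th power of m_k(\<epsilon>) = c n: dividing by n^k turns the bound on
      the oscillatory integral into a multiple of \<epsilon>, for any c.\<close>
    have "m \<epsilon> ^ (k + 1) = \<epsilon> * (c * real n) ^ k"
      using m_pow_properties(4)[OF cm m k, of \<epsilon>] e by simp
    also have "\<dots> \<le> \<epsilon> * (c * real (Suc n)) ^ k"
      using e c by (intro mult_left_mono power_mono) auto
    finally have "K2 * m \<epsilon> ^ (k + 1) \<le> K2 * (\<epsilon> * (c * real (Suc n)) ^ k)"
      using K2(1) by (rule mult_left_mono)
    also have "\<dots> = (K2 * c ^ k * \<epsilon>) * real (Suc n) ^ k"
      by (simp add: power_mult_distrib mult_ac del: of_nat_Suc)
    finally have "norm (osc_integral F n h \<epsilon>) * real (Suc n) ^ k \<le> (K2 * c ^ k * \<epsilon>) * real (Suc n) ^ k"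
      by (rule order.trans[OF K2(2)[OF e(1,3)]])
    then have "norm (osc_integral F n h \<epsilon>) \<le> K2 * c ^ k * \<epsilon>"
      by (rule mult_right_le_imp_le) simp
    moreover have "1 * norm (x n) \<le> 2 * pi * norm (x n)"
      using pi_gt3 by (intro mult_right_mono) auto
    ultimately have "norm (x n) \<le> (K2 * c ^ k + K1) * \<epsilon>"
      using K1(2)[OF e(1,3), of n] by (simp add: distrib_right)
    then show ?case
      using e(1) unfolding \<epsilon>_def[symmetric] by simp
  qed
  then show ?thesis
    by (rule bigoI)
qed

lemma decay_rate_log:
  fixes x :: "nat \<Rightarrow> 'a::complex_banach"
  assumes x: "bounded (range x)" "bounded (range (\<lambda>n. \<Sum>k\<le>n. x k))"
    "boundary_function (G_transform x) F"
    and cm: "continuous_on {0<..pi} m" and m: "antimono_on {0<..pi} m" "\<And>t. t \<in> {0<..pi} \<Longrightarrow> 1 \<le> m t"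
    and F: "F \<in> C_infinity" and C: "C > 0"
    and bnd: "\<And>\<theta> j. 0 < \<bar>\<theta>\<bar> \<Longrightarrow> \<bar>\<theta>\<bar> \<le> pi \<Longrightarrow>
      norm (circle_derivs j F (cis \<theta>)) \<le> C * fact j * \<bar>\<theta>\<bar> * m \<bar>\<theta>\<bar> ^ (j + 1)"
    and c: "0 < c" "c < 1"
  shows "(\<lambda>n. norm (x n)) \<in> O(\<lambda>n. rate_inv (m_log m) (c * real n) + 1 / real n)"
proof -
  obtain h where h: "cutoff 2 1 h"
    using cutoff_exists by blast
  then have h1: "cutoff (Suc 0) 1 h"
    by (rule cutoff_antimono) simp
  obtain K1 where K1: "K1 > 0" "\<And>n \<epsilon>. 0 < \<epsilon> \<Longrightarrow> \<epsilon> \<le> 1 / 2 \<Longrightarrow>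
      2 * pi * norm (x n) \<le> norm (osc_integral F n h \<epsilon>) + K1 * \<epsilon>"
    using x h by (rule norm_term_le_osc_integral) (rule that)
  obtain K2 where K2: "K2 > 0" "\<And>\<epsilon> n q. 0 < \<epsilon> \<Longrightarrow> \<epsilon> \<le> 1 / 2 \<Longrightarrow> n > 0 \<Longrightarrow> real q * (m \<epsilon> / real n) \<le> 1 \<Longrightarrow>
      norm (osc_integral F n h \<epsilon>) \<le> K2 * (\<epsilon> + m \<epsilon> * (fact q * (m \<epsilon> / real n) ^ q))"
    by (rule osc_integral_bound_factorial[OF F C m bnd h1], assumption+) (rule that)
  define A where "A = K2 * (1 + exp 2 / (1 - c)) + K1"
  have "\<forall>\<^sub>F n in sequentially. 0 < rate_inv (m_log m) (c * real n) \<and> rate_inv (m_log m) (c * real n) \<le> pi \<and>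
    rate_inv (m_log m) (c * real n) \<le> 1 / 2 \<and> m_log m (rate_inv (m_log m) (c * real n)) = c * real n"
    by (intro eventually_rate_inv m_log_properties[OF cm m] c) auto
  then have "\<forall>\<^sub>F n in sequentially. norm (norm (x n)) \<le> A * norm (rate_inv (m_log m) (c * real n) + 1 / real n)"
    using eventually_gt_at_top[of 0]
  proof eventually_elim
    case (elim n)
    define \<epsilon> where "\<epsilon> = rate_inv (m_log m) (c * real n)"
    have e: "0 < \<epsilon>" "\<epsilon> \<in> {0<..pi}" "\<epsilon> \<le> 1 / 2" "m \<epsilon> * ln (1 + m \<epsilon> / \<epsilon>) = c * real n" "0 < n" "0 < real n"
      using elim by (auto simp: \<epsilon>_def m_log_def)
    define q where "q = nat \<lfloor>real n / m \<epsilon>\<rfloor>"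
    note q = mult_fact_floor_le[OF e(1) m(2)[OF e(2)] c e(4,6) q_def]
    have "norm (osc_integral F n h \<epsilon>) \<le> K2 * (\<epsilon> + m \<epsilon> * (fact q * (m \<epsilon> / real n) ^ q))"
      by (rule K2(2)[OF e(1,3,5) q(1)])
    also have "\<dots> \<le> K2 * (\<epsilon> + exp 2 / (1 - c) * \<epsilon>)"
      using K2(1) q(2) by (intro mult_left_mono add_left_mono) auto
    finally have "norm (osc_integral F n h \<epsilon>) + K1 * \<epsilon> \<le> A * \<epsilon>"
      by (simp add: A_def algebra_simps)
    moreover have "1 * norm (x n) \<le> 2 * pi * norm (x n)"
      using pi_gt3 by (intro mult_right_mono) auto
    ultimately have "norm (x n) \<le> A * \<epsilon>"
      using K1(2)[OF e(1,3), of n] by simp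
    also have "\<dots> \<le> A * (\<epsilon> + 1 / real n)"
      unfolding A_def using K1(1) K2(1) c by (intro mult_left_mono add_nonneg_nonneg mult_nonneg_nonneg) auto
    finally show ?case
      using e(1) unfolding \<epsilon>_def[symmetric] by simp
  qed
  then show ?thesis
    by (rule bigoI)
qed

theorem theorem2p1:
  fixes x :: "nat \<Rightarrow> 'a::complex_banach" and F :: "complex \<Rightarrow> 'a"
  assumes "bounded (range x)"
    and "bounded (range (\<lambda>n. \<Sum>k\<le>n. x k))"
    and "boundary_function (G_transform x) F"
  shows "x \<longlonglongrightarrow> 0 \<and>
    (\<forall>m :: real \<Rightarrow> real.
      continuous_on {0<..pi} m \<longrightarrow>
      antimono_on {0<..pi} m \<longrightarrow>
      (\<forall>\<epsilon>\<in>{0<..pi}. 1 \<le> m \<epsilon>) \<longrightarrow>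
      (\<forall>k\<ge>1. F \<in> C_k k \<longrightarrow>
        (\<exists>C>0. \<forall>\<theta> j l. 0 < \<bar>\<theta>\<bar> \<longrightarrow> \<bar>\<theta>\<bar> \<le> pi \<longrightarrow> j \<le> l \<longrightarrow> l \<le> k \<longrightarrow>
           norm (circle_derivs j F (cis \<theta>)) \<le> C * \<bar>\<theta>\<bar> ^ (l - j) * m \<bar>\<theta>\<bar> ^ (l + 1)) \<longrightarrow>
        (\<forall>c>0. (\<lambda>n. norm (x n)) \<in> O(\<lambda>n. rate_inv (m_pow m k) (c * real n)))) \<and>
      (F \<in> C_infinity \<longrightarrow>
        (\<exists>C>0. \<forall>\<theta> j. 0 < \<bar>\<theta>\<bar> \<longrightarrow> \<bar>\<theta>\<bar> \<le> pi \<longrightarrow>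
           norm (circle_derivs j F (cis \<theta>)) \<le> C * fact j * \<bar>\<theta>\<bar> * m \<bar>\<theta>\<bar> ^ (j + 1)) \<longrightarrow>
        (\<forall>c. 0 < c \<longrightarrow> c < 1 \<longrightarrow>
          (\<lambda>n. norm (x n)) \<in> O(\<lambda>n. rate_inv (m_log m) (c * real n) + 1 / real n))))"
proof (intro conjI allI impI ballI)
  show "x \<longlonglongrightarrow> 0"
    by (rule tendsto_zero_of_boundary_function[OF assms])
next
  fix m :: "real \<Rightarrow> real" and k :: nat and c :: real
  assume m: "continuous_on {0<..pi} m" "antimono_on {0<..pi} m" "\<forall>\<epsilon>\<in>{0<..pi}. 1 \<le> m \<epsilon>"
    and k: "1 \<le> k" "F \<in> C_k k"
    and bnd: "\<exists>C>0. \<forall>\<theta> j l. 0 < \<bar>\<theta>\<bar> \<longrightarrow> \<bar>\<theta>\<bar> \<le> pi \<longrightarrow> j \<le> l \<longrightarrow> l \<le> k \<longrightarrow>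
           norm (circle_derivs j F (cis \<theta>)) \<le> C * \<bar>\<theta>\<bar> ^ (l - j) * m \<bar>\<theta>\<bar> ^ (l + 1)"
    and c: "0 < c"
  from bnd obtain C where "C > 0" "\<And>\<theta> j. 0 < \<bar>\<theta>\<bar> \<Longrightarrow> \<bar>\<theta>\<bar> \<le> pi \<Longrightarrow> j \<le> k \<Longrightarrow>
      norm (circle_derivs j F (cis \<theta>)) \<le> C * \<bar>\<theta>\<bar> ^ (k - j) * m \<bar>\<theta>\<bar> ^ (k + 1)"
    by blast
  then show "(\<lambda>n. norm (x n)) \<in> O(\<lambda>n. rate_inv (m_pow m k) (c * real n))"
    using m c k by (intro decay_rate_pow[OF assms]) auto
next
  fix m :: "real \<Rightarrow> real" and c :: real
  assume m: "continuous_on {0<..pi} m" "antimono_on {0<..pi} m" "\<forall>\<epsilon>\<in>{0<..pi}. 1 \<le> m \<epsilon>"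
    and F: "F \<in> C_infinity"
    and bnd: "\<exists>C>0. \<forall>\<theta> j. 0 < \<bar>\<theta>\<bar> \<longrightarrow> \<bar>\<theta>\<bar> \<le> pi \<longrightarrow>
           norm (circle_derivs j F (cis \<theta>)) \<le> C * fact j * \<bar>\<theta>\<bar> * m \<bar>\<theta>\<bar> ^ (j + 1)"
    and c: "0 < c" "c < 1"
  from bnd obtain C where "C > 0" "\<And>\<theta> j. 0 < \<bar>\<theta>\<bar> \<Longrightarrow> \<bar>\<theta>\<bar> \<le> pi \<Longrightarrow>
      norm (circle_derivs j F (cis \<theta>)) \<le> C * fact j * \<bar>\<theta>\<bar> * m \<bar>\<theta>\<bar> ^ (j + 1)"
    by blast
  then show "(\<lambda>n. norm (x n)) \<in> O(\<lambda>n. rate_inv (m_log m) (c * real n) + 1 / real n)"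
    using m c F by (intro decay_rate_log[OF assms]) auto
qed

end
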